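(* Let $u:\mathbb{H}^1\to\mathbb{R}$ be a smooth pluriharmonic function and consider the CR manifold $(\mathbb{H}^1, e^{u}\theta)$, where $\theta$ is the standard contact form on $\mathbb{H}^1$. Assume that $(\mathbb{H}^1,e^u\theta)$ is complete, that its $Q'$-curvature satisfies $Q'\ge 0$, that its Webster scalar curvature is nonnegative near infinity, i.e. $-\Delta_b u\ge |\nabla_b u|^2$ outside some compact set, and that $$\int_{\mathbb{H}^1} Q' e^{4u}\,\theta\wedge d\theta < c'_1 .$$ Then the isoperimetric inequality holds: there is a constant $C$, depending only on $\int_{\mathbb{H}^1} Q' e^{4u}\,\theta\wedge d\theta$, such that for every bounded domain $\Omega\subset\mathbb{H}^1$ with smooth boundary, $$\mathrm{Vol}(\Omega)\le C\,\mathrm{Area}(\partial\Omega)^{4/3}.$$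
   Context: $\mathbb{H}^1=\mathbb{C}\times\mathbb{R}$ with coordinates $(z,t)$, $z=x+iy$, and group law $(z,t)\cdot(w,s)=(z+w,\,t+s+2\,\mathrm{Im}(z\bar w))$. Its left-invariant vector fields are $X=\partial_x+2y\partial_t$, $Y=\partial_y-2x\partial_t$, $T=\partial_t$; the standard contact form is $\theta=dt+2(x\,dy-y\,dx)$ (so $\theta(X)=\theta(Y)=0$, $\theta(T)=1$), and $dv=\theta\wedge d\theta$ is (a multiple of) Lebesgue/Haar measure. $\Delta_b=X^2+Y^2$, $\nabla_b u=(Xu)X+(Yu)Y$, $|\nabla_b u|^2=(Xu)^2+(Yu)^2$. A real function $u$ is pluriharmonic if locally it is the real part of a CR function $f$ (i.e. $(X+iY)f=0$). On $\mathbb{H}^1$ the CR covariant operator on pluriharmonic functions is $P'u=2\Delta_b^2u$, and the $Q'$-curvature of $e^u\theta$ (for $u$ pluriharmonic) is defined by $P'u=Q'e^{4u}$. The homogeneous norm is $\rho(z,t)=(|z|^4+t^2)^{1/4}$, and $c'_1>0$ is the normalizing constant of the fundamental solution of $P'$ on pluriharmonic functions, namely $\frac{1}{c'_1}\log\frac{1}{\rho(q^{-1}p)}$ is the fundamental solution of $P'$ (its image under $P'$ is the real part of the Szegő kernel). The volume and area are those associated to the conformal factor: $\mathrm{Vol}(\Omega)=\int_\Omega e^{4u}\,dv$ and $\mathrm{Area}(\partial\Omega)=\int_{\partial\Omega}e^{3u}\,d\sigma$, where $d\sigma$ is the horizontal perimeter measure of $\partial\Omega$ (the total variation measure $|\nabla_b\chi_\Omega|$);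 the homogeneous dimension of $\mathbb{H}^1$ is $4$. *)

theory Defs
  imports "HOL-Analysis.Analysis"
begin

text \<open>Points of the Heisenberg group H^1 are triples (x, y, t), with z = x + iy.\<close>
type_synonym hpt = "real \<times> real \<times> real"

definition hx :: "hpt \<Rightarrow> real" where "hx p = fst p"
definition hy :: "hpt \<Rightarrow> real" where "hy p = fst (snd p)"
definition ht :: "hpt \<Rightarrow> real" where "ht p = snd (snd p)"

text \<open>Group law (z,t).(w,s) = (z+w, t+s+2 Im(z conj w)) and inverse.\<close>
definition hmult :: "hpt \<Rightarrow> hpt \<Rightarrow> hpt" where
  "hmult p q = (hx p + hx q, hy p + hy q,
      ht p + ht q + 2 * (hy p * hx q - hx p * hy q))"
definition hinv :: "hpt \<Rightarrow> hpt" where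
  "hinv p = (- hx p, - hy p, - ht p)"

definition hnorm :: "hpt \<Rightarrow> real" where
  "hnorm p = ((hx p ^ 2 + hy p ^ 2) ^ 2 + ht p ^ 2) powr (1/4)"

text \<open>Left-invariant vector fields X = d_x + 2y d_t, Y = d_y - 2x d_t, as vectors at p.\<close>
definition Xvec :: "hpt \<Rightarrow> hpt" where "Xvec p = (1, 0, 2 * hy p)"
definition Yvec :: "hpt \<Rightarrow> hpt" where "Yvec p = (0, 1, - 2 * hx p)"

definition Xd :: "(hpt \<Rightarrow> 'b::real_normed_vector) \<Rightarrow> hpt \<Rightarrow> 'b" where
  "Xd f p = frechet_derivative f (at p) (Xvec p)"
definition Yd :: "(hpt \<Rightarrow> 'b::real_normed_vector) \<Rightarrow> hpt \<Rightarrow> 'b" where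
  "Yd f p = frechet_derivative f (at p) (Yvec p)"

definition ddir :: "hpt \<Rightarrow> (hpt \<Rightarrow> 'b::real_normed_vector) \<Rightarrow> hpt \<Rightarrow> 'b" where
  "ddir v f = (\<lambda>p. frechet_derivative f (at p) v)"

definition smooth_on :: "hpt set \<Rightarrow> (hpt \<Rightarrow> 'b::real_normed_vector) \<Rightarrow> bool" where
  "smooth_on U f \<longleftrightarrow> (\<forall>vs::hpt list. \<forall>p\<in>U. (fold ddir vs f) differentiable (at p))"

abbreviation smooth :: "(hpt \<Rightarrow> 'b::real_normed_vector) \<Rightarrow> bool" where
  "smooth f \<equiv> smooth_on UNIV f"

definition test_fun :: "(hpt \<Rightarrow> 'b::real_normed_vector) \<Rightarrow> bool" where
  "test_fun f \<longleftrightarrow> smooth f \<and> bounded {p. f p \<noteq> 0}"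

definition sublap :: "(hpt \<Rightarrow> real) \<Rightarrow> hpt \<Rightarrow> real" where
  "sublap u p = Xd (Xd u) p + Yd (Yd u) p"
definition grad_b_sq :: "(hpt \<Rightarrow> real) \<Rightarrow> hpt \<Rightarrow> real" where
  "grad_b_sq u p = (Xd u p)^2 + (Yd u p)^2"
definition Pprime :: "(hpt \<Rightarrow> real) \<Rightarrow> hpt \<Rightarrow> real" where
  "Pprime u p = 2 * sublap (sublap u) p"
definition Qprime :: "(hpt \<Rightarrow> real) \<Rightarrow> hpt \<Rightarrow> real" where
  "Qprime u p = Pprime u p / exp (4 * u p)"

text \<open>The volume form dv = theta \<and> d theta = 4 dx dy dt.\<close>
definition dv :: "hpt measure" where
  "dv = density lborel (\<lambda>_. 4)"

definition pluriharmonic :: "(hpt \<Rightarrow> real) \<Rightarrow> bool" where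
  "pluriharmonic u \<longleftrightarrow> (\<forall>p. \<exists>U. open U \<and> p \<in> U \<and>
     (\<exists>f :: hpt \<Rightarrow> complex. smooth_on U f \<and>
        (\<forall>q\<in>U. Re (f q) = u q \<and> Xd f q + \<i> * Yd f q = 0)))"

text \<open>Carnot-Caratheodory distance of the pseudohermitian structure e^u theta:
  horizontal C^1 curves gamma' = a X + b Y, length element e^(u/2) sqrt(a^2+b^2)
  (the Levi form of e^u theta is e^u times that of theta).\<close>
definition horiz_curve :: "(real \<Rightarrow> hpt) \<Rightarrow> (real \<Rightarrow> real) \<Rightarrow> (real \<Rightarrow> real) \<Rightarrow> bool" where
  "horiz_curve \<gamma> a b \<longleftrightarrow> continuous_on {0..1} a \<and> continuous_on {0..1} b \<and>
     (\<forall>s\<in>{0..1}. (\<gamma> has_vector_derivative (a s *\<^sub>R Xvec (\<gamma> s) + b s *\<^sub>R Yvec (\<gamma> s)))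
                    (at s within {0..1}))"

definition cc_length :: "(hpt \<Rightarrow> real) \<Rightarrow> (real \<Rightarrow> hpt) \<Rightarrow> (real \<Rightarrow> real) \<Rightarrow> (real \<Rightarrow> real) \<Rightarrow> real" where
  "cc_length u \<gamma> a b = integral {0..1} (\<lambda>s. exp (u (\<gamma> s) / 2) * sqrt ((a s)^2 + (b s)^2))"

definition cc_dist :: "(hpt \<Rightarrow> real) \<Rightarrow> hpt \<Rightarrow> hpt \<Rightarrow> real" where
  "cc_dist u p q = Inf {L. \<exists>\<gamma> a b. horiz_curve \<gamma> a b \<and> \<gamma> 0 = p \<and> \<gamma> 1 = q \<and> L = cc_length u \<gamma> a b}"

definition complete_cr :: "(hpt \<Rightarrow> real) \<Rightarrow> bool" where
  "complete_cr u \<longleftrightarrow> (\<forall>s :: nat \<Rightarrow> hpt.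
     (\<forall>e>0. \<exists>N. \<forall>m\<ge>N. \<forall>n\<ge>N. cc_dist u (s m) (s n) < e) \<longrightarrow>
     (\<exists>l. (\<lambda>n. cc_dist u (s n) l) \<longlonglongrightarrow> 0))"

text \<open>The normalising constant c'_1: (1/c'_1) log(1/rho(q^-1 p)) is the fundamental
  solution of P' on pluriharmonic functions, i.e. its image under P' is the real part of
  the Szego kernel. Tested against real test functions phi (P' is formally self-adjoint):
  (1/c) \<integral> log(1/rho(q^-1 p)) P'phi(p) dv(p) = Re (S phi)(q) for a.e. q, where S is the
  Szego projection, the orthogonal projection of L^2(dv) onto the closed subspace of
  L^2 CR functions ((X + iY) g = 0 weakly).\<close>
definition L2_CR :: "(hpt \<Rightarrow> complex) set" where
  "L2_CR = {g. g \<in> borel_measurable lborel \<and> integrable lborel (\<lambda>p. (cmod (g p))^2) \<and>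
     (\<forall>\<psi> :: hpt \<Rightarrow> complex. test_fun \<psi> \<longrightarrow>
        integral\<^sup>L dv (\<lambda>p. g p * (Xd \<psi> p + \<i> * Yd \<psi> p)) = 0)}"

definition is_szego_proj :: "(hpt \<Rightarrow> real) \<Rightarrow> (hpt \<Rightarrow> complex) \<Rightarrow> bool" where
  "is_szego_proj \<phi> g \<longleftrightarrow> g \<in> L2_CR \<and>
     (\<forall>h\<in>L2_CR. integral\<^sup>L dv (\<lambda>p. (complex_of_real (\<phi> p) - g p) * cnj (h p)) = 0)"

definition c1' :: real where
  "c1' = (THE c. c > 0 \<and>
     (\<forall>\<phi> :: hpt \<Rightarrow> real. \<forall>g. test_fun \<phi> \<longrightarrow> is_szego_proj \<phi> g \<longrightarrow>
        (AE q in lborel. (1 / c) * integral\<^sup>L dv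
            (\<lambda>p. ln (1 / hnorm (hmult (hinv q) p)) * Pprime \<phi> p) = Re (g q))))"

definition smooth_bounded_domain :: "hpt set \<Rightarrow> bool" where
  "smooth_bounded_domain \<Omega> \<longleftrightarrow> open \<Omega> \<and> connected \<Omega> \<and> \<Omega> \<noteq> {} \<and> bounded \<Omega> \<and>
     (\<forall>p\<in>frontier \<Omega>. \<exists>U r. open U \<and> p \<in> U \<and> smooth_on U (r :: hpt \<Rightarrow> real) \<and>
        (\<forall>q\<in>U. frechet_derivative r (at q) \<noteq> (\<lambda>_. 0)) \<and>
        \<Omega> \<inter> U = {q\<in>U. r q < 0})"

text \<open>Volume and area for the conformal factor e^u:
  Vol(Omega) = \<integral>_Omega e^(4u) dv,
  Area(dOmega) = \<integral> e^(3u) d|\<nabla>_b chi_Omega|, the e^(3u)-weighted total variation of the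
  horizontal distributional gradient of chi_Omega (w.r.t. dv).\<close>
definition vol_u :: "(hpt \<Rightarrow> real) \<Rightarrow> hpt set \<Rightarrow> real" where
  "vol_u u \<Omega> = integral\<^sup>L dv (\<lambda>p. indicator \<Omega> p * exp (4 * u p))"

definition area_u :: "(hpt \<Rightarrow> real) \<Rightarrow> hpt set \<Rightarrow> real" where
  "area_u u \<Omega> = Sup {integral\<^sup>L dv (\<lambda>p. indicator \<Omega> p * (Xd \<phi>1 p + Yd \<phi>2 p)) | \<phi>1 \<phi>2.
       test_fun (\<phi>1 :: hpt \<Rightarrow> real) \<and> test_fun (\<phi>2 :: hpt \<Rightarrow> real) \<and>
       (\<forall>p. (\<phi>1 p)^2 + (\<phi>2 p)^2 \<le> (exp (3 * u p))^2)}"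

end

theory Submission
  imports Defs
begin

text \<open>The hypotheses are rigid: they force \<open>u\<close> to be constant. A pluriharmonic \<open>u\<close> satisfies the
  third-order equations \<open>X \<Delta>\<^sub>b u = 4 T Y u\<close> and \<open>Y \<Delta>\<^sub>b u = - 4 T X u\<close>, whence \<open>P' u = - 32 T\<^sup>2 u\<close>; so
  \<open>Q' \<ge> 0\<close> makes \<open>v = - T\<^sup>2 u\<close> a nonnegative integrable pluriharmonic function, and testing its equation
  against dilates of a cubic polynomial gives \<open>\<integral>v = 0\<close>. Thus \<open>u\<close> is affine in \<open>t\<close>; letting \<open>t \<rightarrow> \<infinity>\<close> in
  \<open>- \<Delta>\<^sub>b u \<ge> |\<nabla>\<^sub>b u|\<^sup>2\<close> shows that \<open>T u\<close> and \<open>\<Delta>\<^sub>b u\<close> are constant and that \<open>\<nabla>\<^sub>b u\<close> is bounded, and one more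
  test with dilated cutoffs gives \<open>\<Delta>\<^sub>b u = 0\<close>, hence \<open>\<nabla>\<^sub>b u = 0\<close>.

  For constant \<open>u\<close> the inequality is the isoperimetric inequality of the Heisenberg group, proved by
  duality: \<open>\<Delta>\<^sub>b\<close> of \<open>((|z|\<^sup>2 + \<epsilon>)\<^sup>2 + t\<^sup>2)\<close> to the power \<open>-1/2\<close> approximates a point mass, and averaging its
  horizontal gradient over left translates by points of \<open>\<Omega>\<close> yields a horizontal field of size at most
  a constant times \<open>|\<Omega>|\<close> to the power \<open>1/4\<close> whose divergence has integral at least \<open>|\<Omega>| / 2\<close> over \<open>\<Omega>\<close>.\<close>

section \<open>Smooth functions\<close>

text \<open>Pluriharmonicity provides a conjugate function only locally. The third-order equations
  eliminate it and hold globally, so they can be tested against compactly supported functions; since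
  T is central, they pass to T^2 u. A cubic is the right test polynomial because the operator is
  homogeneous of order three: its adjoint sends x^3 to a nonzero constant, and the scaling factor of
  the dilation is common to all terms and drops out.

  \<open>area_u\<close> is a supremum of reals, and a lower bound for it can be read off one
  competing field only if the set is bounded above. This is why finite perimeter of smooth bounded
  domains has to be proved, characteristic boundary points included.

  The average of translated kernels is taken over a finite net in a compact part of \<Omega>, not as
  an integral over \<Omega>: the field is then a finite sum, differentiable term by term, at the
  price of a small loss in the bound of its size. Polar coordinates are avoided; the kernel is
  dominated by a product of powers of the coordinates, and this produces the constants 1024, 1026
  and 1027.\<close>

declare split_paired_All [simp del] split_paired_Ex [simp del]

lemma smooth_on_differentiable: "smooth_on U f \<Longrightarrow> p \<in> U \<Longrightarrow> f differentiable (at p)"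
  unfolding smooth_on_def by (metis fold_simps(1))

lemma smooth_on_ddir: "smooth_on U f \<Longrightarrow> smooth_on U (ddir v f)"
  unfolding smooth_on_def by (metis fold_simps(2))

text \<open>\<open>smooth_on\<close> quantifies over all finite lists of directions. An invariant
  \<open>P\<close> that gives differentiability and survives one \<open>ddir\<close> reduces this to
  a single derivative, so later proofs only exhibit a class of functions closed under
  \<open>ddir\<close>.\<close>

lemma smooth_on_coinduct:
  assumes "P f"
    and "\<And>f p. P f \<Longrightarrow> p \<in> U \<Longrightarrow> f differentiable (at p)"
    and "\<And>f v. P f \<Longrightarrow> P (ddir v f)"
  shows "smooth_on U f"
proof -
  have "P (fold ddir vs f)" for vs using assms(1)
    by (induction vs arbitrary: f) (auto intro: assms(3))
  then show ?thesis unfolding smooth_on_def using assms(2) by blast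
qed

lemma differentiable_cong_open:
  assumes "open U" "p \<in> U" "\<And>q. q \<in> U \<Longrightarrow> f q = g q" "f differentiable (at p)"
  shows "g differentiable (at p)"
proof -
  obtain D where "(f has_derivative D) (at p)" using assms(4) unfolding differentiable_def by blast
  then have "(g has_derivative D) (at p)"
    by (rule has_derivative_transform_within_open[OF _ assms(1,2)]) (use assms(3) in auto)
  then show ?thesis unfolding differentiable_def by blast
qed

lemma ddir_cong_open:
  assumes "open U" "p \<in> U" "\<And>q. q \<in> U \<Longrightarrow> f q = g q"
  shows "ddir v f p = ddir v g p"
proof -
  have "(f has_derivative D) (at p) \<longleftrightarrow> (g has_derivative D) (at p)" for D
  proof
    show "(g has_derivative D) (at p)" if "(f has_derivative D) (at p)"
      by (rule has_derivative_transform_within_open[OF that assms(1,2)]) (use assms(3) in auto)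
    show "(f has_derivative D) (at p)" if "(g has_derivative D) (at p)"
      by (rule has_derivative_transform_within_open[OF that assms(1,2)]) (use assms(3) in auto)
  qed
  then show ?thesis unfolding ddir_def frechet_derivative_def by simp
qed

lemma smooth_on_cong:
  assumes "open U" "smooth_on U f" "\<And>q. q \<in> U \<Longrightarrow> f q = g q"
  shows "smooth_on U g"
\<comment> \<open>The invariant is agreement on \<open>U\<close> with some smooth function, since
  values of \<open>ddir\<close> outside \<open>U\<close> are not controlled.\<close>
proof (rule smooth_on_coinduct[where P = "\<lambda>g. \<exists>f. smooth_on U f \<and> (\<forall>q\<in>U. f q = g q)"])
  fix g v assume "\<exists>f. smooth_on U f \<and> (\<forall>q\<in>U. f q = g q)"
  then obtain f where f: "smooth_on U f" "\<forall>q\<in>U. f q = g q" by blast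
  then have "\<forall>q\<in>U. ddir v f q = ddir v g q"
    using ddir_cong_open[OF assms(1)] by blast
  then show "\<exists>f. smooth_on U f \<and> (\<forall>q\<in>U. f q = ddir v g q)"
    using smooth_on_ddir[OF f(1)] by blast
qed (use assms differentiable_cong_open[OF assms(1)] smooth_on_differentiable in blast)+

lemma smooth_on_subset: "smooth_on U f \<Longrightarrow> V \<subseteq> U \<Longrightarrow> smooth_on V f"
  unfolding smooth_on_def by blast

lemma has_derivative_ddir: "(f has_derivative D) (at p) \<Longrightarrow> ddir v f p = D v"
  unfolding ddir_def by (metis frechet_derivative_at)

lemma differentiable_has_derivative_ddir:
  "f differentiable (at p) \<Longrightarrow> (f has_derivative (\<lambda>v. ddir v f p)) (at p)"
  unfolding ddir_def by (simp add: frechet_derivative_works)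

lemma ddir_const [simp]: "ddir v (\<lambda>p. c) = (\<lambda>p. 0)"
  unfolding ddir_def by simp

lemma smooth_on_const [simp]: "smooth_on U (\<lambda>p. c)"
  by (rule smooth_on_coinduct[where P = "\<lambda>f. \<exists>c. f = (\<lambda>p. c)"]) auto

lemma bounded_linear_smooth_on:
  assumes "bounded_linear L"
  shows "smooth_on U L"
proof (rule smooth_on_coinduct[where P = "\<lambda>f. bounded_linear f \<or> (\<exists>c. f = (\<lambda>p. c))"])
  fix f :: "hpt \<Rightarrow> 'a" and v assume "bounded_linear f \<or> (\<exists>c. f = (\<lambda>p. c))"
  then show "bounded_linear (ddir v f) \<or> (\<exists>c. ddir v f = (\<lambda>p. c))"
    by (auto simp: ddir_def frechet_derivative_at[OF bounded_linear_imp_has_derivative, symmetric])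
qed (use assms in \<open>auto intro: bounded_linear_imp_differentiable\<close>)

lemma bounded_linear_coords [simp]: "bounded_linear hx" "bounded_linear hy" "bounded_linear ht"
  unfolding hx_def[abs_def] hy_def[abs_def] ht_def[abs_def]
  by (intro bounded_linear_fst bounded_linear_fst_comp bounded_linear_snd_comp bounded_linear_snd)+

lemmas smooth_on_coords [simp] = bounded_linear_coords[THEN bounded_linear_smooth_on]

lemma ddir_coords [simp]: "ddir v hx = (\<lambda>p. hx v)" "ddir v hy = (\<lambda>p. hy v)" "ddir v ht = (\<lambda>p. ht v)"
  by (auto simp: fun_eq_iff intro!: has_derivative_ddir bounded_linear_imp_has_derivative)

lemma ddir_bounded_linear_comp:
  assumes "bounded_linear L" "f differentiable (at p)"
  shows "ddir v (\<lambda>p. L (f p)) p = L (ddir v f p)"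
  by (rule has_derivative_ddir[where D="\<lambda>v. L (ddir v f p)"])
    (intro bounded_linear.has_derivative[OF assms(1)] differentiable_has_derivative_ddir assms)

lemma smooth_on_bounded_linear_comp:
  assumes "open U" "bounded_linear L" "smooth_on U f"
  shows "smooth_on U (\<lambda>p. L (f p))"
proof (rule smooth_on_coinduct[where P = "\<lambda>g. \<exists>f. smooth_on U f \<and> (\<forall>q\<in>U. L (f q) = g q)"])
  fix g v assume "\<exists>f. smooth_on U f \<and> (\<forall>q\<in>U. L (f q) = g q)"
  then obtain f where f: "smooth_on U f" "\<forall>q\<in>U. L (f q) = g q" by blast
  then have "\<forall>q\<in>U. L (ddir v f q) = ddir v g q"
    using ddir_cong_open[OF assms(1), of _ "\<lambda>q. L (f q)" g]
      ddir_bounded_linear_comp[OF assms(2)] smooth_on_differentiable by metis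
  then show "\<exists>f. smooth_on U f \<and> (\<forall>q\<in>U. L (f q) = ddir v g q)"
    using smooth_on_ddir[OF f(1)] by blast
next
  fix g p assume p: "p \<in> U" and "\<exists>f. smooth_on U f \<and> (\<forall>q\<in>U. L (f q) = g q)"
  then obtain f where f: "smooth_on U f" "\<forall>q\<in>U. L (f q) = g q" by blast
  have "(\<lambda>q. L (f q)) differentiable (at p)"
    using bounded_linear.has_derivative[OF assms(2)
        differentiable_has_derivative_ddir[OF smooth_on_differentiable[OF f(1) p]]]
    unfolding differentiable_def by blast
  then show "g differentiable (at p)"
    using differentiable_cong_open[OF assms(1) p, of "\<lambda>q. L (f q)" g] f(2) by blast
qed (use assms in blast)

lemma smooth_on_continuous_on: "smooth_on U f \<Longrightarrow> continuous_on U f"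
  by (meson continuous_at_imp_continuous_on differentiable_imp_continuous_within smooth_on_differentiable)

lemma ddir_arith:
  assumes "f differentiable (at p)" "g differentiable (at p)"
  shows "ddir v (\<lambda>p. f p + g p) p = ddir v f p + ddir v g p"
    "ddir v (\<lambda>p. f p - g p) p = ddir v f p - ddir v g p"
  by (rule has_derivative_ddir[where v=v], intro has_derivative_add has_derivative_diff
      differentiable_has_derivative_ddir assms)+

lemma ddir_mult:
  fixes f g :: "hpt \<Rightarrow> real"
  assumes "f differentiable (at p)" "g differentiable (at p)"
  shows "ddir v (\<lambda>p. f p * g p) p = f p * ddir v g p + ddir v f p * g p"
  by (rule has_derivative_ddir[where v=v], intro has_derivative_mult
      differentiable_has_derivative_ddir assms)

lemma has_derivative_DERIV_comp:
  fixes f :: "hpt \<Rightarrow> real"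
  assumes "f differentiable (at p)" "DERIV h (f p) :> d"
  shows "((\<lambda>p. h (f p)) has_derivative (\<lambda>v. d * ddir v f p)) (at p)"
  using has_derivative_compose[OF differentiable_has_derivative_ddir[OF assms(1)], of h "(*) d"]
    assms(2) unfolding has_field_derivative_def by simp

lemma differentiable_DERIV_comp:
  fixes f :: "hpt \<Rightarrow> real"
  assumes "f differentiable (at p)" "DERIV h (f p) :> d"
  shows "(\<lambda>p. h (f p)) differentiable (at p)"
  using has_derivative_DERIV_comp[OF assms] unfolding differentiable_def by blast

lemma ddir_DERIV_comp:
  fixes f :: "hpt \<Rightarrow> real"
  assumes "f differentiable (at p)" "DERIV h (f p) :> d"
  shows "ddir v (\<lambda>p. h (f p)) p = d * ddir v f p"
  using has_derivative_ddir[OF has_derivative_DERIV_comp[OF assms]] .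

text \<open>The family \<open>flat n\<close> is closed under differentiation up to linear combinations, so that closure
  under composition with it can be proved coinductively.\<close>
definition flat :: "nat \<Rightarrow> real \<Rightarrow> real" where
  "flat n x = (if x > 0 then inverse x ^ n * exp (- inverse x) else 0)"

lemma flat_nonneg [simp]: "flat n x \<ge> 0" unfolding flat_def by simp
lemma flat_pos_iff [simp]: "flat n x > 0 \<longleftrightarrow> x > 0" unfolding flat_def by simp
lemma flat_eq_0 [simp]: "x \<le> 0 \<Longrightarrow> flat n x = 0" unfolding flat_def by simp
lemma flat_0_le_1: "flat 0 x \<le> 1" unfolding flat_def by simp

lemma flat_tendsto_0: "flat n \<midarrow>0\<rightarrow> 0"
proof -
  have "((\<lambda>x. inverse x ^ n / exp (inverse x)) \<longlongrightarrow> (0::real)) (at_right 0)"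
    by (rule filterlim_compose[OF tendsto_power_div_exp_0 filterlim_inverse_at_top_right])
  then have "(flat n \<longlongrightarrow> 0) (at_right 0)"
    by (rule Lim_transform_eventually)
      (auto simp: flat_def exp_minus divide_inverse eventually_at_right_less intro!: eventually_mono[OF eventually_at_right_less])
  moreover have "(flat n \<longlongrightarrow> 0) (at_left 0)"
    by (rule tendsto_eventually) (auto simp: eventually_at_left_field intro!: exI[of _ "-1"])
  ultimately show ?thesis by (simp add: filterlim_split_at)
qed

lemma DERIV_flat: "DERIV (flat n) x :> flat (n + 2) x - real n * flat (n + 1) x"
proof -
  consider "x < 0" | "x > 0" | "x = 0" by linarith
  then show ?thesis
  proof cases
    case 1
    have "DERIV (\<lambda>x::real. 0) x :> 0" by simp
    then have "DERIV (flat n) x :> 0"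
      by (rule has_field_derivative_transform_within_open[where S="{..<0}"]) (use 1 in auto)
    then show ?thesis using 1 by simp
  next
    case 2
    have "DERIV (\<lambda>x. inverse x ^ n * exp (- inverse x)) x :> flat (n + 2) x - real n * flat (n + 1) x"
    proof -
      \<comment> \<open>At \<open>n = 0\<close> the truncated exponent \<open>n - Suc 0\<close> is
        harmless because of the factor \<open>real n\<close>.\<close>
      have *: "real n * inverse x ^ (n - Suc 0) = real n * (inverse x ^ n * x)"
        using 2 by (cases n) auto
      show ?thesis
      using 2 * by (auto intro!: derivative_eq_intros simp: flat_def algebra_simps power2_eq_square)
    qed
    then show ?thesis
      by (rule has_field_derivative_transform_within_open[where S="{0<..}"])
        (use 2 in \<open>auto simp: flat_def\<close>)
  next
    case 3
    \<comment> \<open>The difference quotient of \<open>flat n\<close> at 0 is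
      \<open>flat (Suc n)\<close>, so the preceding limit lemma gives the derivative 0
      there.\<close>
    have "(\<lambda>h. flat n (0 + h) / h) \<midarrow>0\<rightarrow> 0"
      by (rule Lim_transform_eventually[OF flat_tendsto_0[of "Suc n"]])
        (auto simp: flat_def eventually_at_filter divide_inverse)
    then show ?thesis using 3 by (simp add: DERIV_def)
  qed
qed

text \<open>Differentiating a quotient, a root or a \<open>flat n\<close> produces sums and products
  of the other constructors, so all closure properties are generated together and shown stable under
  \<open>ddir\<close> in one induction. The rule \<open>cong\<close> enters because the derivative
  formulas hold on \<open>U\<close> only.\<close>

inductive smooth_alg :: "hpt set \<Rightarrow> (hpt \<Rightarrow> real) \<Rightarrow> bool" for U where
  base: "smooth_on U f \<Longrightarrow> smooth_alg U f"
| add: "smooth_alg U f \<Longrightarrow> smooth_alg U g \<Longrightarrow> smooth_alg U (\<lambda>p. f p + g p)"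
| mult: "smooth_alg U f \<Longrightarrow> smooth_alg U g \<Longrightarrow> smooth_alg U (\<lambda>p. f p * g p)"
| inverse: "smooth_alg U f \<Longrightarrow> (\<And>p. p \<in> U \<Longrightarrow> f p \<noteq> 0) \<Longrightarrow> smooth_alg U (\<lambda>p. inverse (f p))"
| sqrt: "smooth_alg U f \<Longrightarrow> (\<And>p. p \<in> U \<Longrightarrow> f p > 0) \<Longrightarrow> smooth_alg U (\<lambda>p. sqrt (f p))"
| flat: "smooth_alg U f \<Longrightarrow> smooth_alg U (\<lambda>p. flat n (f p))"
| cong: "smooth_alg U f \<Longrightarrow> (\<And>p. p \<in> U \<Longrightarrow> f p = g p) \<Longrightarrow> smooth_alg U g"

lemma smooth_alg_step:
  assumes "open U" "smooth_alg U f"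
  shows "(\<forall>p\<in>U. f differentiable (at p)) \<and> (\<forall>v. smooth_alg U (ddir v f))"
  using assms(2)
proof induction
  case (base f)
  then show ?case by (auto intro: smooth_on_differentiable smooth_on_ddir smooth_alg.base)
next
  case (add f g)
  have "smooth_alg U (ddir v (\<lambda>p. f p + g p))" for v
    by (rule smooth_alg.cong[OF smooth_alg.add]) (use add in \<open>auto simp: ddir_arith\<close>)
  with add show ?case by auto
next
  case (mult f g)
  have "smooth_alg U (ddir v (\<lambda>p. f p * g p))" for v
    by (rule smooth_alg.cong[OF smooth_alg.add[OF smooth_alg.mult smooth_alg.mult]])
      (use mult in \<open>auto simp: ddir_mult\<close>)
  with mult show ?case by auto
next
  case (inverse f)
  have D: "DERIV inverse (f p) :> - (inverse (f p) * inverse (f p))" if "p \<in> U" for p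
    using DERIV_inverse'[OF DERIV_ident inverse(2)[OF that]] by simp
  have "smooth_alg U (ddir v (\<lambda>p. inverse (f p)))" for v
    by (rule smooth_alg.cong[OF smooth_alg.mult[OF smooth_alg.mult[OF smooth_alg.base[OF smooth_on_const[of U "-1"]] 
            smooth_alg.mult[OF smooth_alg.inverse smooth_alg.inverse]]]])
      (use inverse D in \<open>auto simp: ddir_DERIV_comp[OF _ D]\<close>)
  moreover have "\<forall>p\<in>U. (\<lambda>p. inverse (f p)) differentiable (at p)"
    using differentiable_DERIV_comp[OF _ D] inverse by simp
  ultimately show ?case by blast
next
  case (sqrt f)
  have D: "DERIV sqrt (f p) :> inverse (sqrt (f p)) / 2" if "p \<in> U" for p
    using DERIV_real_sqrt[OF sqrt(2)[OF that]] .
  have "smooth_alg U (ddir v (\<lambda>p. sqrt (f p)))" for v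
    by (rule smooth_alg.cong[OF smooth_alg.mult[OF smooth_alg.mult[OF smooth_alg.base[OF smooth_on_const[of U "1/2"]] 
            smooth_alg.inverse[OF smooth_alg.sqrt]]]])
      (use sqrt D in \<open>auto simp: ddir_DERIV_comp[OF _ D] less_imp_neq[symmetric] order_less_imp_not_less\<close>)
  moreover have "\<forall>p\<in>U. (\<lambda>p. sqrt (f p)) differentiable (at p)"
    using differentiable_DERIV_comp[OF _ D] sqrt by simp
  ultimately show ?case by blast
next
  case (flat f n)
  have "smooth_alg U (ddir v (\<lambda>p. flat n (f p)))" for v
  proof (rule smooth_alg.cong)
    show "smooth_alg U (\<lambda>p. (flat (n + 2) (f p) + - real n * flat (n + 1) (f p)) * ddir v f p)"
      by (rule smooth_alg.mult[OF smooth_alg.add[OF smooth_alg.flat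
            smooth_alg.mult[OF smooth_alg.base[OF smooth_on_const] smooth_alg.flat]]])
        (use flat in auto)
  qed (use flat in \<open>auto simp: ddir_DERIV_comp[OF _ DERIV_flat] algebra_simps\<close>)
  moreover have "\<forall>p\<in>U. (\<lambda>p. flat n (f p)) differentiable (at p)"
    using differentiable_DERIV_comp[OF _ DERIV_flat] flat by simp
  ultimately show ?case by blast
next
  case (cong f g)
  then have "\<forall>p\<in>U. ddir v f p = ddir v g p" for v using ddir_cong_open[OF assms(1)] by blast
  then show ?case
    using cong differentiable_cong_open[OF assms(1)] smooth_alg.cong by blast
qed

lemma smooth_alg_smooth_on:
  assumes "open U" "smooth_alg U f"
  shows "smooth_on U f"
  by (rule smooth_on_coinduct[where P="smooth_alg U"]) (use assms smooth_alg_step in auto)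

lemma smooth_on_arith:
  fixes f g :: "hpt \<Rightarrow> real"
  assumes U: "open U" and f: "smooth_on U f" and g: "smooth_on U g"
  shows "smooth_on U (\<lambda>p. f p + g p)" "smooth_on U (\<lambda>p. f p * g p)"
    "smooth_on U (\<lambda>p. f p - g p)" "smooth_on U (\<lambda>p. - f p)"
    "(\<And>p. p \<in> U \<Longrightarrow> g p \<noteq> 0) \<Longrightarrow> smooth_on U (\<lambda>p. f p / g p)"
proof -
  note s = smooth_alg_smooth_on[OF U] smooth_alg.base[OF f] smooth_alg.base[OF g]
  have g': "smooth_alg U (\<lambda>p. -1 * g p)" "smooth_alg U (\<lambda>p. -1 * f p)"
    by (rule smooth_alg.mult[OF smooth_alg.base]; use s in simp)+
  show "smooth_on U (\<lambda>p. f p + g p)" "smooth_on U (\<lambda>p. f p * g p)"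
    using s smooth_alg.add smooth_alg.mult by blast+
  show "smooth_on U (\<lambda>p. f p - g p)" "smooth_on U (\<lambda>p. - f p)"
    using s(1)[OF smooth_alg.add[OF s(2) g'(1)]] s(1)[OF g'(2)] by simp_all
  assume "\<And>p. p \<in> U \<Longrightarrow> g p \<noteq> 0"
  then show "smooth_on U (\<lambda>p. f p / g p)"
    unfolding divide_inverse using s smooth_alg.mult smooth_alg.inverse by blast
qed

lemma smooth_on_power:
  fixes f :: "hpt \<Rightarrow> real"
  assumes U: "open U" and f: "smooth_on U f"
  shows "smooth_on U (\<lambda>p. f p ^ n)"
  by (induction n) (auto intro!: smooth_on_arith assms)

lemma smooth_on_sqrt:
  assumes "open U" "smooth_on U f" "\<And>p. p \<in> U \<Longrightarrow> f p > 0"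
  shows "smooth_on U (\<lambda>p. sqrt (f p))"
  by (rule smooth_alg_smooth_on[OF assms(1) smooth_alg.sqrt[OF smooth_alg.base]]) (use assms in auto)

lemma smooth_on_flat:
  assumes "open U" "smooth_on U f"
  shows "smooth_on U (\<lambda>p. flat n (f p))"
  by (rule smooth_alg_smooth_on[OF assms(1) smooth_alg.flat[OF smooth_alg.base]]) (use assms in auto)

lemma smooth_on_sum:
  fixes f :: "'i \<Rightarrow> hpt \<Rightarrow> real"
  assumes "open U" "\<And>i. i \<in> I \<Longrightarrow> smooth_on U (f i)"
  shows "smooth_on U (\<lambda>p. \<Sum>i\<in>I. f i p)"
  using assms(2) by (induction I rule: infinite_finite_induct) (auto intro!: smooth_on_arith assms(1))

lemma ddir_linear_comb:
  assumes "f differentiable (at p)"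
  shows "ddir (a *\<^sub>R v + b *\<^sub>R w) f p = a *\<^sub>R ddir v f p + b *\<^sub>R ddir w f p"
  using linear_frechet_derivative[OF assms] unfolding ddir_def
  by (simp add: linear_add linear_scale)

section \<open>Left-invariant derivatives and pluriharmonic functions\<close>

lemma ddir_line_DERIV:
  fixes f :: "hpt \<Rightarrow> real"
  assumes "f differentiable (at (a + s *\<^sub>R v))"
  shows "DERIV (\<lambda>s. f (a + s *\<^sub>R v)) s :> ddir v f (a + s *\<^sub>R v)"
proof -
  have "((\<lambda>s. f (a + s *\<^sub>R v)) has_derivative (\<lambda>h. ddir (h *\<^sub>R v) f (a + s *\<^sub>R v))) (at s)"
    by (rule has_derivative_compose[where f="\<lambda>s. a + s *\<^sub>R v",
          OF _ differentiable_has_derivative_ddir[OF assms]]) (auto intro!: derivative_eq_intros)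
  moreover have "ddir (h *\<^sub>R v) f (a + s *\<^sub>R v) = ddir v f (a + s *\<^sub>R v) * h" for h
    using ddir_linear_comb[OF assms, of h v 0 v] by simp
  ultimately show ?thesis by (simp add: has_field_derivative_def)
qed

text \<open>The mean value theorem is applied twice, along \<open>v\<close> to the increment in
  direction \<open>w\<close> and then along \<open>w\<close>. The second difference is symmetric in
  \<open>v\<close> and \<open>w\<close>, while the mixed derivative is not visibly so; comparing
  both orders proves symmetry.\<close>

lemma second_difference_mvt:
  fixes f :: "hpt \<Rightarrow> real"
  assumes f: "smooth_on U f" and sub: "ball p d \<subseteq> U"
    and s: "0 < s" "s * (norm v + norm w) < d"
  shows "\<exists>q. dist p q < d \<and> dist p q \<le> s * (norm v + norm w) \<and>
    f (p + s *\<^sub>R v + s *\<^sub>R w) - f (p + s *\<^sub>R v) - f (p + s *\<^sub>R w) + f p = s * s * ddir w (ddir v f) q"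
proof -
  have near: "p + a *\<^sub>R v + b *\<^sub>R w \<in> U \<and> dist p (p + a *\<^sub>R v + b *\<^sub>R w) \<le> s * (norm v + norm w)"
    if "0 \<le> a" "a \<le> s" "0 \<le> b" "b \<le> s" for a b
  proof -
    have "dist p (p + a *\<^sub>R v + b *\<^sub>R w) = norm (a *\<^sub>R v + b *\<^sub>R w)"
      by (metis add.assoc add_diff_cancel_left' dist_commute dist_norm)
    also have "\<dots> \<le> a * norm v + b * norm w"
      by (rule norm_triangle_le) (use that in simp)
    also have "\<dots> \<le> s * (norm v + norm w)"
      using mult_right_mono[OF that(2), of "norm v"] mult_right_mono[OF that(4), of "norm w"]
      by (simp add: algebra_simps)
    finally show ?thesis using s sub by auto
  qed
  define g where "g = (\<lambda>a. f ((p + s *\<^sub>R w) + a *\<^sub>R v) - f (p + a *\<^sub>R v))"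
  have D: "DERIV g a :> ddir v f (p + a *\<^sub>R v + s *\<^sub>R w) - ddir v f (p + a *\<^sub>R v)" if a: "0 \<le> a" "a \<le> s" for a
  proof -
    have 1: "p + s *\<^sub>R w + a *\<^sub>R v = p + a *\<^sub>R v + s *\<^sub>R w" by simp
    have "DERIV (\<lambda>a. f ((p + s *\<^sub>R w) + a *\<^sub>R v)) a :> ddir v f ((p + s *\<^sub>R w) + a *\<^sub>R v)"
      by (rule ddir_line_DERIV) (use near[of a s] a s smooth_on_differentiable[OF f] in \<open>simp add: 1\<close>)
    moreover have "DERIV (\<lambda>a. f (p + a *\<^sub>R v)) a :> ddir v f (p + a *\<^sub>R v)"
      by (rule ddir_line_DERIV) (use near[of a 0] a s smooth_on_differentiable[OF f] in simp)
    ultimately show ?thesis unfolding g_def using 1 by (auto intro!: derivative_eq_intros)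
  qed
  obtain a where a: "0 < a" "a < s"
    "g s - g 0 = (s - 0) * (ddir v f (p + a *\<^sub>R v + s *\<^sub>R w) - ddir v f (p + a *\<^sub>R v))"
    using MVT2[OF s(1), of g "\<lambda>a. ddir v f (p + a *\<^sub>R v + s *\<^sub>R w) - ddir v f (p + a *\<^sub>R v)", OF D] by metis
  have D2: "DERIV (\<lambda>b. ddir v f ((p + a *\<^sub>R v) + b *\<^sub>R w)) b :> ddir w (ddir v f) ((p + a *\<^sub>R v) + b *\<^sub>R w)"
    if "0 \<le> b" "b \<le> s" for b
    by (rule ddir_line_DERIV[OF smooth_on_differentiable[OF smooth_on_ddir[OF f]]])
      (use near[of a b] a that in simp)
  obtain b where b: "0 < b" "b < s"
    "ddir v f (p + a *\<^sub>R v + s *\<^sub>R w) - ddir v f (p + a *\<^sub>R v + 0 *\<^sub>R w) =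
       (s - 0) * ddir w (ddir v f) ((p + a *\<^sub>R v) + b *\<^sub>R w)"
    using MVT2[OF s(1), of "\<lambda>b. ddir v f (p + a *\<^sub>R v + b *\<^sub>R w)"
        "\<lambda>b. ddir w (ddir v f) (p + a *\<^sub>R v + b *\<^sub>R w)", OF D2] by metis
  have "f (p + s *\<^sub>R v + s *\<^sub>R w) - f (p + s *\<^sub>R v) - f (p + s *\<^sub>R w) + f p = g s - g 0"
    unfolding g_def by (simp add: algebra_simps)
  also have "\<dots> = s * s * ddir w (ddir v f) (p + a *\<^sub>R v + b *\<^sub>R w)"
    using a(3) b(3) by simp
  finally show ?thesis using near[of a b] a b s by (intro exI[of _ "p + a *\<^sub>R v + b *\<^sub>R w"]) auto
qed

lemma ddir_commute:
  fixes f :: "hpt \<Rightarrow> real"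
  assumes U: "open U" and p: "p \<in> U" and f: "smooth_on U f"
  shows "ddir v (ddir w f) p = ddir w (ddir v f) p"
proof (rule ccontr)
  let ?A = "ddir v (ddir w f)" and ?B = "ddir w (ddir v f)"
  assume ne: "?A p \<noteq> ?B p"
  define e where "e = \<bar>?A p - ?B p\<bar> / 2"
  have e: "e > 0" using ne by (simp add: e_def)
  have cont: "continuous (at p) ?A" "continuous (at p) ?B"
    using smooth_on_continuous_on[OF smooth_on_ddir[OF smooth_on_ddir[OF f]]] p U
    by (metis continuous_on_eq_continuous_at)+
  obtain d1 where d1: "d1 > 0" "\<And>q. dist q p < d1 \<Longrightarrow> dist (?A q) (?A p) < e"
    using cont(1) e unfolding isCont_def LIM_def by (metis dist_self)
  obtain d2 where d2: "d2 > 0" "\<And>q. dist q p < d2 \<Longrightarrow> dist (?B q) (?B p) < e"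
    using cont(2) e unfolding isCont_def LIM_def by (metis dist_self)
  obtain d3 where d3: "d3 > 0" "ball p d3 \<subseteq> U" using U p open_contains_ball by metis
  define d where "d = min d1 (min d2 d3)"
  have d: "d > 0" "ball p d \<subseteq> U" using d1 d2 d3 by (auto simp: d_def)
  \<comment> \<open>The summand 1 keeps the denominator positive when \<open>v = w = 0\<close>; the
    final halving makes the estimate below strict.\<close>
  define s where "s = d / (norm v + norm w + 1) / 2"
  have n: "norm v + norm w + 1 > 0" by (smt (verit) norm_ge_zero)
  have s: "0 < s" using d n by (simp add: s_def)
  have "s * (norm v + norm w) \<le> s * (norm v + norm w + 1)" using s by (simp add: algebra_simps)
  also have "\<dots> = d / 2" using n unfolding s_def by (simp only: divide_divide_eq_left' times_divide_eq_left) (simp add: field_simps)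
  also have "\<dots> < d" using d by simp
  finally have s2: "s * (norm v + norm w) < d" "s * (norm w + norm v) < d" by (simp_all add: add.commute)
  obtain q where q: "dist p q < d"
    "f (p + s *\<^sub>R v + s *\<^sub>R w) - f (p + s *\<^sub>R v) - f (p + s *\<^sub>R w) + f p = s * s * ?B q"
    using second_difference_mvt[OF f d(2) s s2(1)] by blast
  obtain q' where q': "dist p q' < d"
    "f (p + s *\<^sub>R w + s *\<^sub>R v) - f (p + s *\<^sub>R w) - f (p + s *\<^sub>R v) + f p = s * s * ?A q'"
    using second_difference_mvt[OF f d(2) s s2(2)] by blast
  have "s * s * ?B q = s * s * ?A q'" using q(2) q'(2) by (simp add: algebra_simps)
  then have "?B q = ?A q'" using s by simp
  moreover have "dist (?B q) (?B p) < e" "dist (?A q') (?A p) < e"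
    using d1(2)[of q'] d2(2)[of q] q q' by (auto simp: d_def dist_commute)
  ultimately show False unfolding e_def dist_real_def by (smt (verit) field_sum_of_halves)
qed

section \<open>The frame X, Y, T and its commutation relations\<close>

abbreviation Td :: "(hpt \<Rightarrow> 'b::real_normed_vector) \<Rightarrow> hpt \<Rightarrow> 'b" where
  "Td \<equiv> ddir (0, 0, 1)"

lemma Xd_ddir:
  fixes f :: "hpt \<Rightarrow> 'b::real_normed_vector"
  assumes "f differentiable (at p)"
  shows "Xd f p = ddir (1,0,0) f p + (2 * hy p) *\<^sub>R Td f p"
    "Yd f p = ddir (0,1,0) f p - (2 * hx p) *\<^sub>R Td f p"
proof -
  have "Xvec p = 1 *\<^sub>R (1,0,0) + (2 * hy p) *\<^sub>R (0,0,1)" "Yvec p = 1 *\<^sub>R (0,1,0) + (- 2 * hx p) *\<^sub>R (0,0,1)"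
    by (simp_all add: Xvec_def Yvec_def)
  moreover have "Xd f p = ddir (Xvec p) f p" "Yd f p = ddir (Yvec p) f p"
    unfolding Xd_def Yd_def ddir_def by simp_all
  ultimately show "Xd f p = ddir (1,0,0) f p + (2 * hy p) *\<^sub>R Td f p"
    "Yd f p = ddir (0,1,0) f p - (2 * hx p) *\<^sub>R Td f p"
    by (simp_all only: ddir_linear_comb[OF assms]) simp_all
qed

lemma Xd_Yd_eq_ddir: "Xd f p = ddir (Xvec p) f p" "Yd f p = ddir (Yvec p) f p"
  unfolding Xd_def Yd_def ddir_def by simp_all

lemma Xd_cong_open:
  assumes "open U" "p \<in> U" "\<And>q. q \<in> U \<Longrightarrow> f q = g q"
  shows "Xd f p = Xd g p" "Yd f p = Yd g p"
  unfolding Xd_Yd_eq_ddir by (rule ddir_cong_open[OF assms(1,2)], use assms(3) in simp)+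

lemma smooth_on_Xd_Yd:
  fixes f :: "hpt \<Rightarrow> real"
  assumes U: "open U" and f: "smooth_on U f"
  shows "smooth_on U (Xd f)" "smooth_on U (Yd f)"
proof -
  note d = smooth_on_ddir[OF f]
  have "smooth_on U (\<lambda>p. ddir (1,0,0) f p + 2 * hy p * Td f p)"
    "smooth_on U (\<lambda>p. ddir (0,1,0) f p - 2 * hx p * Td f p)"
    by (intro smooth_on_arith U d smooth_on_const smooth_on_coords)+
  then show "smooth_on U (Xd f)" "smooth_on U (Yd f)"
    by (auto intro: smooth_on_cong[OF U] simp: Xd_ddir[OF smooth_on_differentiable[OF f]])
qed

lemma smooth_on_sublap:
  assumes U: "open U" and f: "smooth_on U f"
  shows "smooth_on U (sublap f)"
  unfolding sublap_def[abs_def] by (intro smooth_on_arith smooth_on_Xd_Yd U f)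

lemma Xd_mult:
  fixes f g :: "hpt \<Rightarrow> real"
  assumes "f differentiable (at p)" "g differentiable (at p)"
  shows "Xd (\<lambda>p. f p * g p) p = f p * Xd g p + Xd f p * g p"
    "Yd (\<lambda>p. f p * g p) p = f p * Yd g p + Yd f p * g p"
  unfolding Xd_Yd_eq_ddir by (intro ddir_mult assms)+

lemma ddir_cmult:
  fixes f :: "hpt \<Rightarrow> real"
  assumes "f differentiable (at p)"
  shows "ddir v (\<lambda>p. c * f p) p = c * ddir v f p"
  using ddir_mult[of "\<lambda>p. c" p f v] assms by simp

lemma Xd_cmult:
  fixes f :: "hpt \<Rightarrow> real"
  assumes "f differentiable (at p)"
  shows "Xd (\<lambda>p. c * f p) p = c * Xd f p" "Yd (\<lambda>p. c * f p) p = c * Yd f p"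
  unfolding Xd_Yd_eq_ddir by (intro ddir_cmult assms)+

lemma hcoords_simps [simp]: "hx (a,b,c) = a" "hy (a,b,c) = b" "ht (a,b,c) = c"
  by (simp_all add: hx_def hy_def ht_def)

text \<open>The last summand comes from differentiating the coefficients \<open>2 * hy\<close> and
  \<open>- 2 * hx\<close> of the fields. It is the only source of noncommutativity: it vanishes for
  \<open>v = (0, 0, 1)\<close>, so T is central, and it contributes -2 T twice to [X, Y].\<close>

lemma ddir_Xd_Yd:
  fixes f :: "hpt \<Rightarrow> real"
  assumes U: "open U" "p \<in> U" and f: "smooth_on U f"
  shows "ddir v (Xd f) p = ddir v (ddir (1,0,0) f) p + 2 * hy p * ddir v (Td f) p + 2 * hy v * Td f p"
    "ddir v (Yd f) p = ddir v (ddir (0,1,0) f) p - 2 * hx p * ddir v (Td f) p - 2 * hx v * Td f p"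
proof -
  note d = smooth_on_differentiable[OF f] smooth_on_differentiable[OF smooth_on_ddir[OF f]]
  have c: "(\<lambda>q. 2 * hy q) differentiable (at p)" "(\<lambda>q. 2 * hx q) differentiable (at p)"
    by (rule smooth_on_differentiable[OF smooth_on_arith(2)[OF open_UNIV smooth_on_const]], simp, simp)+
  have m: "(\<lambda>q. 2 * hy q * Td f q) differentiable (at p)" "(\<lambda>q. 2 * hx q * Td f q) differentiable (at p)"
    using c d(2)[OF U(2)] by (auto intro: differentiable_mult)
  have "ddir v (Xd f) p = ddir v (\<lambda>q. ddir (1,0,0) f q + 2 * hy q * Td f q) p"
    by (rule ddir_cong_open[OF U]) (simp add: Xd_ddir d(1))
  also have "\<dots> = ddir v (ddir (1,0,0) f) p + (2 * hy p * ddir v (Td f) p + ddir v (\<lambda>q. 2 * hy q) p * Td f p)"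
    by (subst ddir_arith) (use m d(2)[OF U(2)] ddir_mult[OF c(1) d(2)[OF U(2)]] in auto)
  also have "ddir v (\<lambda>q. 2 * hy q) p = 2 * hy v"
    by (subst ddir_cmult) (auto intro: smooth_on_differentiable[of UNIV])
  finally show "ddir v (Xd f) p = ddir v (ddir (1,0,0) f) p + 2 * hy p * ddir v (Td f) p + 2 * hy v * Td f p"
    by simp
  have "ddir v (Yd f) p = ddir v (\<lambda>q. ddir (0,1,0) f q - 2 * hx q * Td f q) p"
    by (rule ddir_cong_open[OF U]) (simp add: Xd_ddir d(1))
  also have "\<dots> = ddir v (ddir (0,1,0) f) p - (2 * hx p * ddir v (Td f) p + ddir v (\<lambda>q. 2 * hx q) p * Td f p)"
    by (subst ddir_arith) (use m d(2)[OF U(2)] ddir_mult[OF c(2) d(2)[OF U(2)]] in auto)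
  also have "ddir v (\<lambda>q. 2 * hx q) p = 2 * hx v"
    by (subst ddir_cmult) (auto intro: smooth_on_differentiable[of UNIV])
  finally show "ddir v (Yd f) p = ddir v (ddir (0,1,0) f) p - 2 * hx p * ddir v (Td f) p - 2 * hx v * Td f p"
    by simp
qed

lemma Td_Xd_Yd_commute:
  fixes f :: "hpt \<Rightarrow> real"
  assumes U: "open U" "p \<in> U" and f: "smooth_on U f"
  shows "Td (Xd f) p = Xd (Td f) p" "Td (Yd f) p = Yd (Td f) p"
  using ddir_Xd_Yd[OF assms, of "(0,0,1)"] Xd_ddir[OF smooth_on_differentiable[OF smooth_on_ddir[OF f] U(2)]]
    ddir_commute[OF U f] by simp_all

lemma Xd_Yd_commutator:
  fixes f :: "hpt \<Rightarrow> real"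
  assumes U: "open U" "p \<in> U" and f: "smooth_on U f"
  shows "Xd (Yd f) p - Yd (Xd f) p = - 4 * Td f p"
  unfolding Xd_ddir[OF smooth_on_differentiable[OF smooth_on_Xd_Yd(1)[OF U(1) f] U(2)]]
    Xd_ddir[OF smooth_on_differentiable[OF smooth_on_Xd_Yd(2)[OF U(1) f] U(2)]] ddir_Xd_Yd[OF assms]
  using ddir_commute[OF U f, of "(0,1,0)" "(1,0,0)"] ddir_commute[OF U f, of "(0,0,1)" "(1,0,0)"]
    ddir_commute[OF U f, of "(0,0,1)" "(0,1,0)"] by (simp add: algebra_simps)

lemma Td_sublap_commute:
  assumes U: "open U" "p \<in> U" and f: "smooth_on U f"
  shows "Td (sublap f) p = sublap (Td f) p"
proof -
  note s = smooth_on_Xd_Yd[OF U(1)]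
  have "Td (sublap f) p = Td (Xd (Xd f)) p + Td (Yd (Yd f)) p"
    unfolding sublap_def[abs_def] by (intro ddir_arith smooth_on_differentiable[OF _ U(2)] s f)
  also have "\<dots> = Xd (Td (Xd f)) p + Yd (Td (Yd f)) p"
    using Td_Xd_Yd_commute[OF U] s f by simp
  also have "\<dots> = Xd (Xd (Td f)) p + Yd (Yd (Td f)) p"
    using Td_Xd_Yd_commute[OF U(1) _ f] by (intro arg_cong2[where f="(+)"] Xd_cong_open[OF U])
  finally show ?thesis unfolding sublap_def .
qed

text \<open>With a local CR function \<open>f = u + i w\<close> the CR equation reads
  \<open>Y w = X u\<close>, \<open>X w = - Y u\<close>. Hence
  \<open>X X u + Y Y u = X Y w - Y X w = - 4 T w\<close>, and one more derivative expresses X w and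
  Y w through u again, so that the local conjugate \<open>w\<close> disappears.\<close>

lemma pluriharmonic_third_order:
  assumes u: "smooth u" "pluriharmonic u"
  shows "Xd (sublap u) p = 4 * Td (Yd u) p" "Yd (sublap u) p = - 4 * Td (Xd u) p"
proof -
  obtain U f where U: "open U" "p \<in> U" and f: "smooth_on U (f :: hpt \<Rightarrow> complex)"
    and cr: "\<And>q. q \<in> U \<Longrightarrow> Re (f q) = u q \<and> Xd f q + \<i> * Yd f q = 0"
    using u(2) unfolding pluriharmonic_def by metis
  define w where "w = (\<lambda>q. Im (f q))"
  have w: "smooth_on U w" unfolding w_def
    by (rule smooth_on_bounded_linear_comp[OF U(1) bounded_linear_Im f])
  have uU: "smooth_on U u" using u(1) by (rule smooth_on_subset) simp
  note s = smooth_on_Xd_Yd[OF U(1)]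
  have D: "ddir v u q = Re (ddir v f q)" "ddir v w q = Im (ddir v f q)" if "q \<in> U" for q v
  proof -
    have "ddir v u q = ddir v (\<lambda>q. Re (f q)) q"
      by (rule ddir_cong_open[OF U(1) that]) (use cr in simp)
    then show "ddir v u q = Re (ddir v f q)"
      using ddir_bounded_linear_comp[OF bounded_linear_Re smooth_on_differentiable[OF f that]] by simp
    show "ddir v w q = Im (ddir v f q)" unfolding w_def
      using ddir_bounded_linear_comp[OF bounded_linear_Im smooth_on_differentiable[OF f that]] by simp
  qed
  have CR: "Yd w q = Xd u q" "Xd w q = - Yd u q" if "q \<in> U" for q
  proof -
    have "Re (Xd f q + \<i> * Yd f q) = 0" "Im (Xd f q + \<i> * Yd f q) = 0" using cr[OF that] by simp_all
    then show "Yd w q = Xd u q" "Xd w q = - Yd u q"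
      unfolding Xd_Yd_eq_ddir D[OF that] by simp_all
  qed
  have lap: "sublap u q = - 4 * Td w q" if q: "q \<in> U" for q
  proof -
    have "Xd (Xd u) q = Xd (Yd w) q" by (rule Xd_cong_open[OF U(1) q]) (simp add: CR)
    moreover have "Yd (Yd u) q = Yd (\<lambda>q. -1 * Xd w q) q"
      by (rule Xd_cong_open[OF U(1) q]) (simp add: CR)
    moreover have "\<dots> = - Yd (Xd w) q"
      by (subst Xd_cmult) (use smooth_on_differentiable[OF s(1)[OF w] q] in simp_all)
    ultimately show ?thesis using Xd_Yd_commutator[OF U(1) q w] unfolding sublap_def by simp
  qed
  have dT: "Td w differentiable at p" by (rule smooth_on_differentiable[OF smooth_on_ddir[OF w] U(2)])
  have "Td (Xd w) p = Td (\<lambda>q. -1 * Yd u q) p" by (rule ddir_cong_open[OF U]) (simp add: CR)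
  also have "\<dots> = - Td (Yd u) p"
    by (subst ddir_cmult) (use smooth_on_differentiable[OF s(2)[OF uU] U(2)] in simp_all)
  finally have TX: "Td (Xd w) p = - Td (Yd u) p" .
  have TY: "Td (Yd w) p = Td (Xd u) p" by (rule ddir_cong_open[OF U]) (simp add: CR)
  have "Xd (sublap u) p = Xd (\<lambda>q. - 4 * Td w q) p" "Yd (sublap u) p = Yd (\<lambda>q. - 4 * Td w q) p"
    by (rule Xd_cong_open[OF U]; simp add: lap)+
  then show "Xd (sublap u) p = 4 * Td (Yd u) p" "Yd (sublap u) p = - 4 * Td (Xd u) p"
    using Xd_cmult[OF dT, of "-4"] Td_Xd_Yd_commute[OF U w] TX TY by simp_all
qed

section \<open>Integration by parts and cutoff functions\<close>

lemma nn_integral_hpt: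
  fixes f :: "hpt \<Rightarrow> ennreal"
  assumes [measurable]: "f \<in> borel_measurable borel"
  shows "(\<integral>\<^sup>+p. f p \<partial>lborel) = (\<integral>\<^sup>+x. \<integral>\<^sup>+y. \<integral>\<^sup>+t. f (x, y, t) \<partial>lborel \<partial>lborel \<partial>lborel)"
proof -
  have "(\<integral>\<^sup>+p. f p \<partial>lborel) = (\<integral>\<^sup>+x. \<integral>\<^sup>+q. f (x, q) \<partial>lborel \<partial>lborel)"
    by (subst lborel.nn_integral_fst) (simp_all add: lborel_prod)
  also have "\<dots> = (\<integral>\<^sup>+x. \<integral>\<^sup>+y. \<integral>\<^sup>+t. f (x, y, t) \<partial>lborel \<partial>lborel \<partial>lborel)"
  proof -
    have "(\<integral>\<^sup>+q. f (x, q) \<partial>lborel) = (\<integral>\<^sup>+y. \<integral>\<^sup>+t. f (x, y, t) \<partial>lborel \<partial>lborel)" for x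
      by (subst lborel.nn_integral_fst) (simp_all add: lborel_prod)
    then show ?thesis by simp
  qed
  finally show ?thesis .
qed

lemma continuous_coords [continuous_intros]:
  "continuous_on S hx" "continuous_on S hy" "continuous_on S ht"
  by (simp_all add: linear_continuous_on)

lemma measurable_coords [measurable]:
  "hx \<in> borel_measurable borel" "hy \<in> borel_measurable borel" "ht \<in> borel_measurable borel"
  by (simp_all add: borel_measurable_continuous_onI continuous_coords)

text \<open>Triangular affine maps: the form common to the dilations and to \<open>q^-1 p\<close> as
  a function of either factor. The shear \<open>k\<close>, \<open>l\<close> in the t-coordinate
  carries the group twist and leaves the Jacobian \<open>s1 * s2 * s3\<close>.\<close>

definition haffine :: "real \<Rightarrow> real \<Rightarrow> real \<Rightarrow> real \<Rightarrow> real \<Rightarrow> real \<Rightarrow> real \<Rightarrow> real \<Rightarrow> hpt \<Rightarrow> hpt" where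
  "haffine s1 s2 s3 a b c k l p =
     (a + s1 * hx p, b + s2 * hy p, c + k * hx p + l * hy p + s3 * ht p)"

lemma nn_integral_haffine:
  fixes f :: "hpt \<Rightarrow> ennreal"
  assumes [measurable]: "f \<in> borel_measurable borel" and s: "s1 \<noteq> 0" "s2 \<noteq> 0" "s3 \<noteq> 0"
  shows "(\<integral>\<^sup>+p. f p \<partial>lborel) =
    ennreal \<bar>s1 * s2 * s3\<bar> * (\<integral>\<^sup>+p. f (haffine s1 s2 s3 a b c k l p) \<partial>lborel)"
proof -
  have [measurable]: "haffine s1 s2 s3 a b c k l \<in> borel_measurable borel"
    unfolding haffine_def[abs_def] by measurable
  have "(\<integral>\<^sup>+p. f p \<partial>lborel) = (\<integral>\<^sup>+x. \<integral>\<^sup>+y. \<integral>\<^sup>+t. f (x, y, t) \<partial>lborel \<partial>lborel \<partial>lborel)"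
    by (rule nn_integral_hpt) simp
  also have "\<dots> = \<bar>s1\<bar> * (\<integral>\<^sup>+x. (\<integral>\<^sup>+y. \<integral>\<^sup>+t. f (a + s1 * x, y, t) \<partial>lborel \<partial>lborel) \<partial>lborel)"
    by (rule nn_integral_real_affine[OF _ s(1)]) measurable
  also have "\<dots> = \<bar>s1\<bar> * (\<integral>\<^sup>+x. \<bar>s2\<bar> * (\<integral>\<^sup>+y. \<integral>\<^sup>+t. f (a + s1 * x, b + s2 * y, t) \<partial>lborel \<partial>lborel) \<partial>lborel)"
    by (subst nn_integral_real_affine[OF _ s(2), of _ b]) simp_all
  also have "\<dots> = \<bar>s1\<bar> * (\<integral>\<^sup>+x. \<bar>s2\<bar> * (\<integral>\<^sup>+y. \<bar>s3\<bar> * (\<integral>\<^sup>+t. f (a + s1 * x, b + s2 * y, (c + k * x + l * y) + s3 * t) \<partial>lborel) \<partial>lborel) \<partial>lborel)"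
  \<comment> \<open>For fixed x and y the shear is a mere translation in t.\<close>
  proof -
    have "(\<integral>\<^sup>+t. f (a + s1 * x, b + s2 * y, t) \<partial>lborel) =
      \<bar>s3\<bar> * (\<integral>\<^sup>+t. f (a + s1 * x, b + s2 * y, (c + k * x + l * y) + s3 * t) \<partial>lborel)" for x y
      by (rule nn_integral_real_affine[OF _ s(3)]) measurable
    then show ?thesis by simp
  qed
  also have "\<dots> = \<bar>s1\<bar> * (\<bar>s2\<bar> * (\<bar>s3\<bar> * (\<integral>\<^sup>+x. (\<integral>\<^sup>+y. (\<integral>\<^sup>+t. f (a + s1 * x, b + s2 * y, (c + k * x + l * y) + s3 * t) \<partial>lborel) \<partial>lborel) \<partial>lborel)))"
    by (simp add: nn_integral_cmult)
  also have "\<dots> = \<bar>s1\<bar> * (\<bar>s2\<bar> * (\<bar>s3\<bar> * (\<integral>\<^sup>+p. f (haffine s1 s2 s3 a b c k l p) \<partial>lborel)))"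
    by (subst nn_integral_hpt) (simp_all add: haffine_def)
  finally show ?thesis by (simp add: ennreal_mult abs_mult mult.assoc)
qed

text \<open>Applied to indicators, the formula for nonnegative functions identifies
  \<open>lborel\<close> with a constant multiple of its own image measure; integrals of real
  functions then transfer without separating positive and negative parts.\<close>

lemma integral_haffine:
  fixes f :: "hpt \<Rightarrow> real"
  assumes [measurable]: "f \<in> borel_measurable borel" and s: "s1 \<noteq> 0" "s2 \<noteq> 0" "s3 \<noteq> 0"
  shows "integral\<^sup>L lborel f = \<bar>s1 * s2 * s3\<bar> * integral\<^sup>L lborel (\<lambda>p. f (haffine s1 s2 s3 a b c k l p))"
proof -
  let ?A = "haffine s1 s2 s3 a b c k l"
  have [measurable]: "?A \<in> borel_measurable borel"
    unfolding haffine_def[abs_def] by measurable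
  have "lborel = density (distr lborel borel ?A) (\<lambda>_. ennreal \<bar>s1 * s2 * s3\<bar>)"
  proof (rule measure_eqI)
    fix S :: "hpt set" assume "S \<in> sets lborel"
    then have [measurable]: "S \<in> sets borel" by simp
    have "emeasure lborel S = (\<integral>\<^sup>+p. indicator S p \<partial>lborel)" by simp
    also have "\<dots> = ennreal \<bar>s1 * s2 * s3\<bar> * (\<integral>\<^sup>+p. indicator S (?A p) \<partial>lborel)"
      by (rule nn_integral_haffine[OF _ s]) simp
    also have "\<dots> = (\<integral>\<^sup>+p. ennreal \<bar>s1 * s2 * s3\<bar> * indicator S p \<partial>distr lborel borel ?A)"
      by (subst nn_integral_distr) (simp_all add: nn_integral_cmult)
    finally show "emeasure lborel S = emeasure (density (distr lborel borel ?A) (\<lambda>_. ennreal \<bar>s1 * s2 * s3\<bar>)) S"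
      by (simp add: emeasure_density)
  qed simp
  then have "integral\<^sup>L lborel f = integral\<^sup>L (density (distr lborel borel ?A) (\<lambda>_. ennreal \<bar>s1 * s2 * s3\<bar>)) f"
    by simp
  also have "\<dots> = \<bar>s1 * s2 * s3\<bar> * integral\<^sup>L lborel (\<lambda>p. f (?A p))"
    by (subst integral_density) (simp_all add: integral_distr)
  finally show ?thesis .
qed

section \<open>Test functions and integration by parts\<close>

lemma test_fun_smooth: "test_fun g \<Longrightarrow> smooth g"
  unfolding test_fun_def by simp

lemma test_fun_differentiable: "test_fun g \<Longrightarrow> g differentiable (at p)"
  unfolding test_fun_def using smooth_on_differentiable[of UNIV] by blast

lemma test_fun_support:
  assumes "test_fun g"
  obtains R where "R > 0" "\<And>p. norm p > R \<Longrightarrow> g p = 0"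
proof -
  obtain R where "\<And>p. g p \<noteq> 0 \<Longrightarrow> norm p \<le> R"
    using assms unfolding test_fun_def bounded_iff by auto
  then have "g p = 0" if "norm p > max R 1" for p using that by fastforce
  then show ?thesis by (intro that[of "max R 1"]) auto
qed

lemma test_funI:
  assumes "smooth g" "\<And>p. norm p > R \<Longrightarrow> g p = 0"
  shows "test_fun g"
  unfolding test_fun_def bounded_iff using assms by (metis (mono_tags, lifting) mem_Collect_eq not_le)

lemma test_fun_ddir:
  assumes "test_fun g"
  shows "test_fun (ddir v g)"
proof -
  obtain R where R: "\<And>p. norm p > R \<Longrightarrow> g p = 0" using test_fun_support[OF assms] by metis
  have "ddir v g p = 0" if "norm p > R" for p
  proof -
    have "open {p::hpt. norm p > R}" by (intro open_Collect_less continuous_intros)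
    then have "ddir v g p = ddir v (\<lambda>p. 0) p"
      by (rule ddir_cong_open) (use that R in auto)
    then show ?thesis by simp
  qed
  then show ?thesis using smooth_on_ddir test_fun_smooth[OF assms] by (metis test_funI)
qed

lemma test_fun_mult:
  fixes f g :: "hpt \<Rightarrow> real"
  assumes "smooth f" "test_fun g"
  shows "test_fun (\<lambda>p. f p * g p)"
  using assms unfolding test_fun_def by (auto intro!: smooth_on_arith elim: bounded_subset)

lemma test_fun_arith:
  fixes f g :: "hpt \<Rightarrow> real"
  assumes "test_fun f" "test_fun g"
  shows "test_fun (\<lambda>p. f p + g p)" "test_fun (\<lambda>p. f p - g p)"
proof -
  obtain R where R: "\<And>p. norm p > R \<Longrightarrow> f p = 0" using test_fun_support[OF assms(1)] by metis
  obtain S where S: "\<And>p. norm p > S \<Longrightarrow> g p = 0" using test_fun_support[OF assms(2)] by metis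
  note s = smooth_on_arith[OF open_UNIV assms[THEN test_fun_smooth]]
  show "test_fun (\<lambda>p. f p + g p)" "test_fun (\<lambda>p. f p - g p)"
    by (rule test_funI[where R="max R S"], use s R S in simp_all)+
qed

lemma test_fun_Xd_Yd:
  fixes g :: "hpt \<Rightarrow> real"
  assumes "test_fun g"
  shows "test_fun (Xd g)" "test_fun (Yd g)"
proof -
  have "Xd g = (\<lambda>p. ddir (1,0,0) g p + 2 * hy p * Td g p)"
    "Yd g = (\<lambda>p. ddir (0,1,0) g p - 2 * hx p * Td g p)"
    by (auto simp: fun_eq_iff Xd_ddir[OF test_fun_differentiable[OF assms]])
  then show "test_fun (Xd g)" "test_fun (Yd g)"
    by (simp_all add: test_fun_arith test_fun_mult test_fun_ddir assms smooth_on_arith)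
qed

lemma test_fun_continuous: "test_fun g \<Longrightarrow> continuous_on S g"
  using smooth_on_continuous_on[of UNIV g] continuous_on_subset unfolding test_fun_def by blast

lemma test_fun_bounded:
  fixes g :: "hpt \<Rightarrow> real"
  assumes "test_fun g"
  obtains M where "M > 0" "\<And>p. \<bar>g p\<bar> \<le> M"
proof -
  obtain R where R: "\<And>p. norm p > R \<Longrightarrow> g p = 0" using test_fun_support[OF assms] by metis
  have "bounded (g ` cball 0 R)"
    by (intro compact_imp_bounded compact_continuous_image test_fun_continuous assms) auto
  then obtain M where M: "M > 0" "\<forall>p\<in>cball 0 R. \<bar>g p\<bar> \<le> M" unfolding bounded_pos by auto
  have "\<bar>g p\<bar> \<le> M" for p using M R[of p] by (cases "norm p > R") auto
  then show ?thesis using that M by blast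
qed

lemma integrable_continuous_support:
  fixes g :: "hpt \<Rightarrow> real"
  assumes "continuous_on UNIV g" "\<And>p. norm p > R \<Longrightarrow> g p = 0"
  shows "integrable lborel g"
proof -
  have "integrable lborel (\<lambda>p. indicator (cball 0 R) p *\<^sub>R g p)"
    by (rule borel_integrable_compact) (use continuous_on_subset[OF assms(1)] in simp_all)
  moreover have "(\<lambda>p. indicator (cball 0 R) p *\<^sub>R g p) = g"
    using assms(2) by (auto simp: indicator_def fun_eq_iff)
  ultimately show ?thesis by (simp only:)
qed

lemma test_fun_integrable:
  fixes g :: "hpt \<Rightarrow> real"
  assumes "test_fun g" shows "integrable lborel g"
  using test_fun_support[OF assms] integrable_continuous_support[OF test_fun_continuous[OF assms]] by metis

text \<open>Difference quotients integrate to 0 by translation invariance. By the mean value theorem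
  they are bounded by \<open>M\<close> and supported in a fixed ball, since the steps
  \<open>h n\<close> are at most 1, so dominated convergence passes to the derivative.\<close>

lemma integral_ddir_eq_0:
  fixes g :: "hpt \<Rightarrow> real"
  assumes g: "test_fun g"
  shows "integral\<^sup>L lborel (ddir v g) = 0"
proof -
  obtain R where R: "R > 0" "\<And>p. norm p > R \<Longrightarrow> ddir v g p = 0" using test_fun_support[OF test_fun_ddir[OF g]] by metis
  obtain M where M: "M > 0" "\<And>p. \<bar>ddir v g p\<bar> \<le> M" using test_fun_bounded[OF test_fun_ddir[OF g]] by metis
  note d = test_fun_differentiable[OF g]
  define h where "h n = inverse (real (Suc n))" for n
  have h: "0 < h n" "h n \<le> 1" for n unfolding h_def by (auto simp: field_simps)
  have h0: "h \<longlonglongrightarrow> 0" unfolding h_def by (rule LIMSEQ_inverse_real_of_nat)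
  define D where "D n p = (g (p + h n *\<^sub>R v) - g p) / h n" for n p
  have [measurable]: "g \<in> borel_measurable borel" "ddir v g \<in> borel_measurable borel"
    by (intro borel_measurable_continuous_onI test_fun_continuous test_fun_ddir g)+
  have D0: "integral\<^sup>L lborel (D n) = 0" for n
  proof -
    have t: "integral\<^sup>L lborel (\<lambda>p. g (p + h n *\<^sub>R v)) = integral\<^sup>L lborel g"
      by (subst (2) lborel_distr_plus[of "h n *\<^sub>R v", symmetric]) (simp add: integral_distr add.commute)
    have "integrable (distr lborel borel ((+) (h n *\<^sub>R v))) g"
      unfolding lborel_distr_plus by (rule test_fun_integrable[OF g])
    then have "integrable lborel (\<lambda>p. g (p + h n *\<^sub>R v))"
      by (subst (asm) integrable_distr_eq) (simp_all add: add.commute)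
    then show ?thesis unfolding D_def using t test_fun_integrable[OF g] by simp
  qed
  have lim: "(\<lambda>n. D n p) \<longlonglongrightarrow> ddir v g p" for p
  proof -
    have "DERIV (\<lambda>s. g (p + s *\<^sub>R v)) 0 :> ddir v g (p + 0 *\<^sub>R v)"
      by (rule ddir_line_DERIV[OF d])
    then have "(\<lambda>s. (g (p + s *\<^sub>R v) - g p) / s) \<midarrow>0\<rightarrow> ddir v g p"
      by (simp add: DERIV_def)
    moreover have "filterlim h (at 0) sequentially"
      by (rule filterlim_atI[OF h0]) (use h in \<open>auto intro!: always_eventually simp: less_imp_neq[symmetric]\<close>)
    ultimately show ?thesis unfolding D_def by (rule filterlim_compose)
  qed
  have bd: "\<bar>D n p\<bar> \<le> M * indicator (cball 0 (R + norm v)) p" for n p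
  proof -
    have "\<exists>z. 0 < z \<and> z < h n \<and> g (p + h n *\<^sub>R v) - g (p + 0 *\<^sub>R v) = (h n - 0) * ddir v g (p + z *\<^sub>R v)"
      by (rule MVT2[OF h(1)]) (rule ddir_line_DERIV[OF d])
    then obtain z where z: "0 < z" "z < h n" "D n p = ddir v g (p + z *\<^sub>R v)"
      unfolding D_def using h(1)[of n] by auto
    show ?thesis
    proof (cases "norm p \<le> R + norm v")
      case True then show ?thesis using M(2) z by simp
    next
      case False
      have "norm (z *\<^sub>R v) \<le> norm v" using z h(2)[of n] by (simp add: mult_left_le_one_le)
      then have "norm (p + z *\<^sub>R v) > R" using False norm_diff_ineq[of p "z *\<^sub>R v"] by simp
      then show ?thesis using R(2) z(3) M(1) by simp
    qed
  qed
  have "(\<lambda>n. integral\<^sup>L lborel (D n)) \<longlonglongrightarrow> integral\<^sup>L lborel (ddir v g)"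
  proof (rule integral_dominated_convergence[where w="\<lambda>p. M * indicator (cball 0 (R + norm v)) p"])
    show "integrable lborel (\<lambda>p::hpt. M * indicator (cball 0 (R + norm v)) p)"
      using emeasure_lborel_cball_finite by (auto intro!: integrable_real_indicator)
  qed (use lim bd in \<open>auto simp: D_def[abs_def]\<close>)
  then show ?thesis unfolding D0 using LIMSEQ_unique tendsto_const by metis
qed

text \<open>Both fields are divergence free: \<open>2 * hy\<close> and \<open>2 * hx\<close> do not
  depend on t and can be moved under \<open>Td\<close>, so X g and Y g become combinations of
  constant-direction derivatives of test functions.\<close>

lemma integral_Xd_Yd_eq_0:
  fixes g :: "hpt \<Rightarrow> real"
  assumes g: "test_fun g"
  shows "integral\<^sup>L lborel (Xd g) = 0" "integral\<^sup>L lborel (Yd g) = 0"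
proof -
  note d = test_fun_differentiable[OF g]
  have t: "test_fun (\<lambda>p. 2 * hy p * g p)" "test_fun (\<lambda>p. 2 * hx p * g p)"
    by (intro test_fun_mult smooth_on_arith g open_UNIV smooth_on_const smooth_on_coords)+
  have c: "(\<lambda>q. 2 * hy q) differentiable (at p)" "(\<lambda>q. 2 * hx q) differentiable (at p)" for p
    by (rule smooth_on_differentiable[OF smooth_on_arith(2)[OF open_UNIV smooth_on_const]], simp, simp)+
  have z: "Td (\<lambda>p. 2 * hy p) p = 0" "Td (\<lambda>p. 2 * hx p) p = 0" for p
    by (subst ddir_cmult, auto intro: smooth_on_differentiable[of UNIV])+
  have "Xd g = (\<lambda>p. ddir (1,0,0) g p + Td (\<lambda>p. 2 * hy p * g p) p)"
    "Yd g = (\<lambda>p. ddir (0,1,0) g p - Td (\<lambda>p. 2 * hx p * g p) p)"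
    using z by (auto simp: fun_eq_iff Xd_ddir[OF d] ddir_mult[OF c(1) d] ddir_mult[OF c(2) d])
  then show "integral\<^sup>L lborel (Xd g) = 0" "integral\<^sup>L lborel (Yd g) = 0"
    using integral_ddir_eq_0[OF g] integral_ddir_eq_0[OF t(1)] integral_ddir_eq_0[OF t(2)]
      test_fun_integrable[OF test_fun_ddir[OF g]] test_fun_integrable[OF test_fun_ddir[OF t(1)]]
      test_fun_integrable[OF test_fun_ddir[OF t(2)]] by simp_all
qed

text \<open>\<open>D\<close> stands for any operator obeying the product rule, so that one argument
  serves \<open>ddir v\<close>, \<open>Xd\<close> and \<open>Yd\<close>.\<close>

lemma integral_by_parts_aux:
  fixes D :: "(hpt \<Rightarrow> real) \<Rightarrow> hpt \<Rightarrow> real"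
  assumes "smooth f" "test_fun g" "test_fun (D g)" "smooth (D f)"
    and "integral\<^sup>L lborel (D (\<lambda>p. f p * g p)) = 0"
    and "\<And>p. D (\<lambda>p. f p * g p) p = f p * D g p + D f p * g p"
  shows "integral\<^sup>L lborel (\<lambda>p. f p * D g p) = - integral\<^sup>L lborel (\<lambda>p. D f p * g p)"
  using assms(5) test_fun_integrable[OF test_fun_mult[OF assms(1,3)]]
    test_fun_integrable[OF test_fun_mult[OF assms(4,2)]] unfolding assms(6)[abs_def] by simp

lemma integral_by_parts:
  fixes f g :: "hpt \<Rightarrow> real"
  assumes f: "smooth f" and g: "test_fun g"
  shows "integral\<^sup>L lborel (\<lambda>p. f p * ddir v g p) = - integral\<^sup>L lborel (\<lambda>p. ddir v f p * g p)"
    "integral\<^sup>L lborel (\<lambda>p. f p * Xd g p) = - integral\<^sup>L lborel (\<lambda>p. Xd f p * g p)"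
    "integral\<^sup>L lborel (\<lambda>p. f p * Yd g p) = - integral\<^sup>L lborel (\<lambda>p. Yd f p * g p)"
proof -
  note d = smooth_on_differentiable[OF f UNIV_I] test_fun_differentiable[OF g]
  note m = test_fun_mult[OF f g]
  show "integral\<^sup>L lborel (\<lambda>p. f p * ddir v g p) = - integral\<^sup>L lborel (\<lambda>p. ddir v f p * g p)"
    by (rule integral_by_parts_aux[OF f g test_fun_ddir[OF g] smooth_on_ddir[OF f] integral_ddir_eq_0[OF m] ddir_mult[OF d]])
  show "integral\<^sup>L lborel (\<lambda>p. f p * Xd g p) = - integral\<^sup>L lborel (\<lambda>p. Xd f p * g p)"
    by (rule integral_by_parts_aux[OF f g test_fun_Xd_Yd(1)[OF g] smooth_on_Xd_Yd(1)[OF open_UNIV f] integral_Xd_Yd_eq_0(1)[OF m] Xd_mult(1)[OF d]])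
  show "integral\<^sup>L lborel (\<lambda>p. f p * Yd g p) = - integral\<^sup>L lborel (\<lambda>p. Yd f p * g p)"
    by (rule integral_by_parts_aux[OF f g test_fun_Xd_Yd(2)[OF g] smooth_on_Xd_Yd(2)[OF open_UNIV f] integral_Xd_Yd_eq_0(2)[OF m] Xd_mult(2)[OF d]])
qed

lemma norm_hpt: "(norm (p::hpt))\<^sup>2 = (hx p)\<^sup>2 + (hy p)\<^sup>2 + (ht p)\<^sup>2"
  by (cases p) (simp add: norm_Pair hx_def hy_def ht_def)

text \<open>The squared distance is polynomial, hence smooth, which the distance is not. With
  \<open>s\<close> its quotient by the square of \<open>r\<close>, the two flat functions cannot
  vanish together, since \<open>s < 4\<close> or \<open>s > 1\<close>, and the ratio is 1 for
  \<open>s \<le> 1\<close> and 0 for \<open>s \<ge> 4\<close>.\<close>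

lemma exists_bump:
  fixes a :: hpt
  assumes r: "r > 0"
  obtains \<eta> :: "hpt \<Rightarrow> real" where "test_fun \<eta>" "\<And>p. 0 \<le> \<eta> p" "\<And>p. \<eta> p \<le> 1"
    "\<And>p. dist a p \<le> r \<Longrightarrow> \<eta> p = 1" "\<And>p. dist a p \<ge> 2 * r \<Longrightarrow> \<eta> p = 0"
proof -
  define s where "s = (\<lambda>p. ((hx p - hx a)\<^sup>2 + (hy p - hy a)\<^sup>2 + (ht p - ht a)\<^sup>2) / r\<^sup>2)"
  have s_eq: "s p = (dist a p / r)\<^sup>2" for p
    unfolding s_def dist_norm power_divide norm_hpt
    by (simp add: hx_def hy_def ht_def power2_commute)
  have s: "smooth s" unfolding s_def
    by (intro smooth_on_arith smooth_on_power) (use r in auto)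
  define \<eta> where "\<eta> = (\<lambda>p. flat 0 (4 - s p) / (flat 0 (4 - s p) + flat 0 (s p - 1)))"
  have pos: "flat 0 (4 - s p) + flat 0 (s p - 1) > 0" for p
    using flat_nonneg[of 0 "4 - s p"] flat_nonneg[of 0 "s p - 1"] flat_pos_iff[of 0 "4 - s p"]
      flat_pos_iff[of 0 "s p - 1"] by linarith
  have sm: "smooth \<eta>" unfolding \<eta>_def
    by (intro smooth_on_arith smooth_on_flat s smooth_on_const open_UNIV) (use pos in \<open>auto simp: less_imp_neq[symmetric]\<close>)
  have one: "\<eta> p = 1" if "dist a p \<le> r" for p
  proof -
    have "s p \<le> 1" unfolding s_eq using that r by (simp add: power_le_one_iff)
    then show ?thesis using flat_pos_iff[of 0 "4 - s p"] unfolding \<eta>_def by (simp del: flat_pos_iff)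
  qed
  have zero: "\<eta> p = 0" if "dist a p \<ge> 2 * r" for p
  proof -
    have "2 \<le> dist a p / r" using that r by (simp add: field_simps)
    then have "2\<^sup>2 \<le> s p" unfolding s_eq by (intro power_mono) auto
    then show ?thesis unfolding \<eta>_def by simp
  qed
  have "test_fun \<eta>"
  proof (rule test_funI[OF sm])
    fix p :: hpt assume "norm p > norm a + 2 * r"
    then have "dist a p \<ge> 2 * r" unfolding dist_norm using norm_triangle_ineq2[of p a] by (simp add: norm_minus_commute)
    then show "\<eta> p = 0" by (rule zero)
  qed
  moreover have "0 \<le> \<eta> p" "\<eta> p \<le> 1" for p using pos[of p] unfolding \<eta>_def by (auto simp: field_simps)
  ultimately show ?thesis using that one zero by blast
qed

lemma ddir_affine_comp:
  fixes f :: "hpt \<Rightarrow> real"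
  assumes M: "bounded_linear M" and A: "\<And>p. A p = M p + b" and f: "f differentiable (at (A p))"
  shows "ddir v (\<lambda>p. f (A p)) p = ddir (M v) f (A p)" "(\<lambda>p. f (A p)) differentiable (at p)"
proof -
  have "(A has_derivative M) (at p)" unfolding A[abs_def]
    by (auto intro!: derivative_eq_intros bounded_linear_imp_has_derivative[OF M])
  then have "((\<lambda>p. f (A p)) has_derivative (\<lambda>v. ddir (M v) f (A p))) (at p)"
    using has_derivative_compose[of A M p UNIV f "\<lambda>v. ddir v f (A p)"] differentiable_has_derivative_ddir[OF f] by simp
  then show "ddir v (\<lambda>p. f (A p)) p = ddir (M v) f (A p)" "(\<lambda>p. f (A p)) differentiable (at p)"
    using has_derivative_ddir differentiableI by blast+
qed

text \<open>The invariant is the class of compositions with the fixed map \<open>A\<close>: by the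
  chain rule a directional derivative of such a composition is another one, with \<open>f\<close>
  replaced by \<open>ddir (M v) f\<close>.\<close>

lemma smooth_affine_comp:
  fixes f :: "hpt \<Rightarrow> real"
  assumes M: "bounded_linear M" and A: "\<And>p. A p = M p + b" and f: "smooth f"
  shows "smooth (\<lambda>p. f (A p))"
proof (rule smooth_on_coinduct[where P="\<lambda>g. \<exists>f::hpt \<Rightarrow> real. smooth f \<and> g = (\<lambda>p. f (A p))"])
  fix g v assume "\<exists>f::hpt \<Rightarrow> real. smooth f \<and> g = (\<lambda>p. f (A p))"
  then obtain f :: "hpt \<Rightarrow> real" where f: "smooth f" "g = (\<lambda>p. f (A p))" by blast
  then show "\<exists>f::hpt \<Rightarrow> real. smooth f \<and> ddir v g = (\<lambda>p. f (A p))"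
    using ddir_affine_comp(1)[where f=f and A=A and v=v, OF M A smooth_on_differentiable[OF f(1) UNIV_I]] smooth_on_ddir[OF f(1)]
    by (intro exI[of _ "ddir (M v) f"] conjI ext) simp_all
next
  fix g p assume "\<exists>f::hpt \<Rightarrow> real. smooth f \<and> g = (\<lambda>p. f (A p))"
  then obtain f :: "hpt \<Rightarrow> real" where f: "smooth f" "g = (\<lambda>p. f (A p))" by blast
  then show "g differentiable (at p)"
    using ddir_affine_comp(2)[where f=f and A=A, OF M A smooth_on_differentiable[OF f(1) UNIV_I]] by simp
qed (use f in blast)

section \<open>Rigidity of the conformal factor\<close>

lemma Td_line_DERIV:
  fixes f :: "hpt \<Rightarrow> real"
  assumes "smooth f"
  shows "DERIV (\<lambda>t. f (x, y, t)) t :> Td f (x, y, t)"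
  using ddir_line_DERIV[of f "(x,y,0)" t "(0,0,1)"] smooth_on_differentiable[OF assms] by simp

lemma Td_eq_0_imp_const:
  fixes f :: "hpt \<Rightarrow> real"
  assumes "smooth f" "\<And>p. Td f p = 0"
  shows "f (x, y, t) = f (x, y, s)"
  using DERIV_isconst_all[of "\<lambda>t. f (x, y, t)" t s] Td_line_DERIV[OF assms(1)] assms(2) by simp

lemma Td_Td_eq_0_imp_affine:
  fixes f :: "hpt \<Rightarrow> real"
  assumes "smooth f" "\<And>p. Td (Td f) p = 0"
  shows "f (x, y, t) = f (x, y, 0) + t * Td f (x, y, 0)"
proof -
  have c: "Td f (x, y, t) = Td f (x, y, 0)" for t
    by (rule Td_eq_0_imp_const[OF smooth_on_ddir[OF assms(1)] assms(2)])
  have "DERIV (\<lambda>t. f (x, y, t) - t * Td f (x, y, 0)) t :> 0" for t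
  proof -
    have "DERIV (\<lambda>t. t * Td f (x, y, 0)) t :> Td f (x, y, 0)"
      by (auto intro!: derivative_eq_intros)
    from DERIV_diff[OF Td_line_DERIV[OF assms(1), of x y] this] show ?thesis using c[of t] by simp
  qed
  then show ?thesis using DERIV_isconst_all[of "\<lambda>t. f (x, y, t) - t * Td f (x, y, 0)" t 0] by simp
qed

text \<open>X applied to the first third-order equation and Y to the second give
  \<open>4 (X T Y u - Y T X u) = 4 T [X, Y] u = - 16 T T u\<close> for the iterated sublaplacian;
  the factor 2 in P' makes it -32.\<close>

lemma Pprime_pluriharmonic:
  assumes u: "smooth u" "pluriharmonic u"
  shows "Pprime u p = - 32 * Td (Td u) p"
proof -
  note o = open_UNIV UNIV_I
  note s = smooth_on_Xd_Yd[OF open_UNIV u(1)]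
  note d = smooth_on_differentiable[OF smooth_on_ddir[OF s(1)] UNIV_I]
     smooth_on_differentiable[OF smooth_on_ddir[OF s(2)] UNIV_I]
  have "Xd (sublap u) = (\<lambda>p. 4 * Td (Yd u) p)" "Yd (sublap u) = (\<lambda>p. - 4 * Td (Xd u) p)"
    using pluriharmonic_third_order[OF u] by auto
  then have "sublap (sublap u) p = 4 * Xd (Td (Yd u)) p - 4 * Yd (Td (Xd u)) p"
    unfolding sublap_def[of "sublap u"] by (simp add: Xd_cmult(1)[OF d(2)] Xd_cmult(2)[OF d(1), of "-4", simplified])
  also have "\<dots> = 4 * (Td (Xd (Yd u)) p - Td (Yd (Xd u)) p)"
    using Td_Xd_Yd_commute[OF o s(1)] Td_Xd_Yd_commute[OF o s(2)] by simp
  also have "Td (Xd (Yd u)) p - Td (Yd (Xd u)) p = Td (\<lambda>p. Xd (Yd u) p - Yd (Xd u) p) p"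
    by (rule ddir_arith(2)[symmetric])
      (intro smooth_on_differentiable[OF _ UNIV_I] smooth_on_Xd_Yd s open_UNIV)+
  also have "(\<lambda>p. Xd (Yd u) p - Yd (Xd u) p) = (\<lambda>p. - 4 * Td u p)"
    using Xd_Yd_commutator[OF o u(1)] by auto
  also have "Td (\<lambda>p. - 4 * Td u p) p = - 4 * Td (Td u) p"
    by (rule ddir_cmult[OF smooth_on_differentiable[OF smooth_on_ddir[OF u(1)] UNIV_I]])
  finally show ?thesis unfolding Pprime_def by simp
qed

text \<open>This is the weak form of the equation: three integrations by parts on
  \<open>X \<Delta>_b v\<close> give a minus sign and reverse the order of the operators, two on
  \<open>T Y v\<close> give a plus sign.\<close>

lemma sublap_Xd_test:
  assumes v: "smooth v" and eq: "\<And>p. Xd (sublap v) p = 4 * Td (Yd v) p" and \<phi>: "test_fun \<phi>"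
  shows "integral\<^sup>L lborel (\<lambda>p. v p * (sublap (Xd \<phi>) p + 4 * Yd (Td \<phi>) p)) = 0"
proof -
  note X = test_fun_Xd_Yd(1) and Y = test_fun_Xd_Yd(2)
  note sX = smooth_on_Xd_Yd(1)[OF open_UNIV] and sY = smooth_on_Xd_Yd(2)[OF open_UNIV]
  note int = test_fun_integrable[OF test_fun_mult]
  have "integral\<^sup>L lborel (\<lambda>p. v p * sublap (Xd \<phi>) p) =
      integral\<^sup>L lborel (\<lambda>p. v p * Xd (Xd (Xd \<phi>)) p) + integral\<^sup>L lborel (\<lambda>p. v p * Yd (Yd (Xd \<phi>)) p)"
    unfolding sublap_def distrib_left by (intro Bochner_Integration.integral_add int v X Y \<phi>)
  also have "\<dots> = integral\<^sup>L lborel (\<lambda>p. Xd (Xd v) p * Xd \<phi> p) + integral\<^sup>L lborel (\<lambda>p. Yd (Yd v) p * Xd \<phi> p)"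
    by (simp add: integral_by_parts(2,3) v sX sY X Y \<phi>)
  also have "\<dots> = integral\<^sup>L lborel (\<lambda>p. sublap v p * Xd \<phi> p)"
    unfolding sublap_def distrib_right
    by (intro Bochner_Integration.integral_add[symmetric] int v X Y \<phi> sX sY)
  also have "\<dots> = - integral\<^sup>L lborel (\<lambda>p. Xd (sublap v) p * \<phi> p)"
    by (intro integral_by_parts smooth_on_sublap open_UNIV v \<phi>)
  also have "\<dots> = - 4 * integral\<^sup>L lborel (\<lambda>p. Td (Yd v) p * \<phi> p)"
    unfolding eq by (simp add: mult.assoc)
  finally have 1: "integral\<^sup>L lborel (\<lambda>p. v p * sublap (Xd \<phi>) p) = - 4 * integral\<^sup>L lborel (\<lambda>p. Td (Yd v) p * \<phi> p)" .
  have 2: "integral\<^sup>L lborel (\<lambda>p. v p * Yd (Td \<phi>) p) = integral\<^sup>L lborel (\<lambda>p. Td (Yd v) p * \<phi> p)"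
    by (simp add: integral_by_parts(1,3) v sY test_fun_ddir \<phi>)
  have i: "integrable lborel (\<lambda>p. v p * sublap (Xd \<phi>) p)"
    unfolding sublap_def distrib_left by (intro Bochner_Integration.integrable_add int v X Y \<phi>)
  have "integral\<^sup>L lborel (\<lambda>p. v p * (sublap (Xd \<phi>) p + 4 * Yd (Td \<phi>) p)) =
     integral\<^sup>L lborel (\<lambda>p. v p * sublap (Xd \<phi>) p) + 4 * integral\<^sup>L lborel (\<lambda>p. v p * Yd (Td \<phi>) p)"
  proof -
    have "v p * (sublap (Xd \<phi>) p + 4 * Yd (Td \<phi>) p) = v p * sublap (Xd \<phi>) p + 4 * (v p * Yd (Td \<phi>) p)" for p
      by (simp add: algebra_simps)
    then show ?thesis using i int[OF v Y[OF test_fun_ddir[OF \<phi>]]] by simp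
  qed
  then show ?thesis using 1 2 by simp
qed

section \<open>Homogeneity under dilations\<close>

definition dilation :: "real \<Rightarrow> hpt \<Rightarrow> hpt" where
  "dilation c p = (c * hx p, c * hy p, c\<^sup>2 * ht p)"

lemma bounded_linear_dilation: "bounded_linear (dilation c)"
  unfolding dilation_def[abs_def]
  by (intro bounded_linear_Pair bounded_linear_mult_right[THEN bounded_linear_compose] bounded_linear_coords)

lemma dilation_coords [simp]:
  "hx (dilation c p) = c * hx p" "hy (dilation c p) = c * hy p" "ht (dilation c p) = c\<^sup>2 * ht p"
  unfolding dilation_def by simp_all

lemma Xd_dilation:
  fixes f :: "hpt \<Rightarrow> real"
  assumes f: "smooth f"
  shows "Xd (\<lambda>p. f (dilation c p)) p = c * Xd f (dilation c p)"
    "Yd (\<lambda>p. f (dilation c p)) p = c * Yd f (dilation c p)"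
    "Td (\<lambda>p. f (dilation c p)) p = c\<^sup>2 * Td f (dilation c p)"
proof -
  note d = smooth_on_differentiable[OF f UNIV_I]
  have 1: "dilation c (Xvec p) = c *\<^sub>R Xvec (dilation c p)" "dilation c (Yvec p) = c *\<^sub>R Yvec (dilation c p)"
    "dilation c (0,0,1) = c\<^sup>2 *\<^sub>R (0,0,1)"
    unfolding dilation_def Xvec_def Yvec_def by (simp_all add: power2_eq_square)
  have 2: "ddir v (\<lambda>p. f (dilation c p)) p = ddir (dilation c v) f (dilation c p)" for v
    by (rule ddir_affine_comp(1)[OF bounded_linear_dilation, where b=0]) (simp_all add: d)
  have 3: "ddir (a *\<^sub>R v) f q = a * ddir v f q" for a v q
    using ddir_linear_comb[OF d, of a v 0 v] by simp
  show "Xd (\<lambda>p. f (dilation c p)) p = c * Xd f (dilation c p)"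
    "Yd (\<lambda>p. f (dilation c p)) p = c * Yd f (dilation c p)"
    "Td (\<lambda>p. f (dilation c p)) p = c\<^sup>2 * Td f (dilation c p)"
    unfolding Xd_Yd_eq_ddir 2 1 3 by simp_all
qed

lemma smooth_dilation:
  fixes f :: "hpt \<Rightarrow> real"
  assumes "smooth f" shows "smooth (\<lambda>p. f (dilation c p))"
  by (rule smooth_affine_comp[OF bounded_linear_dilation, where b=0]) (simp_all add: assms)

lemma test_fun_dilation:
  fixes f :: "hpt \<Rightarrow> real"
  assumes f: "test_fun f" and c: "c > 0" shows "test_fun (\<lambda>p. f (dilation c p))"
proof -
  obtain R where R: "R > 0" "\<And>p. norm p > R \<Longrightarrow> f p = 0" using test_fun_support[OF f] by metis
  \<comment> \<open>The dilation stretches every coordinate by a factor of at least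
    \<open>m\<close>, which bounds the support of the composition.\<close>
  define m where "m = min c (c\<^sup>2)"
  have m: "m > 0" unfolding m_def using c by simp
  have "m * norm p \<le> norm (dilation c p)" for p
  proof (rule power2_le_imp_le)
    have "m \<le> c" "m \<le> c\<^sup>2" by (simp_all add: m_def)
    then have 1: "m\<^sup>2 \<le> c\<^sup>2" "m\<^sup>2 \<le> (c\<^sup>2)\<^sup>2" using m by (metis less_imp_le power_mono)+
    have "(m * norm p)\<^sup>2 = m\<^sup>2 * (hx p)\<^sup>2 + m\<^sup>2 * (hy p)\<^sup>2 + m\<^sup>2 * (ht p)\<^sup>2"
      by (simp add: power_mult_distrib norm_hpt distrib_left)
    also have "\<dots> \<le> c\<^sup>2 * (hx p)\<^sup>2 + c\<^sup>2 * (hy p)\<^sup>2 + (c\<^sup>2)\<^sup>2 * (ht p)\<^sup>2"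
      using 1 by (intro add_mono mult_right_mono) auto
    finally show "(m * norm p)\<^sup>2 \<le> (norm (dilation c p))\<^sup>2" by (simp add: norm_hpt power_mult_distrib)
  qed simp
  then have "f (dilation c p) = 0" if "norm p > R / m" for p
    using that m R(2)[of "dilation c p"] by (smt (verit) divide_less_eq mult.commute)
  then show ?thesis by (rule test_funI[OF smooth_dilation[OF test_fun_smooth[OF f]]])
qed

lemma continuous_nonneg_integral_eq_0:
  fixes v :: "hpt \<Rightarrow> real"
  assumes "continuous_on UNIV v" "\<And>p. v p \<ge> 0" "integrable lborel v" "integral\<^sup>L lborel v = 0"
  shows "v p = 0"
proof (rule ccontr)
  assume "v p \<noteq> 0"
  then have "p \<in> {p. v p > 0}" using assms(2)[of p] by auto
  moreover have op: "open {p. v p > 0}" by (intro open_Collect_less assms(1) continuous_intros)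
  ultimately obtain e where e: "e > 0" "ball p e \<subseteq> {p. v p > 0}" using open_contains_ball by metis
  have "AE p in lborel. v p = 0"
    using integral_nonneg_eq_0_iff_AE[of lborel v] assms by simp
  then have "AE q in lborel. q \<notin> ball p e" using e(2) by (auto elim!: eventually_mono)
  then have "emeasure lborel (ball p e) = 0"
    by (subst (asm) AE_iff_measurable[OF _ refl]) (auto simp: ball_def)
  then have "measure lborel (ball p e) = 0" by (simp add: measure_def)
  then show False using content_ball_pos[OF e(1), of p] by simp
qed

text \<open>The test functions are dilates of \<open>x\<^sup>3\<close> times a cutoff: the adjoint third-order operator is
  homogeneous of degree 3 and takes the value 6 on \<open>x\<^sup>3\<close>, so dominated convergence turns
  the weak equation into \<open>6 \<integral>v = 0\<close>.\<close>
lemma integrable_nonneg_pluriharmonic_eq_0: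
  assumes v: "smooth v" and eq: "\<And>p. Xd (sublap v) p = 4 * Td (Yd v) p"
    and int: "integrable lborel v" and nonneg: "\<And>p. v p \<ge> 0"
  shows "v p = 0"
proof -
  obtain \<eta> :: "hpt \<Rightarrow> real" where \<eta>: "test_fun \<eta>" "\<And>p. 0 \<le> \<eta> p" "\<And>p. \<eta> p \<le> 1"
    "\<And>p. dist 0 p \<le> 1 \<Longrightarrow> \<eta> p = 1" "\<And>p. dist 0 p \<ge> 2 * 1 \<Longrightarrow> \<eta> p = 0"
    by (rule exists_bump[of 1 "0::hpt", OF zero_less_one]) blast
  define \<phi> where "\<phi> = (\<lambda>p. (hx p) ^ 3 * \<eta> p)"
  have \<phi>: "test_fun \<phi>" unfolding \<phi>_def by (intro test_fun_mult \<eta> smooth_on_power) simp_all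
  define \<psi> where "\<psi> = (\<lambda>p. sublap (Xd \<phi>) p + 4 * Yd (Td \<phi>) p)"
  have \<psi>: "test_fun \<psi>" unfolding \<psi>_def sublap_def
    by (intro test_fun_arith test_fun_Xd_Yd test_fun_mult test_fun_ddir \<phi> smooth_on_const)
  have hxd: "hx differentiable (at p)" "(\<lambda>p. hx p ^ n) differentiable (at p)" for n p
    by (rule smooth_on_differentiable[of UNIV]; auto intro: smooth_on_power)+
  have Dx: "ddir v (\<lambda>p. c * hx p ^ n) p = c * (real n * hx p ^ (n - 1) * hx v)" for v n p c
  proof -
    have "DERIV (\<lambda>x. c * x ^ n) (hx p) :> c * (real n * hx p ^ (n - 1))"
      by (auto intro!: derivative_eq_intros)
    from ddir_DERIV_comp[OF hxd(1) this] show ?thesis by simp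
  qed
  let ?B = "ball (0::hpt) 1"
  have B: "open ?B" "(0::hpt) \<in> ?B" by auto
  have 1: "Xd \<phi> p = 3 * hx p ^ 2 \<and> Td \<phi> p = 0" if "p \<in> ?B" for p
  proof -
    have "ddir v \<phi> p = ddir v (\<lambda>p. 1 * hx p ^ 3) p" for v
      by (rule ddir_cong_open[OF B(1) that]) (use \<eta>(4) in \<open>simp add: \<phi>_def\<close>)
    then show ?thesis unfolding Xd_Yd_eq_ddir Dx by (simp add: Xvec_def)
  qed
  have 2: "Xd (Xd \<phi>) p = 6 * hx p ^ 1 \<and> Yd (Xd \<phi>) p = 0 \<and> Yd (Td \<phi>) p = 0" if "p \<in> ?B" for p
  proof -
    \<comment> \<open>The zero function is written \<open>0 * hx p ^ 0\<close> to make
      \<open>Dx\<close> applicable.\<close>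
    have "ddir v (Xd \<phi>) p = ddir v (\<lambda>p. 3 * hx p ^ 2) p" "ddir v (Td \<phi>) p = ddir v (\<lambda>p. 0 * hx p ^ 0) p" for v
      by (rule ddir_cong_open[OF B(1) that]; use 1 in simp)+
    then show ?thesis unfolding Xd_Yd_eq_ddir Dx by (simp add: Xvec_def Yvec_def)
  qed
  have "ddir v (Xd (Xd \<phi>)) 0 = ddir v (\<lambda>p. 6 * hx p ^ 1) 0" "ddir v (Yd (Xd \<phi>)) 0 = ddir v (\<lambda>p. 0 * hx p ^ 0) 0" for v
    by (rule ddir_cong_open[OF B]; use 2 in simp)+
  then have "Xd (Xd (Xd \<phi>)) 0 = 6" "Yd (Yd (Xd \<phi>)) 0 = 0"
    unfolding Xd_Yd_eq_ddir Dx by (simp_all add: Xvec_def Yvec_def)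
  then have \<psi>0: "\<psi> 0 = 6" unfolding \<psi>_def sublap_def using 2[OF B(2)] by simp
  have weak: "integral\<^sup>L lborel (\<lambda>p. v p * \<psi> (dilation c p)) = 0" if c: "c > 0" for c
  proof -
    define \<phi>c where "\<phi>c = (\<lambda>p. \<phi> (dilation c p))"
    have sm: "smooth \<phi>" by (rule test_fun_smooth[OF \<phi>])
    note X = smooth_on_Xd_Yd(1)[OF open_UNIV] and Y = smooth_on_Xd_Yd(2)[OF open_UNIV]
    note df = smooth_on_differentiable[OF smooth_dilation UNIV_I]
    have a: "Xd \<phi>c = (\<lambda>p. c * Xd \<phi> (dilation c p))" "Td \<phi>c = (\<lambda>p. c\<^sup>2 * Td \<phi> (dilation c p))"
      unfolding \<phi>c_def using Xd_dilation[OF sm] by auto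
    have b: "Xd (Xd \<phi>c) = (\<lambda>p. c\<^sup>2 * Xd (Xd \<phi>) (dilation c p))" "Yd (Xd \<phi>c) = (\<lambda>p. c\<^sup>2 * Yd (Xd \<phi>) (dilation c p))"
      "Yd (Td \<phi>c) = (\<lambda>p. c^3 * Yd (Td \<phi>) (dilation c p))"
      unfolding a using Xd_cmult[OF df[OF X[OF sm]]] Xd_cmult[OF df[OF smooth_on_ddir[OF sm]]]
        Xd_dilation[OF X[OF sm]] Xd_dilation[OF smooth_on_ddir[OF sm]] by (auto simp: power2_eq_square power3_eq_cube)
    \<comment> \<open>Each X or Y contributes \<open>c\<close> and T contributes the square of
      \<open>c\<close>, so all terms of \<open>\<psi>\<close> carry the same factor
      \<open>c^3\<close>, which is cancelled at the end.\<close>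
    have e: "Xd (Xd (Xd \<phi>c)) = (\<lambda>p. c^3 * Xd (Xd (Xd \<phi>)) (dilation c p))" 
      "Yd (Yd (Xd \<phi>c)) = (\<lambda>p. c^3 * Yd (Yd (Xd \<phi>)) (dilation c p))"
      unfolding b using Xd_cmult[OF df[OF X[OF X[OF sm]]]] Xd_cmult[OF df[OF Y[OF X[OF sm]]]]
        Xd_dilation[OF X[OF X[OF sm]]] Xd_dilation[OF Y[OF X[OF sm]]] by (auto simp: power2_eq_square power3_eq_cube)
    have "test_fun \<phi>c" unfolding \<phi>c_def by (rule test_fun_dilation[OF \<phi> c])
    then have "0 = integral\<^sup>L lborel (\<lambda>p. v p * (sublap (Xd \<phi>c) p + 4 * Yd (Td \<phi>c) p))"
      using sublap_Xd_test[OF v eq] by simp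
    also have "\<dots> = integral\<^sup>L lborel (\<lambda>p. c^3 * (v p * \<psi> (dilation c p)))"
      unfolding sublap_def e unfolding b \<psi>_def sublap_def by (simp add: algebra_simps)
    finally show ?thesis using c by simp
  qed
  obtain M where M: "M > 0" "\<And>p. \<bar>\<psi> p\<bar> \<le> M" using test_fun_bounded[OF \<psi>] by metis
  define h where "h n = inverse (real (Suc n))" for n
  have h: "0 < h n" for n unfolding h_def by auto
  have h0: "h \<longlonglongrightarrow> 0" unfolding h_def by (rule LIMSEQ_inverse_real_of_nat)
  \<comment> \<open>Nonnegativity of \<open>v\<close> is what makes \<open>M * v\<close> an
    integrable majorant.\<close>
  have "(\<lambda>n. integral\<^sup>L lborel (\<lambda>p. v p * \<psi> (dilation (h n) p))) \<longlonglongrightarrow> integral\<^sup>L lborel (\<lambda>p. v p * 6)"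
  proof (rule integral_dominated_convergence[where w="\<lambda>p. M * v p"])
    have vm [measurable]: "v \<in> borel_measurable borel"
      using smooth_on_continuous_on[OF v] by (rule borel_measurable_continuous_onI)
    then show "(\<lambda>p. v p * 6) \<in> borel_measurable lborel" by simp
    show "(\<lambda>p. v p * \<psi> (dilation (h n) p)) \<in> borel_measurable lborel" for n
    proof -
      have "(\<lambda>p. \<psi> (dilation (h n) p)) \<in> borel_measurable borel"
        by (intro borel_measurable_continuous_onI smooth_on_continuous_on smooth_dilation test_fun_smooth \<psi>)
      then show ?thesis by simp
    qed
    show "integrable lborel (\<lambda>p. M * v p)" using int by simp
    show "AE p in lborel. norm (v p * \<psi> (dilation (h n) p)) \<le> M * v p" for n
    proof (rule AE_I2)
      fix p
      have "v p * \<bar>\<psi> (dilation (h n) p)\<bar> \<le> v p * M" using M(2) nonneg by (intro mult_left_mono)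
      then show "norm (v p * \<psi> (dilation (h n) p)) \<le> M * v p"
        using nonneg[of p] by (simp add: abs_mult mult.commute)
    qed
    show "AE p in lborel. (\<lambda>n. v p * \<psi> (dilation (h n) p)) \<longlonglongrightarrow> v p * 6"
    proof (rule AE_I2)
      fix p
      have "(\<lambda>n. dilation (h n) p) \<longlonglongrightarrow> (0 * hx p, 0 * hy p, 0\<^sup>2 * ht p)"
        unfolding dilation_def by (intro tendsto_intros h0)
      then have "(\<lambda>n. dilation (h n) p) \<longlonglongrightarrow> 0" by (simp add: zero_prod_def)
      moreover have "isCont \<psi> 0"
        using test_fun_continuous[OF \<psi>, of UNIV] by (simp add: continuous_on_eq_continuous_at)
      ultimately have "(\<lambda>n. \<psi> (dilation (h n) p)) \<longlonglongrightarrow> 6" using \<psi>0 isCont_tendsto_compose by metis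
      then show "(\<lambda>n. v p * \<psi> (dilation (h n) p)) \<longlonglongrightarrow> v p * 6" by (intro tendsto_intros)
    qed
  qed
  then have "integral\<^sup>L lborel (\<lambda>p. v p * 6) = 0"
    unfolding weak[OF h] using LIMSEQ_unique tendsto_const by metis
  then show ?thesis
    using continuous_nonneg_integral_eq_0[OF smooth_on_continuous_on[OF v] nonneg int] by simp
qed

text \<open>After division by the square of t the left side tends to the sum of the squares of the
  slopes and the right side to 0.\<close>

lemma eventually_quadratic_le_linear:
  fixes a1 b1 a2 b2 a3 b3 :: real
  assumes "eventually (\<lambda>t. (a1 + t * b1)\<^sup>2 + (a2 + t * b2)\<^sup>2 \<le> a3 + t * b3) at_top"
  shows "b1 = 0 \<and> b2 = 0"
proof -
  have "((\<lambda>t. ((a1 + t * b1)\<^sup>2 + (a2 + t * b2)\<^sup>2 - (a3 + t * b3)) / t\<^sup>2) \<longlongrightarrow> b1\<^sup>2 + b2\<^sup>2) at_top"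
  proof -
    have i: "((\<lambda>t. c / t) \<longlongrightarrow> 0) at_top" for c :: real
      by (rule tendsto_divide_0[OF tendsto_const filterlim_at_top_imp_at_infinity[OF filterlim_ident]])
    have "((\<lambda>t. (a1 / t + b1)\<^sup>2 + (a2 / t + b2)\<^sup>2 - (a3 / t * (1 / t) + b3 / t)) \<longlongrightarrow>
        (0 + b1)\<^sup>2 + (0 + b2)\<^sup>2 - (0 * 0 + 0)) at_top"
      by (intro tendsto_intros i)
    then have "((\<lambda>t. (a1 / t + b1)\<^sup>2 + (a2 / t + b2)\<^sup>2 - (a3 / t * (1 / t) + b3 / t)) \<longlongrightarrow> b1\<^sup>2 + b2\<^sup>2) at_top"
      by simp
    then show ?thesis
      by (rule Lim_transform_eventually)
        (auto intro!: eventually_mono[OF eventually_gt_at_top[of 0]] simp: field_simps power2_eq_square)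
  qed
  moreover have "eventually (\<lambda>t. ((a1 + t * b1)\<^sup>2 + (a2 + t * b2)\<^sup>2 - (a3 + t * b3)) / t\<^sup>2 \<le> 0) at_top"
    using assms by eventually_elim (simp add: divide_nonpos_nonneg)
  ultimately have "b1\<^sup>2 + b2\<^sup>2 \<le> 0" by (intro tendsto_upperbound) auto
  then show ?thesis by (metis add_nonneg_eq_0_iff order_antisym power_eq_0_iff zero_le_power2 add_nonneg_nonneg)
qed

text \<open>The commutator turns vanishing of X f and Y f into vanishing of T f, so all partial
  derivatives are 0.\<close>

lemma horizontal_gradient_eq_0_imp_const:
  fixes f :: "hpt \<Rightarrow> real"
  assumes f: "smooth f" and "\<And>p. Xd f p = 0" "\<And>p. Yd f p = 0"
  shows "f p = f q"
proof -
  have X: "Xd f = (\<lambda>p. 0)" "Yd f = (\<lambda>p. 0)" using assms by auto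
  have T: "Td f p = 0" for p
    using Xd_Yd_commutator[OF open_UNIV UNIV_I f, of p] unfolding X by (simp add: Xd_Yd_eq_ddir)
  have "ddir v f p = 0" for v p
  proof -
    note d = smooth_on_differentiable[OF f UNIV_I]
    have e: "ddir (1,0,0) f p = 0" "ddir (0,1,0) f p = 0"
      using Xd_ddir[OF d, of p] T[of p] assms by simp_all
    obtain a b c where v: "v = (a, b, c)" by (cases v)
    have "v = 1 *\<^sub>R (a *\<^sub>R (1,0,0) + b *\<^sub>R (0,1,0)) + c *\<^sub>R (0,0,1)" unfolding v by simp
    then show ?thesis using e T[of p] by (simp only: ddir_linear_comb[OF d]) simp
  qed
  then have "(f has_derivative (\<lambda>v. 0)) (at p within UNIV)" for p
    using differentiable_has_derivative_ddir[OF smooth_on_differentiable[OF f UNIV_I], of p] by simp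
  then obtain c where "\<And>x. f x = c" using has_derivative_zero_constant[OF convex_UNIV, of f] by auto
  then show ?thesis by simp
qed

text \<open>Testing against the cutoff \<open>\<eta>\<close> composed with the dilation by
  \<open>e\<close> and moving one derivative onto it gains a factor \<open>e\<close>, whereas both
  integrals rescale by the same power \<open>e^4\<close>. This gives
  \<open>\<bar>c\<bar> * I \<le> e * (M * J)\<close> for every positive \<open>e\<close>.\<close>

lemma sublap_const_horizontal_gradient_bounded:
  assumes u: "smooth u" and c: "\<And>p. sublap u p = c" and M: "\<And>p. \<bar>Xd u p\<bar> \<le> M" "\<And>p. \<bar>Yd u p\<bar> \<le> M"
  shows "c = 0"
proof -
  obtain \<eta> :: "hpt \<Rightarrow> real" where \<eta>: "test_fun \<eta>" "\<And>p. 0 \<le> \<eta> p" "\<And>p. \<eta> p \<le> 1"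
    "\<And>p. dist 0 p \<le> 1 \<Longrightarrow> \<eta> p = 1" "\<And>p. dist 0 p \<ge> 2 * 1 \<Longrightarrow> \<eta> p = 0"
    by (rule exists_bump[of 1 "0::hpt", OF zero_less_one]) blast
  define I where "I = integral\<^sup>L lborel \<eta>"
  have I: "I \<noteq> 0"
    using continuous_nonneg_integral_eq_0[OF test_fun_continuous[OF \<eta>(1)] \<eta>(2) test_fun_integrable[OF \<eta>(1)], of 0]
      \<eta>(4)[of 0] unfolding I_def by auto
  then have I: "I > 0" using \<eta>(2) Bochner_Integration.integral_nonneg[of lborel \<eta>] unfolding I_def by fastforce
  define J where "J = integral\<^sup>L lborel (\<lambda>p. \<bar>Xd \<eta> p\<bar> + \<bar>Yd \<eta> p\<bar>)"
  note tX = test_fun_Xd_Yd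
  note iX = tX[THEN test_fun_integrable]
  have M0: "M \<ge> 0" using M(1)[of 0] by linarith
  have "\<bar>c\<bar> * I \<le> e * (M * J)" if e: "e > 0" for e
  proof -
    let ?d = "dilation e"
    have dil: "?d = haffine e e (e\<^sup>2) 0 0 0 0 0"
      unfolding dilation_def[abs_def] haffine_def[abs_def] by simp
    have sc: "integral\<^sup>L lborel f = e ^ 4 * integral\<^sup>L lborel (\<lambda>p. f (?d p))"
      if "f \<in> borel_measurable borel" for f :: "hpt \<Rightarrow> real"
      using integral_haffine[OF that, of e e "e\<^sup>2"] e unfolding dil
      by (simp add: power2_eq_square power4_eq_xxxx mult.assoc abs_mult)
    define \<eta>e where "\<eta>e = (\<lambda>p. \<eta> (?d p))"
    have \<eta>e: "test_fun \<eta>e" unfolding \<eta>e_def by (rule test_fun_dilation[OF \<eta>(1) e])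
    have D: "Xd \<eta>e p = e * Xd \<eta> (?d p)" "Yd \<eta>e p = e * Yd \<eta> (?d p)" for p
      unfolding \<eta>e_def by (rule Xd_dilation[OF test_fun_smooth[OF \<eta>(1)]])+
    have meas: "(\<lambda>p. \<bar>Xd \<eta> p\<bar> + \<bar>Yd \<eta> p\<bar>) \<in> borel_measurable borel" "\<eta> \<in> borel_measurable borel"
      by (intro borel_measurable_continuous_onI continuous_intros test_fun_continuous tX \<eta>(1))+
    note sX = smooth_on_Xd_Yd[OF open_UNIV u]
    note im = test_fun_integrable[OF test_fun_mult]
    have "c * integral\<^sup>L lborel \<eta>e = integral\<^sup>L lborel (\<lambda>p. sublap u p * \<eta>e p)" unfolding c by simp
    also have "\<dots> = integral\<^sup>L lborel (\<lambda>p. Xd (Xd u) p * \<eta>e p) + integral\<^sup>L lborel (\<lambda>p. Yd (Yd u) p * \<eta>e p)"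
      unfolding sublap_def distrib_right
      by (intro Bochner_Integration.integral_add im \<eta>e smooth_on_Xd_Yd open_UNIV u)
    also have "\<dots> = - integral\<^sup>L lborel (\<lambda>p. Xd u p * Xd \<eta>e p) - integral\<^sup>L lborel (\<lambda>p. Yd u p * Yd \<eta>e p)"
      by (simp add: integral_by_parts(2)[OF sX(1) \<eta>e] integral_by_parts(3)[OF sX(2) \<eta>e])
    also have "\<dots> = - integral\<^sup>L lborel (\<lambda>p. Xd u p * Xd \<eta>e p + Yd u p * Yd \<eta>e p)"
      using im[OF sX(1) tX(1)[OF \<eta>e]] im[OF sX(2) tX(2)[OF \<eta>e]] by simp
    finally have "\<bar>c * integral\<^sup>L lborel \<eta>e\<bar> = \<bar>integral\<^sup>L lborel (\<lambda>p. Xd u p * Xd \<eta>e p + Yd u p * Yd \<eta>e p)\<bar>" by simp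
    also have "\<dots> \<le> integral\<^sup>L lborel (\<lambda>p. M * e * (\<bar>Xd \<eta> (?d p)\<bar> + \<bar>Yd \<eta> (?d p)\<bar>))"
    proof (rule integral_abs_bound[THEN order_trans], rule integral_mono)
      show "integrable lborel (\<lambda>p. \<bar>Xd u p * Xd \<eta>e p + Yd u p * Yd \<eta>e p\<bar>)"
        by (intro integrable_abs Bochner_Integration.integrable_add im sX tX \<eta>e)
      have "integrable lborel (\<lambda>p. M * (\<bar>Xd \<eta>e p\<bar> + \<bar>Yd \<eta>e p\<bar>))"
        by (intro integrable_mult_right integrable_abs Bochner_Integration.integrable_add iX \<eta>e)
      then show "integrable lborel (\<lambda>p. M * e * (\<bar>Xd \<eta> (?d p)\<bar> + \<bar>Yd \<eta> (?d p)\<bar>))"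
        unfolding D using e by (simp add: abs_mult algebra_simps)
      fix p
      have "\<bar>Xd u p * Xd \<eta>e p + Yd u p * Yd \<eta>e p\<bar> \<le> \<bar>Xd u p\<bar> * \<bar>Xd \<eta>e p\<bar> + \<bar>Yd u p\<bar> * \<bar>Yd \<eta>e p\<bar>"
        by (metis abs_mult abs_triangle_ineq)
      also have "\<dots> \<le> M * \<bar>Xd \<eta>e p\<bar> + M * \<bar>Yd \<eta>e p\<bar>"
        using M by (intro add_mono mult_right_mono) auto
      finally show "\<bar>Xd u p * Xd \<eta>e p + Yd u p * Yd \<eta>e p\<bar> \<le> M * e * (\<bar>Xd \<eta> (?d p)\<bar> + \<bar>Yd \<eta> (?d p)\<bar>)"
        unfolding D using e by (simp add: abs_mult algebra_simps)
    qed
    also have "\<dots> = M * e * integral\<^sup>L lborel (\<lambda>p. \<bar>Xd \<eta> (?d p)\<bar> + \<bar>Yd \<eta> (?d p)\<bar>)" by simp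
    finally have le: "\<bar>c * integral\<^sup>L lborel \<eta>e\<bar> \<le> M * e * integral\<^sup>L lborel (\<lambda>p. \<bar>Xd \<eta> (?d p)\<bar> + \<bar>Yd \<eta> (?d p)\<bar>)" .
    have "\<bar>c\<bar> * I = e ^ 4 * \<bar>c * integral\<^sup>L lborel \<eta>e\<bar>"
    proof -
      have "I = e ^ 4 * integral\<^sup>L lborel \<eta>e" unfolding I_def \<eta>e_def by (rule sc[OF meas(2)])
      moreover from this have "integral\<^sup>L lborel \<eta>e > 0" using I e by (simp add: zero_less_mult_iff)
      ultimately show ?thesis by (simp add: abs_mult)
    qed
    also have "\<dots> \<le> e ^ 4 * (M * e * integral\<^sup>L lborel (\<lambda>p. \<bar>Xd \<eta> (?d p)\<bar> + \<bar>Yd \<eta> (?d p)\<bar>))"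
      using le e by (intro mult_left_mono) auto
    also have "\<dots> = e * (M * J)" unfolding J_def using sc[OF meas(1)] by simp
    finally show ?thesis .
  qed
  \<comment> \<open>Adding 1 to \<open>\<bar>M * J\<bar>\<close> provides a positive number to
    divide by, even when \<open>M * J\<close> is 0.\<close>
  then have "\<bar>c\<bar> * I \<le> e * (\<bar>M * J\<bar> + 1)" if "e > 0" for e
    using that mult_left_mono[of "M * J" "\<bar>M * J\<bar> + 1" e] by (smt (verit, best))
  then have "\<bar>c\<bar> * I \<le> 0 + e'" if "e' > 0" for e'
    using that by (metis abs_ge_zero add_0 add_nonneg_pos divide_pos_pos less_irrefl nonzero_eq_divide_eq zero_less_one)
  then have "\<bar>c\<bar> * I \<le> 0" using field_le_epsilon by blast
  then show ?thesis using I by (simp add: mult_le_0_iff)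
qed

text \<open>Every vertical line leaves the compact set \<open>K\<close>. Once the horizontal
  derivatives and the sublaplacian of \<open>u\<close> are affine in t, the inequality outside
  \<open>K\<close> therefore restricts them everywhere.\<close>

theorem pluriharmonic_liouville:
  assumes u: "smooth u" "pluriharmonic u" and Q: "\<And>p. Qprime u p \<ge> 0"
    and K: "compact K" "\<And>p. p \<notin> K \<Longrightarrow> - sublap u p \<ge> grad_b_sq u p"
    and int: "integrable dv (\<lambda>p. Qprime u p * exp (4 * u p))"
  shows "u p = u q"
proof -
  note o = open_UNIV UNIV_I
  define v where "v = (\<lambda>p. - 1 * Td (Td u) p)"
  have Teq: "Qprime u p * exp (4 * u p) = 32 * v p" for p
    unfolding Qprime_def v_def using Pprime_pluriharmonic[OF u] by simp
  note sT = smooth_on_ddir[OF u(1)] and sTT = smooth_on_ddir[OF smooth_on_ddir[OF u(1)]]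
  note sX = smooth_on_Xd_Yd[OF open_UNIV]
  have v_smooth: "smooth v" unfolding v_def by (intro smooth_on_arith sTT open_UNIV smooth_on_const)
  have v0: "v p \<ge> 0" for p
    using Teq[of p] Q[of p] by (smt (verit) exp_gt_zero mult_nonneg_nonneg)
  have vint: "integrable lborel v"
  proof -
    have "dv = density lborel (\<lambda>_. ennreal 4)" unfolding dv_def by simp
    then show ?thesis using int borel_measurable_continuous_onI[OF smooth_on_continuous_on[OF v_smooth]]
      integrable_density[of "\<lambda>p. 32 * v p" lborel "\<lambda>_. 4"] unfolding Teq by simp
  qed
  \<comment> \<open>T commutes with X, Y and the sublaplacian, so two T-derivatives pass through the
    third-order equation for \<open>u\<close>.\<close>
  have e1: "Xd (sublap (Td (Td u))) p = 4 * Td (Yd (Td (Td u))) p" for p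
  proof -
    have T: "Xd (Td f) = Td (Xd f)" "Yd (Td f) = Td (Yd f)" "sublap (Td f) = Td (sublap f)" if "smooth f" for f :: "hpt \<Rightarrow> real"
      using Td_Xd_Yd_commute[OF o that] Td_sublap_commute[OF o that] by (metis ext)+
    note sl = smooth_on_sublap[OF open_UNIV u(1)]
    have "sublap (Td (Td u)) = Td (Td (sublap u))" using T(3) sT u(1) by simp
    moreover have "Xd (Td (Td (sublap u))) = Td (Td (Xd (sublap u)))"
      using T(1) sl smooth_on_ddir[OF sl] by simp
    moreover have "Xd (sublap u) = (\<lambda>p. 4 * Td (Yd u) p)"
      using pluriharmonic_third_order(1)[OF u] by auto
    moreover have "Td (\<lambda>p. 4 * f p) = (\<lambda>p. 4 * Td f p)" if "smooth f" for f :: "hpt \<Rightarrow> real"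
      using ddir_cmult[OF smooth_on_differentiable[OF that UNIV_I]] by auto
    moreover have "Yd (Td (Td u)) = Td (Td (Yd u))"
      using T(2) sT u(1) by simp
    ultimately show ?thesis using sX(2)[OF u(1)] smooth_on_ddir by metis
  qed
  have e2: "Xd (sublap v) p = 4 * Td (Yd v) p" for p
  proof -
    have c: "Xd (\<lambda>p. -1 * f p) = (\<lambda>p. -1 * Xd f p)" "Yd (\<lambda>p. -1 * f p) = (\<lambda>p. -1 * Yd f p)"
      "Td (\<lambda>p. -1 * f p) = (\<lambda>p. -1 * Td f p)" if "smooth f" for f :: "hpt \<Rightarrow> real"
      using ddir_cmult[OF smooth_on_differentiable[OF that UNIV_I]]
        Xd_cmult[OF smooth_on_differentiable[OF that UNIV_I]] by blast+
    have "sublap v = (\<lambda>p. -1 * sublap (Td (Td u)) p)"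
      unfolding v_def sublap_def[abs_def] c[OF sTT] c[OF sX(1)[OF sTT]] c[OF sX(2)[OF sTT]] by simp
    then show ?thesis unfolding v_def c[OF sTT] c[OF sX(2)[OF sTT]]
      using c(1)[OF smooth_on_sublap[OF open_UNIV sTT]] e1 by simp
  qed
  have TT: "Td (Td u) p = 0" for p
    using integrable_nonneg_pluriharmonic_eq_0[OF v_smooth e2 vint v0, of p] unfolding v_def by simp
  then have TTu: "Td (Td u) = (\<lambda>p. 0)" by auto
  have z: "Xd (\<lambda>p. 0::real) = (\<lambda>p. 0)" "Yd (\<lambda>p. 0::real) = (\<lambda>p. 0)"
    by (simp_all add: Xd_Yd_eq_ddir fun_eq_iff)
  then have z3: "sublap (\<lambda>p. 0) = (\<lambda>p. 0)" unfolding sublap_def[abs_def] by simp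
  define b where "b = Td u"
  have b: "smooth b" unfolding b_def by (rule sT)
  have TX: "Td (Xd u) = Xd b" "Td (Yd u) = Yd b" "Td (sublap u) = sublap b"
    using Td_Xd_Yd_commute[OF o u(1)] Td_sublap_commute[OF o u(1)] unfolding b_def by auto
  have TTX: "Td (Td (Xd u)) = (\<lambda>p. 0)" "Td (Td (Yd u)) = (\<lambda>p. 0)" "Td (Td (sublap u)) = (\<lambda>p. 0)"
    unfolding TX using Td_Xd_Yd_commute[OF o b] Td_sublap_commute[OF o b] TTu z z3 unfolding b_def by auto
  have TT0: "Td (Td (Xd u)) p = 0" "Td (Td (Yd u)) p = 0" "Td (Td (sublap u)) p = 0" for p
    using TTX by simp_all
  obtain R where R: "\<And>p. p \<in> K \<Longrightarrow> norm p \<le> R"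
    using compact_imp_bounded[OF K(1)] unfolding bounded_iff by auto
  have far: "(x, y, t) \<notin> K" if "t > R" for x y t
  proof -
    have "\<bar>t\<bar>\<^sup>2 \<le> (norm (x, y, t))\<^sup>2" by (simp add: norm_hpt)
    then have "\<bar>t\<bar> \<le> norm (x, y, t)" by (rule power2_le_imp_le) simp
    then show ?thesis using R[of "(x, y, t)"] that by fastforce
  qed
  have Xb: "Xd b (x, y, 0) = 0 \<and> Yd b (x, y, 0) = 0" for x y
  proof (rule eventually_quadratic_le_linear)
    show "\<forall>\<^sub>F t in at_top. (Xd u (x, y, 0) + t * Xd b (x, y, 0))\<^sup>2 + (Yd u (x, y, 0) + t * Yd b (x, y, 0))\<^sup>2
       \<le> - sublap u (x, y, 0) + t * (- sublap b (x, y, 0))"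
      using eventually_gt_at_top[of R]
    proof eventually_elim
      case (elim t)
      have a: "Xd u (x, y, t) = Xd u (x, y, 0) + t * Xd b (x, y, 0)"
        "Yd u (x, y, t) = Yd u (x, y, 0) + t * Yd b (x, y, 0)"
        "sublap u (x, y, t) = sublap u (x, y, 0) + t * sublap b (x, y, 0)"
        using Td_Td_eq_0_imp_affine[OF sX(1)[OF u(1)] TT0(1), of x y t]
          Td_Td_eq_0_imp_affine[OF sX(2)[OF u(1)] TT0(2), of x y t]
          Td_Td_eq_0_imp_affine[OF smooth_on_sublap[OF open_UNIV u(1)] TT0(3), of x y t]
        unfolding TX by simp_all
      show ?case using K(2)[OF far[OF elim, of x y]] unfolding grad_b_sq_def a by simp
    qed
  qed
  have "Td (Xd b) p = 0" "Td (Yd b) p = 0" for p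
    using TTX TX by simp_all
  then have "Xd b (x, y, t) = 0 \<and> Yd b (x, y, t) = 0" for x y t
    using Td_eq_0_imp_const[OF sX(1)[OF b]] Td_eq_0_imp_const[OF sX(2)[OF b]] Xb by metis
  then have bX: "Xd b = (\<lambda>p. 0)" "Yd b = (\<lambda>p. 0)" by (auto simp: fun_eq_iff)
  \<comment> \<open>By the third-order equations the horizontal gradient of the sublaplacian
    consists of T-derivatives of X u and Y u, that is of multiples of X b and Y b, which
    vanish.\<close>
  have lap: "sublap u p = sublap u 0" for p
    by (rule horizontal_gradient_eq_0_imp_const[OF smooth_on_sublap[OF open_UNIV u(1)]])
      (simp_all add: pluriharmonic_third_order[OF u] TX bX)
  \<comment> \<open>X u and Y u do not depend on t, so they may be evaluated at height
    \<open>R + 1\<close>, outside \<open>K\<close>.\<close>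
  have grad: "(Xd u p)\<^sup>2 + (Yd u p)\<^sup>2 \<le> - sublap u 0" for p
  proof -
    obtain x y t where p: "p = (x, y, t)" by (cases p)
    have "Xd u p = Xd u (x, y, R + 1)" "Yd u p = Yd u (x, y, R + 1)"
      unfolding p using Td_eq_0_imp_const[OF sX(1)[OF u(1)]] Td_eq_0_imp_const[OF sX(2)[OF u(1)]] TX bX by metis+
    then show ?thesis using K(2)[OF far[of "R + 1" x y]] lap[of "(x, y, R + 1)"] unfolding grad_b_sq_def by simp
  qed
  have "\<bar>Xd u p\<bar> \<le> sqrt (- sublap u 0)" "\<bar>Yd u p\<bar> \<le> sqrt (- sublap u 0)" for p
    using grad[of p] by (auto intro!: real_le_rsqrt simp: add_increasing add_increasing2 intro: order_trans[rotated])
  then have "sublap u 0 = 0"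
    by (rule sublap_const_horizontal_gradient_bounded[OF u(1) lap])
  then have "(Xd u p)\<^sup>2 + (Yd u p)\<^sup>2 \<le> 0" for p using grad[of p] by simp
  then have "Xd u p = 0" "Yd u p = 0" for p by (simp_all add: sum_power2_le_zero_iff)
  then show ?thesis by (intro horizontal_gradient_eq_0_imp_const[OF u(1)])
qed

section \<open>Finite perimeter of smooth bounded domains\<close>

lemma smooth_on_Un: "smooth_on U f \<Longrightarrow> smooth_on V f \<Longrightarrow> smooth_on (U \<union> V) f"
  unfolding smooth_on_def by blast

lemma smooth_on_pointwise:
  assumes "\<And>p. p \<in> U \<Longrightarrow> \<exists>V. p \<in> V \<and> smooth_on V f"
  shows "smooth_on U f"
  using assms unfolding smooth_on_def by metis

text \<open>The product is smooth on \<open>U\<close>, the zero function on the complement of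
  \<open>S\<close>; these open sets cover the space, and the two definitions agree where they
  overlap.\<close>

lemma test_fun_cutoff:
  fixes h \<eta> :: "hpt \<Rightarrow> real"
  assumes U: "open U" and h: "smooth_on U h" and \<eta>: "test_fun \<eta>" and S: "closed S" "S \<subseteq> U"
    and zero: "\<And>p. p \<notin> S \<Longrightarrow> \<eta> p = 0"
  shows "test_fun (\<lambda>p. if p \<in> S then \<eta> p * h p else 0)" (is "test_fun ?k")
proof -
  have "smooth_on U ?k"
  proof (rule smooth_on_cong[OF U])
    show "smooth_on U (\<lambda>p. \<eta> p * h p)"
      by (intro smooth_on_arith U h smooth_on_subset[OF test_fun_smooth[OF \<eta>]]) simp
  qed (use zero in auto)
  moreover have "smooth_on (- S) ?k"
    by (rule smooth_on_cong[of _ "\<lambda>p. 0"]) (use S in auto)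
  ultimately have "smooth_on (U \<union> - S) ?k" by (rule smooth_on_Un)
  moreover have "U \<union> - S = UNIV" using S by auto
  ultimately have "smooth ?k" by simp
  moreover obtain R where "\<And>p. norm p > R \<Longrightarrow> \<eta> p = 0" using test_fun_support[OF \<eta>] by metis
  ultimately show ?thesis by (intro test_funI[of _ R]) auto
qed

text \<open>Treats X and Y at once: the perimeter argument uses of a field only the properties
  collected in the next two lemmas.\<close>

definition left_invariant_field :: "(hpt \<Rightarrow> hpt) \<Rightarrow> bool" where
  "left_invariant_field W \<longleftrightarrow> W = Xvec \<or> W = Yvec"

lemma left_invariant_field_facts:
  assumes W: "left_invariant_field W"
  shows "open U \<Longrightarrow> smooth_on U (f :: hpt \<Rightarrow> real) \<Longrightarrow> smooth_on U (\<lambda>p. ddir (W p) f p)"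
    "test_fun (g :: hpt \<Rightarrow> real) \<Longrightarrow> test_fun (\<lambda>p. ddir (W p) g p)"
    "test_fun (g :: hpt \<Rightarrow> real) \<Longrightarrow> integral\<^sup>L lborel (\<lambda>p. ddir (W p) g p) = 0"
proof -
  have e: "Xd f = (\<lambda>p. ddir (Xvec p) f p)" "Yd f = (\<lambda>p. ddir (Yvec p) f p)" for f :: "hpt \<Rightarrow> real"
    by (auto simp: Xd_Yd_eq_ddir)
  show "open U \<Longrightarrow> smooth_on U (f :: hpt \<Rightarrow> real) \<Longrightarrow> smooth_on U (\<lambda>p. ddir (W p) f p)"
    using W smooth_on_Xd_Yd unfolding left_invariant_field_def e by blast
  show "test_fun (g :: hpt \<Rightarrow> real) \<Longrightarrow> test_fun (\<lambda>p. ddir (W p) g p)"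
    using W test_fun_Xd_Yd unfolding left_invariant_field_def e by blast
  show "test_fun (g :: hpt \<Rightarrow> real) \<Longrightarrow> integral\<^sup>L lborel (\<lambda>p. ddir (W p) g p) = 0"
    using W integral_Xd_Yd_eq_0 unfolding left_invariant_field_def e by blast
qed

lemma test_fun_test_fun_by_parts:
  assumes W: "left_invariant_field W" and f: "test_fun f" and g: "test_fun (g :: hpt \<Rightarrow> real)"
  shows "integral\<^sup>L lborel (\<lambda>p. f p * ddir (W p) g p) = - integral\<^sup>L lborel (\<lambda>p. ddir (W p) f p * g p)"
  using integral_by_parts(2,3)[OF test_fun_smooth[OF f] g] W
  unfolding left_invariant_field_def Xd_Yd_eq_ddir by auto

lemma test_fun_measurable: "test_fun (g :: hpt \<Rightarrow> real) \<Longrightarrow> g \<in> borel_measurable borel"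
  by (intro borel_measurable_continuous_onI test_fun_continuous)

lemma ddir_eq_0_outside:
  fixes g :: "hpt \<Rightarrow> real"
  assumes "closed S" "\<And>p. p \<notin> S \<Longrightarrow> g p = 0" "p \<notin> S"
  shows "ddir v g p = 0"
  using ddir_cong_open[of "- S" p g "\<lambda>p. 0" v] assms by (simp add: open_Compl)

text \<open>With \<open>k\<^sub>n = exp (1 / (n r))\<close> for \<open>r < 0\<close> as smooth approximations of the indicator of
  \<open>{r < 0}\<close>, transversality of \<open>v\<close> bounds \<open>|W k\<^sub>n|\<close> by a multiple of \<open>- v k\<^sub>n\<close>, whose integral
  is controlled after one more integration by parts.\<close>
lemma local_perimeter_bound:
  fixes r :: "hpt \<Rightarrow> real"
  assumes W: "left_invariant_field W" and U: "open U" "p0 \<in> U" and r: "smooth_on U r"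
    and nz: "frechet_derivative r (at p0) \<noteq> (\<lambda>_. 0)"
    and \<Omega>: "\<Omega> \<inter> U = {q\<in>U. r q < 0}" and meas: "\<Omega> \<in> sets borel"
  shows "\<exists>V \<eta> B. open V \<and> p0 \<in> V \<and> test_fun \<eta> \<and> (\<forall>p. 0 \<le> \<eta> p \<and> \<eta> p \<le> (1::real)) \<and> (\<forall>p\<in>V. \<eta> p = 1) \<and>
    (\<forall>f. test_fun f \<longrightarrow> (\<forall>p. \<bar>f p\<bar> \<le> 1) \<longrightarrow>
      \<bar>integral\<^sup>L lborel (\<lambda>p. indicator \<Omega> p * ddir (W p) (\<lambda>p. \<eta> p * f p) p)\<bar> \<le> B)"
proof -
  \<comment> \<open>All directions are allowed for \<open>v\<close>, not only horizontal ones: at a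
    characteristic point of the boundary X r and Y r both vanish.\<close>
  have "\<exists>v. ddir v r p0 \<noteq> 0" using nz unfolding ddir_def by auto
  then obtain v' where v': "ddir v' r p0 \<noteq> 0" by blast
  have "\<exists>v. ddir v r p0 > 0"
  proof (cases "ddir v' r p0 > 0")
    case False
    have "ddir (- v') r p0 = - ddir v' r p0"
      using ddir_linear_comb[OF smooth_on_differentiable[OF r U(2)], of "-1" v' 0 v'] by simp
    then have "ddir (- v') r p0 > 0" using v' False by simp
    then show ?thesis by blast
  qed blast
  then obtain v where v: "ddir v r p0 > 0" by blast
  define c where "c = ddir v r p0 / 2"
  have c: "c > 0" "ddir v r p0 > c" using v by (simp_all add: c_def)
  have "isCont (ddir v r) p0"
    using smooth_on_continuous_on[OF smooth_on_ddir[OF r]] U continuous_on_eq_continuous_at by blast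
  then have "\<forall>\<^sub>F q in at p0. ddir v r q > c"
    using c(2) unfolding isCont_def by (rule order_tendstoD(1))
  then obtain d1 where d1: "d1 > 0" "\<And>q. q \<noteq> p0 \<Longrightarrow> dist q p0 < d1 \<Longrightarrow> ddir v r q > c"
    unfolding eventually_at by auto
  obtain d2 where d2: "d2 > 0" "ball p0 d2 \<subseteq> U" using U open_contains_ball by metis
  \<comment> \<open>Dividing by 8 keeps the ball of radius \<open>4 * d\<close> inside both
    neighbourhoods. \<open>\<eta>\<close> is supported within radius \<open>2 * d\<close>, where the
    wider cutoff \<open>\<eta>'\<close> equals 1.\<close>
  define d where "d = min d1 d2 / 8"
  have d: "d > 0" using d1 d2 by (simp add: d_def)
  have tr: "ddir v r q > c" if "dist p0 q \<le> 4 * d" for q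
    using d1 d2 that c(2) by (cases "q = p0") (auto simp: d_def dist_commute)
  have SU: "cball p0 (4 * d) \<subseteq> U" using d2 d1 by (auto simp: d_def intro!: subsetD[OF d2(2)])
  obtain \<eta> :: "hpt \<Rightarrow> real" where \<eta>: "test_fun \<eta>" "\<And>p. 0 \<le> \<eta> p" "\<And>p. \<eta> p \<le> 1"
    "\<And>p. dist p0 p \<le> d \<Longrightarrow> \<eta> p = 1" "\<And>p. dist p0 p \<ge> 2 * d \<Longrightarrow> \<eta> p = 0"
    by (rule exists_bump[of d p0, OF d]) blast
  have d': "2 * d > 0" using d by simp
  obtain \<eta>' :: "hpt \<Rightarrow> real" where \<eta>': "test_fun \<eta>'" "\<And>p. 0 \<le> \<eta>' p" "\<And>p. \<eta>' p \<le> 1"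
    "\<And>p. dist p0 p \<le> 2 * d \<Longrightarrow> \<eta>' p = 1" "\<And>p. dist p0 p \<ge> 2 * (2 * d) \<Longrightarrow> \<eta>' p = 0"
    by (rule exists_bump[of "2 * d" p0, OF d']) blast
  define Wr where "Wr = (\<lambda>p. ddir (W p) r p)"
  have "bounded (Wr ` cball p0 (4 * d))"
    unfolding Wr_def using left_invariant_field_facts(1)[OF W U(1) r] SU
    by (intro compact_imp_bounded compact_continuous_image) (auto intro: continuous_on_subset smooth_on_continuous_on)
  then obtain M where M: "M > 0" "\<And>p. p \<in> cball p0 (4 * d) \<Longrightarrow> \<bar>Wr p\<bar> \<le> M"
    unfolding bounded_pos by auto
  define B where "B = M / c * integral\<^sup>L lborel (\<lambda>p. \<bar>ddir v \<eta> p\<bar>)"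
  have "\<bar>integral\<^sup>L lborel (\<lambda>p. indicator \<Omega> p * ddir (W p) (\<lambda>p. \<eta> p * f p) p)\<bar> \<le> B"
    if f: "test_fun f" and f1: "\<And>p. \<bar>f p\<bar> \<le> 1" for f
  proof -
    define g where "g = (\<lambda>p. \<eta> p * f p)"
    define Wg where "Wg = (\<lambda>p. ddir (W p) g p)"
    have g: "test_fun g" unfolding g_def by (rule test_fun_mult[OF test_fun_smooth[OF \<eta>(1)] f])
    have Wg: "test_fun Wg" unfolding Wg_def by (rule left_invariant_field_facts(2)[OF W g])
    have Wg0: "Wg p = 0" if "dist p0 p > 2 * d" for p
      unfolding Wg_def by (rule ddir_eq_0_outside[of "cball p0 (2 * d)"]) (use that \<eta>(5) in \<open>auto simp: g_def\<close>)
    define H where "H n = (\<lambda>s. flat 0 (- (real (Suc n) * s)))" for n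
    have H01: "0 \<le> H n s" "H n s \<le> 1" for n s unfolding H_def by (auto intro: flat_0_le_1)
    have DH: "DERIV (H n) s :> - (real (Suc n) * flat 2 (- (real (Suc n) * s)))" for n s
    proof -
      have "DERIV (\<lambda>s. - (real (Suc n) * s)) s :> - real (Suc n)" by (auto intro!: derivative_eq_intros)
      from DERIV_chain2[OF DERIV_flat this, of 0] show ?thesis
        unfolding H_def by (simp add: numeral_2_eq_2 algebra_simps)
    qed
    \<comment> \<open>The cutoff \<open>\<eta>'\<close> turns the composition of \<open>H n\<close>
      with \<open>r\<close>, which is controlled only on \<open>U\<close>, into a test function
      without changing it where \<open>\<eta>\<close> lives.\<close>
    define k where "k n = (\<lambda>p. if p \<in> cball p0 (4 * d) then \<eta>' p * H n (r p) else 0)" for n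
    have k: "test_fun (k n)" for n
      unfolding k_def
    proof (rule test_fun_cutoff[OF U(1) _ \<eta>'(1) closed_cball SU])
      show "smooth_on U (\<lambda>p. H n (r p))" unfolding H_def
        by (rule smooth_on_flat[OF U(1) smooth_on_arith(4)[OF U(1) smooth_on_arith(2)[OF U(1) smooth_on_const r] r]])
    qed (use \<eta>'(5) in auto)
    have k01: "0 \<le> k n p" "k n p \<le> 1" for n p
      unfolding k_def using \<eta>'(2,3) H01 by (auto simp: mult_le_one)
    have k_eq: "k n p = H n (r p)" if "dist p0 p \<le> 2 * d" for n p
      unfolding k_def using that d \<eta>'(4) by auto
    have Dk: "ddir w (k n) p = - (real (Suc n) * flat 2 (- (real (Suc n) * r p))) * ddir w r p"
      if "dist p0 p < 2 * d" for n p w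
    proof -
      have "ddir w (k n) p = ddir w (\<lambda>p. H n (r p)) p"
        by (rule ddir_cong_open[of "ball p0 (2 * d)"]) (use that k_eq in auto)
      also have "\<dots> = - (real (Suc n) * flat 2 (- (real (Suc n) * r p))) * ddir w r p"
        using that SU d by (intro ddir_DERIV_comp DH smooth_on_differentiable[OF r]) auto
      finally show ?thesis .
    qed
    have bound: "\<bar>integral\<^sup>L lborel (\<lambda>p. k n p * Wg p)\<bar> \<le> B" for n
    proof -
      have "\<bar>integral\<^sup>L lborel (\<lambda>p. k n p * Wg p)\<bar> = \<bar>integral\<^sup>L lborel (\<lambda>p. ddir (W p) (k n) p * g p)\<bar>"
        unfolding Wg_def test_fun_test_fun_by_parts[OF W k g] by simp
      also have "\<dots> \<le> integral\<^sup>L lborel (\<lambda>p. - (M / c) * (\<eta> p * ddir v (k n) p))"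
      proof (rule integral_abs_bound[THEN order_trans], rule integral_mono)
        note Wk = left_invariant_field_facts(2)[OF W k]
        show "integrable lborel (\<lambda>p. \<bar>ddir (W p) (k n) p * g p\<bar>)"
          by (intro integrable_abs test_fun_integrable test_fun_mult g test_fun_smooth Wk)
        show "integrable lborel (\<lambda>p. - (M / c) * (\<eta> p * ddir v (k n) p))"
          by (intro integrable_mult_right test_fun_integrable test_fun_mult test_fun_ddir test_fun_smooth k \<eta>)
        fix p
        show "\<bar>ddir (W p) (k n) p * g p\<bar> \<le> - (M / c) * (\<eta> p * ddir v (k n) p)"
        proof (cases "dist p0 p < 2 * d")
          case True
          define F where "F = real (Suc n) * flat 2 (- (real (Suc n) * r p))"
          have F: "F \<ge> 0" unfolding F_def by simp
          have "\<bar>ddir (W p) (k n) p * g p\<bar> = F * \<bar>Wr p\<bar> * (\<eta> p * \<bar>f p\<bar>)"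
            unfolding Dk[OF True] F_def[symmetric] g_def Wr_def using F \<eta>(2) by (simp add: abs_mult)
          also have "\<dots> \<le> F * M * (\<eta> p * 1)"
            using M(2)[of p] True d F \<eta>(2)[of p] f1[of p] M(1)
            by (intro mult_mono) (auto intro!: mult_nonneg_nonneg)
          also have "\<dots> = (M / c) * (\<eta> p * (F * c))" using c by simp
          also have "\<dots> \<le> (M / c) * (\<eta> p * (F * ddir v r p))"
            using tr[of p] True d F \<eta>(2)[of p] c M(1) by (intro mult_left_mono) auto
          also have "\<dots> = - (M / c) * (\<eta> p * ddir v (k n) p)"
            unfolding Dk[OF True] F_def by simp
          finally show ?thesis .
        next
          case False
          then show ?thesis using \<eta>(5)[of p] by (simp add: g_def)
        qed
      qed
      \<comment> \<open>Moving \<open>v\<close> from \<open>k n\<close> to \<open>\<eta>\<close>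
        gives a bound independent of \<open>n\<close> and \<open>f\<close>, because
        \<open>k n\<close> lies between 0 and 1.\<close>
      also have "\<dots> = M / c * integral\<^sup>L lborel (\<lambda>p. ddir v \<eta> p * k n p)"
        using integral_by_parts(1)[OF test_fun_smooth[OF \<eta>(1)] k] by simp
      also have "\<dots> \<le> B" unfolding B_def
      proof (intro mult_left_mono integral_mono)
        show "integrable lborel (\<lambda>p. ddir v \<eta> p * k n p)"
          by (intro test_fun_integrable test_fun_mult smooth_on_ddir test_fun_smooth k \<eta>)
        show "integrable lborel (\<lambda>p. \<bar>ddir v \<eta> p\<bar>)"
          by (intro integrable_abs test_fun_integrable test_fun_ddir \<eta>)
        fix p
        have "ddir v \<eta> p * k n p \<le> \<bar>ddir v \<eta> p\<bar> * k n p" using k01 by (intro mult_right_mono) auto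
        also have "\<dots> \<le> \<bar>ddir v \<eta> p\<bar>" using k01[of n p] by (simp add: mult_left_le)
        finally show "ddir v \<eta> p * k n p \<le> \<bar>ddir v \<eta> p\<bar>" .
      qed (use M c in auto)
      finally show ?thesis .
    qed
    have "(\<lambda>n. integral\<^sup>L lborel (\<lambda>p. k n p * Wg p)) \<longlonglongrightarrow> integral\<^sup>L lborel (\<lambda>p. indicator \<Omega> p * Wg p)"
    proof (rule integral_dominated_convergence[where w="\<lambda>p. \<bar>Wg p\<bar>"])
      show "(\<lambda>p. indicator \<Omega> p * Wg p) \<in> borel_measurable lborel"
        using meas test_fun_measurable[OF Wg] by simp
      show "(\<lambda>p. k n p * Wg p) \<in> borel_measurable lborel" for n
        using test_fun_measurable[OF k] test_fun_measurable[OF Wg] by simp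
      show "integrable lborel (\<lambda>p. \<bar>Wg p\<bar>)" by (intro integrable_abs test_fun_integrable Wg)
      show "AE p in lborel. norm (k n p * Wg p) \<le> \<bar>Wg p\<bar>" for n
        using k01 by (intro AE_I2) (simp add: abs_mult mult_left_le_one_le)
      show "AE p in lborel. (\<lambda>n. k n p * Wg p) \<longlonglongrightarrow> indicator \<Omega> p * Wg p"
      proof (rule AE_I2)
        fix p
        show "(\<lambda>n. k n p * Wg p) \<longlonglongrightarrow> indicator \<Omega> p * Wg p"
        proof (cases "dist p0 p \<le> 2 * d")
          case False then show ?thesis using Wg0[of p] by simp
        next
          case True
          then have "p \<in> U" using SU d by auto
          then have iff: "p \<in> \<Omega> \<longleftrightarrow> r p < 0" using \<Omega> by blast
          have "(\<lambda>n. k n p) \<longlonglongrightarrow> indicator \<Omega> p"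
          proof (cases "r p < 0")
            case neg: True
            have "(\<lambda>n. exp (- (inverse (real (Suc n)) * inverse (- r p)))) \<longlonglongrightarrow> exp (- (0 * inverse (- r p)))"
              by (intro tendsto_intros LIMSEQ_inverse_real_of_nat)
            moreover have "exp (- (inverse (real (Suc n)) * inverse (- r p))) = k n p" for n
            proof -
              have "- (real (Suc n) * r p) > 0" using neg by (simp add: mult_pos_neg del: of_nat_Suc)
              then show ?thesis unfolding k_eq[OF True] H_def flat_def
                by (simp del: of_nat_Suc)
            qed
            ultimately have "(\<lambda>n. k n p) \<longlonglongrightarrow> exp (- (0 * inverse (- r p)))" by (simp only:)
            then show ?thesis using iff neg by simp
          next
            case pos: False
            have "k n p = 0" for n unfolding k_eq[OF True] H_def using pos by simp
            then show ?thesis using iff pos by simp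
          qed
          then show ?thesis by (intro tendsto_intros)
        qed
      qed
    qed
    then have "(\<lambda>n. \<bar>integral\<^sup>L lborel (\<lambda>p. k n p * Wg p)\<bar>) \<longlonglongrightarrow> \<bar>integral\<^sup>L lborel (\<lambda>p. indicator \<Omega> p * Wg p)\<bar>"
      by (rule tendsto_rabs)
    then show ?thesis unfolding Wg_def g_def
      by (rule LIMSEQ_le_const2) (use bound in \<open>auto simp: Wg_def g_def\<close>)
  qed
  then show ?thesis using d \<eta>
    by (intro exI[of _ "ball p0 d"] exI[of _ \<eta>] exI[of _ B]) auto
qed

text \<open>Vanishing near the frontier makes the product of \<open>f\<close> with the indicator of
  \<open>\<Omega>\<close> a test function, and the integral of its derivative along \<open>W\<close>
  is 0.\<close>

lemma integral_ddir_vanishing_near_frontier: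
  assumes W: "left_invariant_field W" and \<Omega>: "open \<Omega>" and f: "test_fun (f :: hpt \<Rightarrow> real)"
    and van: "\<And>p. p \<in> frontier \<Omega> \<Longrightarrow> \<exists>N. open N \<and> p \<in> N \<and> (\<forall>q\<in>N. f q = 0)"
  shows "integral\<^sup>L lborel (\<lambda>p. indicator \<Omega> p * ddir (W p) f p) = 0"
proof -
  define g where "g = (\<lambda>p. indicator \<Omega> p * f p)"
  have local: "\<exists>V h. open V \<and> p \<in> V \<and> smooth h \<and> (\<forall>q\<in>V. h q = g q) \<and>
      (\<forall>v. ddir v h p = indicator \<Omega> p * ddir v f p)" for p
  proof -
    consider "p \<in> \<Omega>" | "p \<in> frontier \<Omega>" | "p \<in> - closure \<Omega>"
      using \<Omega> by (auto simp: frontier_def interior_open)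
    then show ?thesis
    proof cases
      case 1 then show ?thesis using \<Omega> test_fun_smooth[OF f]
        by (intro exI[of _ \<Omega>] exI[of _ f]) (auto simp: g_def)
    next
      case 2
      then have "p \<notin> \<Omega>" using \<Omega> by (simp add: frontier_def interior_open)
      with van[OF 2] show ?thesis by (metis g_def indicator_simps(2) ddir_const mult_zero_left mult_zero_right smooth_on_const)
    next
      case 3
      then have "p \<notin> \<Omega>" "\<And>q. q \<in> - closure \<Omega> \<Longrightarrow> g q = 0" using closure_subset by (auto simp: g_def indicator_def)
      then show ?thesis using 3 by (intro exI[of _ "- closure \<Omega>"] exI[of _ "\<lambda>p. 0"]) (simp add: open_Compl)
    qed
  qed
  have "smooth g"
  proof (rule smooth_on_pointwise)
    fix p :: hpt
    obtain V h where "open V" "p \<in> V" "smooth h" "\<forall>q\<in>V. h q = g q" using local[of p] by blast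
    then show "\<exists>V. p \<in> V \<and> smooth_on V g" using smooth_on_cong[of V h g] smooth_on_subset by blast
  qed
  moreover obtain R where "\<And>p. norm p > R \<Longrightarrow> f p = 0" using test_fun_support[OF f] by metis
  ultimately have g: "test_fun g" by (intro test_funI[of g R]) (auto simp: g_def)
  have "ddir v g p = indicator \<Omega> p * ddir v f p" for v p
  proof -
    obtain V h where V: "open V" "p \<in> V" "\<forall>q\<in>V. h q = g q" "ddir v h p = indicator \<Omega> p * ddir v f p" using local[of p] by blast
    then show ?thesis using ddir_cong_open[of V p h g v] by simp
  qed
  then show ?thesis using left_invariant_field_facts(3)[OF W g] by simp
qed

text \<open>Finitely many of the local neighbourhoods cover the compact frontier. Splitting off
  \<open>\<eta> i * f\<close> one neighbourhood at a time leaves a function that vanishes near ever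
  more of the frontier, until \<open>integral_ddir_vanishing_near_frontier\<close> applies.\<close>

lemma finite_perimeter:
  assumes W: "left_invariant_field W" and \<Omega>: "smooth_bounded_domain \<Omega>"
  shows "\<exists>B. \<forall>f. test_fun f \<longrightarrow> (\<forall>p. \<bar>f p\<bar> \<le> (1::real)) \<longrightarrow>
     \<bar>integral\<^sup>L lborel (\<lambda>p. indicator \<Omega> p * ddir (W p) f p)\<bar> \<le> B"
proof -
  have op: "open \<Omega>" and bdd: "bounded \<Omega>" using \<Omega> unfolding smooth_bounded_domain_def by auto
  have meas: "\<Omega> \<in> sets borel" using op by simp
  let ?I = "\<lambda>f :: hpt \<Rightarrow> real. integral\<^sup>L lborel (\<lambda>p. indicator \<Omega> p * ddir (W p) f p)"
  have int: "integrable lborel (\<lambda>p. indicator \<Omega> p * h p)" if "test_fun h" for h :: "hpt \<Rightarrow> real"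
    using integrable_mult_indicator[of \<Omega> lborel h] meas test_fun_integrable[OF that] by simp
  define L where "L p V \<eta> B \<longleftrightarrow> open V \<and> p \<in> V \<and> test_fun \<eta> \<and> (\<forall>p. 0 \<le> \<eta> p \<and> \<eta> p \<le> (1::real)) \<and> (\<forall>p\<in>V. \<eta> p = 1) \<and>
    (\<forall>f. test_fun f \<longrightarrow> (\<forall>p. \<bar>f p\<bar> \<le> 1) \<longrightarrow> \<bar>?I (\<lambda>p. \<eta> p * f p)\<bar> \<le> B)" for p V \<eta> B
  have "\<exists>V \<eta> B. L p V \<eta> B" if p: "p \<in> frontier \<Omega>" for p
  proof -
    obtain U r where "open U" "p \<in> U" "smooth_on U (r :: hpt \<Rightarrow> real)"
        "\<forall>q\<in>U. frechet_derivative r (at q) \<noteq> (\<lambda>_. 0)" "\<Omega> \<inter> U = {q\<in>U. r q < 0}"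
      using \<Omega> p unfolding smooth_bounded_domain_def by blast
    then show ?thesis using local_perimeter_bound[OF W, of U p r \<Omega>] meas unfolding L_def by simp
  qed
  then obtain V \<eta> B where "\<And>p. p \<in> frontier \<Omega> \<Longrightarrow> L p (V p) (\<eta> p) (B p)"
    by metis
  note loc = this[unfolded L_def]
  have "compact (frontier \<Omega>)" using bdd by (simp add: compact_frontier_bounded)
  moreover have "open (V p)" if "p \<in> frontier \<Omega>" for p using loc[OF that] by simp
  moreover have "frontier \<Omega> \<subseteq> (\<Union>p\<in>frontier \<Omega>. V p)" using loc by (intro subsetI UN_I) auto
  ultimately obtain J where J: "J \<subseteq> frontier \<Omega>" "finite J" "frontier \<Omega> \<subseteq> (\<Union>p\<in>J. V p)"
    by (rule compactE_image)
  \<comment> \<open>The induction over \<open>J\<close> treats all \<open>f\<close> that already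
    vanish near the frontier points not covered by \<open>J\<close>; in the step, \<open>f2\<close>
    vanishes on \<open>V i\<close> because \<open>\<eta> i\<close> is 1 there.\<close>
  have "\<exists>C. \<forall>f. test_fun f \<longrightarrow> (\<forall>p. \<bar>f p\<bar> \<le> 1) \<longrightarrow>
      (\<forall>p\<in>frontier \<Omega> - (\<Union>p\<in>J. V p). \<exists>N. open N \<and> p \<in> N \<and> (\<forall>q\<in>N. f q = 0)) \<longrightarrow> \<bar>?I f\<bar> \<le> C"
    using J(2,1)
  proof induction
    case empty
    have "?I f = 0" if "test_fun f" "\<forall>p\<in>frontier \<Omega>. \<exists>N. open N \<and> p \<in> N \<and> (\<forall>q\<in>N. f q = 0)" for f :: "hpt \<Rightarrow> real"
      using integral_ddir_vanishing_near_frontier[OF W op that(1)] that(2) by blast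
    then show ?case by (intro exI[of _ 0] allI impI) simp
  next
    case (insert i J)
    then obtain C where C: "\<And>f. test_fun f \<Longrightarrow> (\<forall>p. \<bar>f p\<bar> \<le> 1) \<Longrightarrow>
      (\<forall>p\<in>frontier \<Omega> - (\<Union>p\<in>J. V p). \<exists>N. open N \<and> p \<in> N \<and> (\<forall>q\<in>N. f q = 0)) \<Longrightarrow> \<bar>?I f\<bar> \<le> C"
      by auto
    have i: "i \<in> frontier \<Omega>" using insert.prems by simp
    note li = loc[OF i]
    show ?case
    proof (intro exI[of _ "B i + C"] allI impI)
      fix f :: "hpt \<Rightarrow> real"
      assume f: "test_fun f" "\<forall>p. \<bar>f p\<bar> \<le> 1"
        "\<forall>p\<in>frontier \<Omega> - (\<Union>p\<in>insert i J. V p). \<exists>N. open N \<and> p \<in> N \<and> (\<forall>q\<in>N. f q = 0)"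
      define f1 where "f1 = (\<lambda>q. \<eta> i q * f q)"
      define f2 where "f2 = (\<lambda>q. (1 - \<eta> i q) * f q)"
      have s1: "test_fun f1" unfolding f1_def using li f(1) by (intro test_fun_mult test_fun_smooth) auto
      have s2: "test_fun f2" unfolding f2_def
        using li f(1) by (intro test_fun_mult smooth_on_arith smooth_on_const open_UNIV test_fun_smooth) auto
      have a2: "\<forall>p. \<bar>f2 p\<bar> \<le> 1"
        using f(2) li unfolding f2_def by (auto simp: abs_mult intro!: mult_le_one)
      have v2: "\<exists>N. open N \<and> p \<in> N \<and> (\<forall>q\<in>N. f2 q = 0)" if p: "p \<in> frontier \<Omega> - (\<Union>p\<in>J. V p)" for p
      proof (cases "p \<in> V i")
        case True then show ?thesis using li by (intro exI[of _ "V i"]) (auto simp: f2_def)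
      next
        case False
        then have "p \<in> frontier \<Omega> - (\<Union>p\<in>insert i J. V p)" using p by auto
        from bspec[OF f(3) this] obtain N where "open N" "p \<in> N" "\<forall>q\<in>N. f q = 0" by (elim exE conjE)
        then show ?thesis by (intro exI[of _ N]) (simp add: f2_def)
      qed
      have "f = (\<lambda>q. f1 q + f2 q)" by (auto simp: f1_def f2_def algebra_simps)
      then have "?I f = integral\<^sup>L lborel (\<lambda>p. indicator \<Omega> p * ddir (W p) f1 p + indicator \<Omega> p * ddir (W p) f2 p)"
        using ddir_arith(1)[OF test_fun_differentiable[OF s1] test_fun_differentiable[OF s2]] by (simp add: distrib_left)
      also have "\<dots> = ?I f1 + ?I f2"
        by (rule Bochner_Integration.integral_add[OF int[OF left_invariant_field_facts(2)[OF W s1]]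
              int[OF left_invariant_field_facts(2)[OF W s2]]])
      finally have "\<bar>?I f\<bar> \<le> \<bar>?I f1\<bar> + \<bar>?I f2\<bar>" by simp
      moreover have "\<bar>?I f1\<bar> \<le> B i" unfolding f1_def using li f by blast
      moreover have "\<bar>?I f2\<bar> \<le> C" using C[OF s2 a2] v2 by blast
      ultimately show "\<bar>?I f\<bar> \<le> B i + C" by linarith
    qed
  qed
  then obtain C where "\<forall>f. test_fun f \<longrightarrow> (\<forall>p. \<bar>f p\<bar> \<le> 1) \<longrightarrow>
      (\<forall>p\<in>frontier \<Omega> - (\<Union>p\<in>J. V p). \<exists>N. open N \<and> p \<in> N \<and> (\<forall>q\<in>N. f q = 0)) \<longrightarrow> \<bar>?I f\<bar> \<le> C"
    by blast
  moreover have "frontier \<Omega> - (\<Union>p\<in>J. V p) = {}" using J(3) by blast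
  ultimately show ?thesis by auto
qed

section \<open>The isoperimetric inequality\<close>

text \<open>With \<open>W = |z|\<^sup>2 + e - i t\<close> we have \<open>hN e = |W|\<^sup>2\<close>, and \<open>(kernX e, kernY e)\<close> is the horizontal
  gradient of \<open>- 1 / |W|\<close>, a regularisation of the fundamental solution of the sublaplacian.\<close>
definition hN :: "real \<Rightarrow> hpt \<Rightarrow> real" where
  "hN e p = ((hx p)\<^sup>2 + (hy p)\<^sup>2 + e)\<^sup>2 + (ht p)\<^sup>2"
definition hP :: "real \<Rightarrow> hpt \<Rightarrow> real" where
  "hP e p = 2 * hx p * ((hx p)\<^sup>2 + (hy p)\<^sup>2 + e) + 2 * hy p * ht p"
definition hQ :: "real \<Rightarrow> hpt \<Rightarrow> real" where
  "hQ e p = 2 * hy p * ((hx p)\<^sup>2 + (hy p)\<^sup>2 + e) - 2 * hx p * ht p"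
definition kernX :: "real \<Rightarrow> hpt \<Rightarrow> real" where "kernX e p = hP e p / (hN e p * sqrt (hN e p))"
definition kernY :: "real \<Rightarrow> hpt \<Rightarrow> real" where "kernY e p = hQ e p / (hN e p * sqrt (hN e p))"

lemma hN_pos:
  assumes "(hx p)\<^sup>2 + (hy p)\<^sup>2 + e > 0"
  shows "hN e p > 0"
  unfolding hN_def using zero_less_power[OF assms, of 2] by (rule add_pos_nonneg) simp

lemma hN_pos': "e > 0 \<Longrightarrow> hN e p > 0"
  by (rule hN_pos) (simp add: add_nonneg_pos)

lemma smooth_hN_hP_hQ: "smooth (hN e)" "smooth (hP e)" "smooth (hQ e)"
  unfolding hN_def[abs_def] hP_def[abs_def] hQ_def[abs_def]
  by (intro smooth_on_arith smooth_on_power open_UNIV smooth_on_const smooth_on_coords)+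

lemma smooth_kern:
  assumes "e > 0" shows "smooth (kernX e)" "smooth (kernY e)"
proof -
  have "smooth (\<lambda>p. sqrt (hN e p))"
    by (rule smooth_on_sqrt[OF open_UNIV smooth_hN_hP_hQ(1) hN_pos'[OF assms]])
  note d = smooth_on_arith(2)[OF open_UNIV smooth_hN_hP_hQ(1) this]
  have nz: "hN e p * sqrt (hN e p) \<noteq> 0" for p using hN_pos'[OF assms, of p] by simp
  show "smooth (kernX e)" "smooth (kernY e)"
    unfolding kernX_def[abs_def] kernY_def[abs_def]
    using smooth_on_arith(5)[OF open_UNIV smooth_hN_hP_hQ(2) d nz]
      smooth_on_arith(5)[OF open_UNIV smooth_hN_hP_hQ(3) d nz] by blast+
qed

text \<open>In complex form \<open>hP e + i hQ e = 2 z W\<close> with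
  \<open>W = |z|^2 + e - i t\<close>; the identity compares squared moduli.\<close>

lemma hP_sq_add_hQ_sq: "(hP e p)\<^sup>2 + (hQ e p)\<^sup>2 = 4 * ((hx p)\<^sup>2 + (hy p)\<^sup>2) * hN e p"
  unfolding hP_def hQ_def hN_def by algebra

lemmas has_derivative_coords = bounded_linear_coords[THEN bounded_linear_imp_has_derivative]

lemma Xd_hN_hP_hQ:
  "Xd (hN e) p = 2 * hP e p" "Yd (hN e) p = 2 * hQ e p"
  "Xd (hP e) p + Yd (hQ e) p = 4 * ((hx p)\<^sup>2 + (hy p)\<^sup>2 + e) + 8 * ((hx p)\<^sup>2 + (hy p)\<^sup>2)"
proof -
  have N: "(hN e has_derivative (\<lambda>v. 2 * ((hx p)\<^sup>2 + (hy p)\<^sup>2 + e) * (2 * hx p * hx v + 2 * hy p * hy v) + 2 * ht p * ht v)) (at p)"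
    unfolding hN_def[abs_def]
    by (auto intro!: derivative_eq_intros has_derivative_coords simp: algebra_simps)
  have P: "(hP e has_derivative (\<lambda>v. 2 * hx v * ((hx p)\<^sup>2 + (hy p)\<^sup>2 + e) + 2 * hx p * (2 * hx p * hx v + 2 * hy p * hy v)
     + 2 * hy v * ht p + 2 * hy p * ht v)) (at p)"
    unfolding hP_def[abs_def]
    by (auto intro!: derivative_eq_intros has_derivative_coords simp: algebra_simps)
  have Q: "(hQ e has_derivative (\<lambda>v. 2 * hy v * ((hx p)\<^sup>2 + (hy p)\<^sup>2 + e) + 2 * hy p * (2 * hx p * hx v + 2 * hy p * hy v)
     - 2 * hx v * ht p - 2 * hx p * ht v)) (at p)"
    unfolding hQ_def[abs_def]
    by (auto intro!: derivative_eq_intros has_derivative_coords simp: algebra_simps)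
  show "Xd (hN e) p = 2 * hP e p" "Yd (hN e) p = 2 * hQ e p"
    unfolding Xd_Yd_eq_ddir has_derivative_ddir[OF N] Xvec_def Yvec_def hP_def hQ_def
    by (simp_all add: algebra_simps)
  show "Xd (hP e) p + Yd (hQ e) p = 4 * ((hx p)\<^sup>2 + (hy p)\<^sup>2 + e) + 8 * ((hx p)\<^sup>2 + (hy p)\<^sup>2)"
    unfolding Xd_Yd_eq_ddir has_derivative_ddir[OF P] has_derivative_ddir[OF Q] Xvec_def Yvec_def
    by (simp add: algebra_simps power2_eq_square)
qed

text \<open>The term \<open>- 12 |z|^2\<close> from differentiating the power of \<open>hN e\<close>
  and the term \<open>12 |z|^2\<close> from the numerators cancel, and only a multiple of
  \<open>e\<close> remains: a positive function that concentrates at the origin as \<open>e\<close>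
  tends to 0.\<close>

lemma divergence_kern:
  assumes e: "e > 0"
  shows "Xd (kernX e) p + Yd (kernY e) p = 4 * e / (hN e p * sqrt (hN e p))"
proof -
  define n where "n = hN e p"
  define s where "s = sqrt n"
  have n: "n > 0" unfolding n_def by (rule hN_pos'[OF e])
  have s: "s > 0" "s * s = n" using n by (simp_all add: s_def)
  define h where "h = (\<lambda>n::real. inverse (n * sqrt n))"
  \<comment> \<open>\<open>h n\<close> is the power -3/2 of \<open>n\<close>, and
    \<open>n * n * s\<close> is its power 5/2.\<close>
  have Dh: "DERIV h n :> - (3 / 2) / (n * n * s)"
  proof -
    have "DERIV (\<lambda>n. n * sqrt n) n :> n * (inverse s / 2) + s"
      unfolding s_def using n by (auto intro!: derivative_eq_intros)
    from DERIV_inverse_fun[OF this] have "DERIV h n :> - ((n * (inverse s / 2) + s) * inverse ((n * s) ^ 2))"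
      using n s unfolding h_def s_def[symmetric] by (simp add: numeral_2_eq_2)
    moreover have "- ((n * (inverse s / 2) + s) * inverse ((n * s) ^ 2)) = - (3 / 2) / (n * n * s)"
      using s n by (simp add: field_simps power2_eq_square flip: s(2))
    ultimately show ?thesis by simp
  qed
  note dN = smooth_on_differentiable[OF smooth_hN_hP_hQ(1) UNIV_I, of e p]
  note dP = smooth_on_differentiable[OF smooth_hN_hP_hQ(2) UNIV_I, of e p]
  note dQ = smooth_on_differentiable[OF smooth_hN_hP_hQ(3) UNIV_I, of e p]
  note dh = differentiable_DERIV_comp[OF dN Dh[unfolded n_def]]
  have 1: "kernX e = (\<lambda>p. hP e p * h (hN e p))" "kernY e = (\<lambda>p. hQ e p * h (hN e p))"
    by (simp_all add: kernX_def[abs_def] kernY_def[abs_def] h_def divide_inverse)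
  have gen: "P * (- (3 / 2) / D * (2 * P)) + A * H + (Q * (- (3 / 2) / D * (2 * Q)) + B * H) =
    - 3 * (P\<^sup>2 + Q\<^sup>2) / D + (A + B) * H" for P Q A B D H :: real
    by (cases "D = 0") (simp_all add: field_simps power2_eq_square)
  have "Xd (kernX e) p + Yd (kernY e) p =
    hP e p * (- (3 / 2) / (n * n * s) * Xd (hN e) p) + Xd (hP e) p * h n +
    (hQ e p * (- (3 / 2) / (n * n * s) * Yd (hN e) p) + Yd (hQ e) p * h n)"
    unfolding 1 Xd_mult(1)[OF dP dh] Xd_mult(2)[OF dQ dh]
    using ddir_DERIV_comp[OF dN Dh[unfolded n_def]] by (simp add: Xd_Yd_eq_ddir n_def)
  also have "\<dots> = - 3 * ((hP e p)\<^sup>2 + (hQ e p)\<^sup>2) / (n * n * s) + (Xd (hP e) p + Yd (hQ e) p) * h n"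
    unfolding Xd_hN_hP_hQ(1,2) by (rule gen)
  also have "\<dots> = - 3 * (4 * ((hx p)\<^sup>2 + (hy p)\<^sup>2) * n) / (n * n * s) +
      (4 * ((hx p)\<^sup>2 + (hy p)\<^sup>2 + e) + 8 * ((hx p)\<^sup>2 + (hy p)\<^sup>2)) / (n * s)"
    unfolding hP_sq_add_hQ_sq Xd_hN_hP_hQ(3) h_def s_def n_def[symmetric] by (simp add: divide_inverse)
  also have "\<dots> = 4 * e / (n * s)" using n s by (simp add: field_simps)
  finally show ?thesis unfolding n_def s_def .
qed

text \<open>The length of the horizontal field \<open>(kernX e, kernY e)\<close> in closed form. It
  is also used for \<open>e = 0\<close>, as a majorant for all nonnegative \<open>e\<close>; on the
  t-axis it is 0, at the origin by the convention for division by zero.\<close>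

definition kern_size :: "real \<Rightarrow> hpt \<Rightarrow> real" where
  "kern_size e p = 2 * sqrt ((hx p)\<^sup>2 + (hy p)\<^sup>2) / hN e p"

lemma norm_kern:
  assumes "e > 0" shows "sqrt ((kernX e p)\<^sup>2 + (kernY e p)\<^sup>2) = kern_size e p"
proof -
  have n: "hN e p > 0" by (rule hN_pos'[OF assms])
  have "(kernX e p)\<^sup>2 + (kernY e p)\<^sup>2 = ((hP e p)\<^sup>2 + (hQ e p)\<^sup>2) / (hN e p * sqrt (hN e p))\<^sup>2"
    unfolding kernX_def kernY_def by (simp add: power_divide add_divide_distrib)
  also have "\<dots> = 4 * ((hx p)\<^sup>2 + (hy p)\<^sup>2) / (hN e p)\<^sup>2"
    unfolding hP_sq_add_hQ_sq using n by (simp add: power_mult_distrib field_simps power2_eq_square)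
  finally have "sqrt ((kernX e p)\<^sup>2 + (kernY e p)\<^sup>2) = sqrt (2\<^sup>2 * ((hx p)\<^sup>2 + (hy p)\<^sup>2) / (hN e p)\<^sup>2)" by simp
  then show ?thesis unfolding kern_size_def using n
    by (simp add: real_sqrt_divide real_sqrt_mult del: distrib_left_numeral)
qed

lemma kern_size_nonneg: "kern_size e p \<ge> 0"
  unfolding kern_size_def hN_def by simp

lemma kern_size_antimono: "e \<ge> 0 \<Longrightarrow> kern_size e p \<le> kern_size 0 p"
proof (cases "(hx p)\<^sup>2 + (hy p)\<^sup>2 = 0")
  case False
  assume e: "e \<ge> 0"
  have pos: "(hx p)\<^sup>2 + (hy p)\<^sup>2 > 0" using False by (simp add: order_less_le)
  then have "hN 0 p > 0" by (intro hN_pos) simp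
  moreover have "hN 0 p \<le> hN e p" unfolding hN_def using e power_mono[of "(hx p)\<^sup>2 + (hy p)\<^sup>2" "(hx p)\<^sup>2 + (hy p)\<^sup>2 + e" 2] by simp
  ultimately show ?thesis unfolding kern_size_def by (intro divide_left_mono) auto
qed (simp add: kern_size_def)

lemma continuous_kern_size: "e > 0 \<Longrightarrow> continuous_on S (kern_size e)"
  unfolding kern_size_def[abs_def]
  by (intro continuous_intros continuous_on_subset[OF smooth_on_continuous_on[OF smooth_hN_hP_hQ(1)]])
    (auto simp: hN_pos' less_imp_neq[symmetric])

lemma kern_size_measurable [measurable]: "kern_size e \<in> borel_measurable borel"
  unfolding kern_size_def[abs_def] hN_def[abs_def] by measurable

text \<open>The kernel has homogeneous degree -3. With \<open>\<rho> = |z|\<close> the point is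
  \<open>\<rho> * r^3 \<le> \<rho>^4 + t^2\<close>: clear if \<open>\<rho> \<ge> r\<close>, and
  otherwise \<open>t^2\<close> alone exceeds \<open>r^4\<close>.\<close>

lemma kern_size_far:
  assumes r: "r > 0" and far: "\<bar>hx p\<bar> > r \<or> \<bar>hy p\<bar> > r \<or> \<bar>ht p\<bar> > r\<^sup>2"
  shows "kern_size 0 p \<le> 2 / r ^ 3"
proof -
  define \<rho> where "\<rho> = sqrt ((hx p)\<^sup>2 + (hy p)\<^sup>2)"
  have \<rho>: "\<rho> \<ge> 0" "\<rho>\<^sup>2 = (hx p)\<^sup>2 + (hy p)\<^sup>2" unfolding \<rho>_def by simp_all
  have k: "kern_size 0 p = 2 * \<rho> / (\<rho> ^ 4 + (ht p)\<^sup>2)"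
    unfolding kern_size_def hN_def \<rho>_def[symmetric] \<rho>(2)[symmetric] using \<rho>(1) by simp
  have "\<rho> * r ^ 3 \<le> \<rho> ^ 4 + (ht p)\<^sup>2"
  proof (cases "\<rho> \<ge> r")
    case True
    then have "\<rho> * r ^ 3 \<le> \<rho> * \<rho> ^ 3" using r \<rho> by (intro mult_left_mono power_mono) auto
    also have "\<dots> = \<rho> ^ 4" by (simp add: power_Suc[symmetric] del: power_Suc)
    finally show ?thesis by (simp add: add_increasing2)
  next
    case False
    have "\<bar>hx p\<bar> \<le> \<rho>" "\<bar>hy p\<bar> \<le> \<rho>" unfolding \<rho>_def by (auto intro: real_le_rsqrt)
    then have "\<bar>ht p\<bar> > r\<^sup>2" using far False by linarith
    then have "(r\<^sup>2)\<^sup>2 \<le> \<bar>ht p\<bar>\<^sup>2" by (intro power_mono) auto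
    then have t: "r ^ 4 \<le> (ht p)\<^sup>2" by simp
    have "\<rho> * r ^ 3 \<le> r * r ^ 3" using False r by (intro mult_right_mono) auto
    also have "\<dots> = r ^ 4" by (simp add: power_Suc[symmetric] del: power_Suc)
    also have "\<dots> \<le> \<rho> ^ 4 + (ht p)\<^sup>2" using t by (simp add: add_increasing)
    finally show ?thesis .
  qed
  then have le: "2 * \<rho> \<le> 2 / r ^ 3 * (\<rho> ^ 4 + (ht p)\<^sup>2)"
    using r by (simp add: pos_le_divide_eq)
  have "\<rho> ^ 4 + (ht p)\<^sup>2 \<ge> 0" by simp
  then show ?thesis unfolding k using r le
    by (cases "\<rho> ^ 4 + (ht p)\<^sup>2 = 0") (simp_all add: pos_divide_le_eq order_less_le)
qed

text \<open>With \<open>m\<close> the larger of |z| and the root of |t|, the kernel is at most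
  \<open>2 |z| / m^4\<close>. The exponents 3/4, counted twice for t, add up to the degree 3, and
  being less than 1 they leave each one-variable factor integrable at 0.\<close>

lemma kern_size_product_bound:
  assumes nz: "hx p \<noteq> 0" "hy p \<noteq> 0" "ht p \<noteq> 0"
  shows "kern_size 0 p \<le> 2 * (\<bar>hx p\<bar> powr (-3/4) * (\<bar>hy p\<bar> powr (-3/4) * \<bar>ht p\<bar> powr (-3/4)))"
proof -
  define \<rho> where "\<rho> = sqrt ((hx p)\<^sup>2 + (hy p)\<^sup>2)"
  have \<rho>2: "\<rho>\<^sup>2 = (hx p)\<^sup>2 + (hy p)\<^sup>2" unfolding \<rho>_def by simp
  have \<rho>: "\<rho> > 0" unfolding \<rho>_def using nz by (simp add: add_pos_nonneg)
  have k: "kern_size 0 p = 2 * \<rho> / (\<rho> ^ 4 + (ht p)\<^sup>2)"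
    unfolding kern_size_def hN_def \<rho>_def[symmetric] \<rho>2[symmetric] using \<rho> by simp
  have xy: "\<bar>hx p\<bar> \<le> \<rho>" "\<bar>hy p\<bar> \<le> \<rho>" unfolding \<rho>_def by (auto intro: real_le_rsqrt)
  define m where "m = max \<rho> (sqrt \<bar>ht p\<bar>)"
  have m: "m > 0" "\<rho> \<le> m" "\<bar>ht p\<bar> \<le> m\<^sup>2" 
    unfolding m_def using \<rho> power_mono[of "sqrt \<bar>ht p\<bar>" "max \<rho> (sqrt \<bar>ht p\<bar>)" 2] by simp_all
  have m4: "m ^ 4 \<le> \<rho> ^ 4 + (ht p)\<^sup>2"
  proof (cases "m = \<rho>")
    case False
    then have "m = sqrt \<bar>ht p\<bar>" unfolding m_def by (auto simp: max_def split: if_splits)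
    then have "m\<^sup>2 = \<bar>ht p\<bar>" by simp
    then have "m ^ 4 = (ht p)\<^sup>2" by (metis power2_abs power_mult numeral_Bit0 mult_2 power_even_eq)
    then show ?thesis by simp
  qed simp
  have "\<rho> * (\<bar>hx p\<bar> powr (3/4) * (\<bar>hy p\<bar> powr (3/4) * \<bar>ht p\<bar> powr (3/4)))
     \<le> m * (m powr (3/4) * (m powr (3/4) * (m\<^sup>2) powr (3/4)))"
    using m xy \<rho> by (intro mult_mono powr_mono2 mult_nonneg_nonneg) auto
  also have "(m\<^sup>2) powr (3/4) = m powr (3/2)" using m by (simp add: powr_powr flip: powr_numeral)
  also have "m * (m powr (3/4) * (m powr (3/4) * m powr (3/2))) = m powr (1 + (3/4 + (3/4 + 3/2)))"
    using m by (simp only: powr_add powr_one)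
  also have "\<dots> = m ^ 4" using m by (simp add: powr_numeral)
  also note m4
  finally have "\<rho> * (\<bar>hx p\<bar> powr (3/4) * (\<bar>hy p\<bar> powr (3/4) * \<bar>ht p\<bar> powr (3/4))) \<le> \<rho> ^ 4 + (ht p)\<^sup>2" .
  moreover have "\<rho> ^ 4 + (ht p)\<^sup>2 > 0" using \<rho> by (simp add: add_pos_nonneg)
  ultimately show ?thesis unfolding k using nz
    by (simp add: powr_minus field_simps)
qed

lemma nn_integral_abs_powr:
  assumes r: "r \<ge> 0"
  shows "(\<integral>\<^sup>+x. ennreal (\<bar>x\<bar> powr (-3/4)) * indicator {-r..r} x \<partial>lborel) \<le> ennreal (8 * r powr (1/4))"
proof -
  define f :: "real \<Rightarrow> ennreal" where "f x = ennreal (\<bar>x\<bar> powr (-3/4)) * indicator {0..r} x" for x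
  have [measurable]: "f \<in> borel_measurable borel" unfolding f_def[abs_def] by measurable
  have h: "(\<integral>\<^sup>+x. f x \<partial>lborel) = ennreal (4 * r powr (1/4))"
  proof -
    have "((\<lambda>x. x powr (-3/4)) has_integral (4 * r powr (1/4))) {0..r}"
      using has_integral_powr_from_0[of "-3/4" r] r by (simp add: mult.commute)
    then have "((\<lambda>x. \<bar>x\<bar> powr (-3/4)) has_integral (4 * r powr (1/4))) {0..r}"
      by (rule has_integral_eq[rotated]) simp
    then have "(\<integral>\<^sup>+x. ennreal (indicator {0..r} x * \<bar>x\<bar> powr (-3/4)) \<partial>lborel) = ennreal (4 * r powr (1/4))"
      by (subst nn_integral_has_integral_lebesgue) auto
    then show ?thesis unfolding f_def by (simp add: ennreal_mult' ennreal_indicator mult.commute)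
  qed
  have "(\<integral>\<^sup>+x. ennreal (\<bar>x\<bar> powr (-3/4)) * indicator {-r..r} x \<partial>lborel) \<le> (\<integral>\<^sup>+x. f x + f (- x) \<partial>lborel)"
    unfolding f_def by (intro nn_integral_mono) (auto simp: indicator_def)
  also have "\<dots> = (\<integral>\<^sup>+x. f x \<partial>lborel) + (\<integral>\<^sup>+x. f (- x) \<partial>lborel)"
    by (rule nn_integral_add) measurable
  also have "(\<integral>\<^sup>+x. f (- x) \<partial>lborel) = (\<integral>\<^sup>+x. f x \<partial>lborel)"
    using nn_integral_real_affine[of f "-1" 0] by simp
  also have "(\<integral>\<^sup>+x. f x \<partial>lborel) + (\<integral>\<^sup>+x. f x \<partial>lborel) = ennreal (8 * r powr (1/4))"
    unfolding h by (simp add: ennreal_plus[symmetric] del: ennreal_plus)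
  finally show ?thesis .
qed

text \<open>Box adapted to the dilations: its volume is \<open>8 * r ^ 4\<close> for positive
  \<open>r\<close>, and its complement is where \<open>kern_size_far\<close> applies.\<close>

definition hbox :: "real \<Rightarrow> hpt set" where
  "hbox r = {p. \<bar>hx p\<bar> \<le> r \<and> \<bar>hy p\<bar> \<le> r \<and> \<bar>ht p\<bar> \<le> r\<^sup>2}"

lemma hbox_measurable [measurable]: "hbox r \<in> sets borel"
  unfolding hbox_def by measurable

text \<open>The product bound splits the integral into three one-variable ones: 1024 is
  \<open>2 * 8 * 8 * 8\<close>, and the exponents 1/4, 1/4 and twice 1/4 of \<open>r\<close> add up
  to 1.\<close>

lemma nn_integral_kern_size_hbox:
  assumes r: "r > 0"
  shows "(\<integral>\<^sup>+p. ennreal (kern_size 0 p) * indicator (hbox r) p \<partial>lborel) \<le> ennreal (1024 * r)"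
proof -
  define g :: "real \<Rightarrow> real \<Rightarrow> ennreal" where "g s x = ennreal (\<bar>x\<bar> powr (-3/4)) * indicator {-s..s} x" for s x
  have [measurable]: "g s \<in> borel_measurable borel" for s unfolding g_def[abs_def] by measurable
  have "(\<integral>\<^sup>+p. ennreal (kern_size 0 p) * indicator (hbox r) p \<partial>lborel) =
    (\<integral>\<^sup>+x. \<integral>\<^sup>+y. \<integral>\<^sup>+t. ennreal (kern_size 0 (x,y,t)) * indicator (hbox r) (x,y,t) \<partial>lborel \<partial>lborel \<partial>lborel)"
    by (rule nn_integral_hpt) measurable
  also have "\<dots> \<le> (\<integral>\<^sup>+x. \<integral>\<^sup>+y. \<integral>\<^sup>+t. 2 * (g r x * (g r y * g (r\<^sup>2) t)) \<partial>lborel \<partial>lborel \<partial>lborel)"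
  \<comment> \<open>The product bound asks for nonzero coordinates; the value 0 is a null set in
    each variable.\<close>
  proof (rule nn_integral_mono_AE, rule eventually_mono[OF AE_lborel_singleton[of 0]])
    fix x :: real assume x: "x \<noteq> 0"
    show "(\<integral>\<^sup>+y. \<integral>\<^sup>+t. ennreal (kern_size 0 (x,y,t)) * indicator (hbox r) (x,y,t) \<partial>lborel \<partial>lborel)
       \<le> (\<integral>\<^sup>+y. \<integral>\<^sup>+t. 2 * (g r x * (g r y * g (r\<^sup>2) t)) \<partial>lborel \<partial>lborel)"
    proof (rule nn_integral_mono_AE, rule eventually_mono[OF AE_lborel_singleton[of 0]])
      fix y :: real assume y: "y \<noteq> 0"
      show "(\<integral>\<^sup>+t. ennreal (kern_size 0 (x,y,t)) * indicator (hbox r) (x,y,t) \<partial>lborel)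
         \<le> (\<integral>\<^sup>+t. 2 * (g r x * (g r y * g (r\<^sup>2) t)) \<partial>lborel)"
      proof (rule nn_integral_mono_AE, rule eventually_mono[OF AE_lborel_singleton[of 0]])
        fix t :: real assume t: "t \<noteq> 0"
        show "ennreal (kern_size 0 (x,y,t)) * indicator (hbox r) (x,y,t) \<le> 2 * (g r x * (g r y * g (r\<^sup>2) t))"
        proof (cases "(x,y,t) \<in> hbox r")
          case True
          have "ennreal (kern_size 0 (x,y,t)) \<le> ennreal (2 * (\<bar>x\<bar> powr (-3/4) * (\<bar>y\<bar> powr (-3/4) * \<bar>t\<bar> powr (-3/4))))"
            using kern_size_product_bound[of "(x,y,t)"] x y t by (intro ennreal_leI) simp
          also have "\<dots> = 2 * (g r x * (g r y * g (r\<^sup>2) t))"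
            using True unfolding g_def hbox_def by (simp add: ennreal_mult' indicator_def abs_le_iff)
          finally show ?thesis using True by simp
        qed simp
      qed
    qed
  qed
  also have "\<dots> = 2 * ((\<integral>\<^sup>+x. g r x \<partial>lborel) * ((\<integral>\<^sup>+y. g r y \<partial>lborel) * (\<integral>\<^sup>+t. g (r\<^sup>2) t \<partial>lborel)))"
    by (simp add: nn_integral_cmult nn_integral_multc)
  also have "\<dots> \<le> 2 * (ennreal (8 * r powr (1/4)) * (ennreal (8 * r powr (1/4)) * ennreal (8 * (r\<^sup>2) powr (1/4))))"
    unfolding g_def using r by (intro mult_left_mono mult_mono nn_integral_abs_powr) auto
  also have "\<dots> = ennreal (1024 * (r powr (1/4) * (r powr (1/4) * (r\<^sup>2) powr (1/4))))"
    by (simp add: ennreal_mult'[symmetric] flip: ennreal_numeral)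
  also have "(r\<^sup>2) powr (1/4) = r powr (1/2)" using r by (simp add: powr_powr flip: powr_numeral)
  also have "r powr (1/4) * (r powr (1/4) * r powr (1/2)) = r powr (1/4 + (1/4 + 1/2))"
    by (simp only: powr_add)
  also have "\<dots> = r" using r by simp
  finally show ?thesis .
qed

text \<open>As a function of \<open>p\<close> this is a left translation, as a function of
  \<open>q\<close> an inversion followed by a right translation; both are triangular with Jacobian
  of modulus 1.\<close>

lemma hmult_hinv_haffine:
  "hmult (hinv q) p = haffine 1 1 1 (- hx q) (- hy q) (- ht q) (- 2 * hy q) (2 * hx q) p"
  "hmult (hinv q) p = haffine (-1) (-1) (-1) (hx p) (hy p) (ht p) (2 * hy p) (- 2 * hx p) q"
  unfolding hmult_def hinv_def haffine_def by simp_all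

lemma nn_integral_hmult_hinv:
  assumes "f \<in> borel_measurable borel"
  shows "(\<integral>\<^sup>+p. f (hmult (hinv q) p) \<partial>lborel) = (\<integral>\<^sup>+p. f p \<partial>lborel)"
    "(\<integral>\<^sup>+q. f (hmult (hinv q) p) \<partial>lborel) = (\<integral>\<^sup>+p. f p \<partial>lborel)"
  unfolding hmult_hinv_haffine(1)[of q]
   apply (subst nn_integral_haffine[OF assms, of 1 1 1 "- hx q" "- hy q" "- ht q" "- 2 * hy q" "2 * hx q"]; simp)
  unfolding hmult_hinv_haffine(2)[of _ p]
  by (subst nn_integral_haffine[OF assms, of "-1" "-1" "-1" "hx p" "hy p" "ht p" "2 * hy p" "- 2 * hx p"]; simp)

text \<open>The box has the size \<open>r = m powr (1/4)\<close> for which both contributions scale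
  alike: at most \<open>1024 * r\<close> inside, and at most \<open>2 / r ^ 3 * m = 2 * r\<close>
  outside.\<close>

lemma nn_integral_kern_size_le:
  assumes E: "E \<in> sets borel" and m: "m > 0" "emeasure lborel E \<le> ennreal m" and e: "e \<ge> 0"
  shows "(\<integral>\<^sup>+q. ennreal (kern_size e (hmult (hinv q) p)) * indicator E q \<partial>lborel) \<le> ennreal (1026 * m powr (1/4))"
proof -
  define r where "r = m powr (1/4)"
  have r: "r > 0" unfolding r_def using m by simp
  have r4: "r ^ 4 = m" unfolding r_def using m by (simp add: powr_power)
  define f where "f = (\<lambda>w. ennreal (kern_size 0 w) * indicator (hbox r) w)"
  have [measurable]: "f \<in> borel_measurable borel" unfolding f_def by measurable
  have [measurable]: "(\<lambda>q. f (hmult (hinv q) p)) \<in> borel_measurable borel"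
    unfolding hmult_def hinv_def by measurable
  have "(\<integral>\<^sup>+q. ennreal (kern_size e (hmult (hinv q) p)) * indicator E q \<partial>lborel) \<le>
     (\<integral>\<^sup>+q. f (hmult (hinv q) p) + ennreal (2 / r ^ 3) * indicator E q \<partial>lborel)"
  proof (rule nn_integral_mono)
    fix q :: hpt
    let ?w = "hmult (hinv q) p"
    have le: "kern_size e ?w \<le> kern_size 0 ?w" by (rule kern_size_antimono[OF e])
    show "ennreal (kern_size e ?w) * indicator E q \<le> f ?w + ennreal (2 / r ^ 3) * indicator E q"
    proof (cases "q \<in> E")
      case True
      show ?thesis
      proof (cases "?w \<in> hbox r")
        case in_box: True
        have "ennreal (kern_size e ?w) \<le> f ?w" unfolding f_def using in_box le by (simp add: ennreal_leI)
        then show ?thesis using True by (simp add: add_increasing2)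
      next
        case False
        then have "kern_size 0 ?w \<le> 2 / r ^ 3" by (intro kern_size_far r) (auto simp: hbox_def)
        then have "ennreal (kern_size e ?w) \<le> ennreal (2 / r ^ 3)" using le by (intro ennreal_leI) linarith
        then show ?thesis using True by (simp add: add_increasing)
      qed
    qed simp
  qed
  also have "\<dots> = (\<integral>\<^sup>+q. f (hmult (hinv q) p) \<partial>lborel) + ennreal (2 / r ^ 3) * emeasure lborel E"
    using E by (subst nn_integral_add) (simp_all add: nn_integral_cmult)
  also have "\<dots> \<le> ennreal (1024 * r) + ennreal (2 / r ^ 3) * ennreal m"
    using nn_integral_kern_size_hbox[OF r] m(2) nn_integral_hmult_hinv(2)[of f p]
    by (intro add_mono mult_left_mono) (auto simp: f_def)
  also have "\<dots> = ennreal (1024 * r + 2 / r ^ 3 * m)"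
    using r m by (simp add: ennreal_mult'[symmetric] ennreal_plus[symmetric] del: ennreal_plus)
  also have "2 / r ^ 3 * m = 2 * r" unfolding r4[symmetric] using r by (simp add: power_eq_if)
  finally show ?thesis unfolding r_def by simp
qed

lemma nn_integral_hbox: 
  assumes "s > 0" 
  shows "(\<integral>\<^sup>+p. indicator (hbox s) p \<partial>lborel) = ennreal (8 * s ^ 4)"
proof -
  have "hbox s = cbox (-s, -s, -s\<^sup>2) (s, s, s\<^sup>2)"
    unfolding hbox_def by (auto simp: cbox_Pair_eq hx_def hy_def ht_def abs_le_iff)
  then have "(\<integral>\<^sup>+p. indicator (hbox s) p \<partial>lborel) = emeasure lborel (cbox (-s, -s, -s\<^sup>2) (s, s, s\<^sup>2))" by simp
  also have "\<dots> = ennreal (measure lborel (cbox (-s, -s, -s\<^sup>2) (s, s, s\<^sup>2)))"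
    using emeasure_lborel_cbox_finite[of "(-s, -s, -s\<^sup>2)" "(s, s, s\<^sup>2)"]
    by (intro emeasure_eq_ennreal_measure) (simp add: less_top)
  also have "measure lborel (cbox (-s, -s, -s\<^sup>2) (s, s, s\<^sup>2)) = 8 * s ^ 4"
    unfolding content_Pair using assms by (simp add: power2_eq_square power4_eq_xxxx)
  finally show ?thesis .
qed

text \<open>With \<open>e\<close> equal to the square of \<open>s\<close>, the divergence dominates
  the indicator of \<open>hbox s\<close> divided by its volume: on the box \<open>hN\<close> is at
  most \<open>10 * s ^ 4\<close>, and the root of 10 is below 32/10, which yields exactly
  \<open>4 / 32 = 1 / 8\<close>.\<close>

lemma divergence_lower_bound:
  assumes s: "s > 0" and p: "p \<in> hbox s"
  shows "1 / (8 * s ^ 4) \<le> 4 * s\<^sup>2 / (hN (s\<^sup>2) p * sqrt (hN (s\<^sup>2) p))"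
proof -
  have "(hx p)\<^sup>2 \<le> s\<^sup>2" "(hy p)\<^sup>2 \<le> s\<^sup>2" "(ht p)\<^sup>2 \<le> (s\<^sup>2)\<^sup>2"
    using p power_mono[of "\<bar>hx p\<bar>" s 2] power_mono[of "\<bar>hy p\<bar>" s 2] power_mono[of "\<bar>ht p\<bar>" "s\<^sup>2" 2]
    unfolding hbox_def by simp_all
  then have "((hx p)\<^sup>2 + (hy p)\<^sup>2 + s\<^sup>2)\<^sup>2 \<le> (s\<^sup>2 + s\<^sup>2 + s\<^sup>2)\<^sup>2" "(ht p)\<^sup>2 \<le> (s\<^sup>2)\<^sup>2"
    by (intro power_mono, linarith, simp, simp)
  then have "hN (s\<^sup>2) p \<le> (s\<^sup>2 + s\<^sup>2 + s\<^sup>2)\<^sup>2 + (s\<^sup>2)\<^sup>2" unfolding hN_def by (rule add_mono)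
  also have "\<dots> = 10 * s ^ 4" by (simp add: power2_eq_square power4_eq_xxxx)
  finally have N: "hN (s\<^sup>2) p \<le> 10 * s ^ 4" .
  have "sqrt (hN (s\<^sup>2) p) \<le> sqrt ((32 / 10 * s\<^sup>2)\<^sup>2)"
    using N s by (intro real_sqrt_le_mono) (simp add: power_mult_distrib power_divide, smt (verit) zero_less_power)
  also have "\<dots> = 32 / 10 * s\<^sup>2" by simp
  finally have S: "sqrt (hN (s\<^sup>2) p) \<le> 32 / 10 * s\<^sup>2" .
  have pos: "hN (s\<^sup>2) p > 0" using s by (intro hN_pos') simp
  have "hN (s\<^sup>2) p * sqrt (hN (s\<^sup>2) p) \<le> 10 * s ^ 4 * (32 / 10 * s\<^sup>2)"
    using N S pos by (intro mult_mono) auto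
  also have "10 * s ^ 4 * (32 / 10 * s\<^sup>2) = 32 * s ^ 4 * s\<^sup>2" by algebra
  finally have "hN (s\<^sup>2) p * sqrt (hN (s\<^sup>2) p) \<le> 32 * s ^ 4 * s\<^sup>2" .
  then have "4 * s\<^sup>2 / (32 * s ^ 4 * s\<^sup>2) \<le> 4 * s\<^sup>2 / (hN (s\<^sup>2) p * sqrt (hN (s\<^sup>2) p))"
    using pos by (intro divide_left_mono) (use s in auto)
  moreover have "4 * s\<^sup>2 / (32 * s ^ 4 * s\<^sup>2) = 1 / (8 * s ^ 4)" using s by (simp add: field_simps)
  ultimately show ?thesis by simp
qed

lemma Xd_left_translation:
  fixes f :: "hpt \<Rightarrow> real"
  assumes f: "smooth f"
  shows "smooth (\<lambda>p. f (hmult (hinv q) p))"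
    "Xd (\<lambda>p. f (hmult (hinv q) p)) p = Xd f (hmult (hinv q) p)"
    "Yd (\<lambda>p. f (hmult (hinv q) p)) p = Yd f (hmult (hinv q) p)"
proof -
  define M where "M = (\<lambda>p. (hx p, hy p, ht p + (2 * hx q * hy p - 2 * hy q * hx p)))"
  have M: "bounded_linear M" unfolding M_def
    by (intro bounded_linear_Pair bounded_linear_add bounded_linear_sub
        bounded_linear_mult_right[THEN bounded_linear_compose] bounded_linear_coords)
  have A: "hmult (hinv q) p = M p + hinv q" for p
    unfolding hmult_def hinv_def M_def by simp
  show "smooth (\<lambda>p. f (hmult (hinv q) p))" by (rule smooth_affine_comp[OF M A f])
  have "M (Xvec p) = Xvec (hmult (hinv q) p)" "M (Yvec p) = Yvec (hmult (hinv q) p)"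
    unfolding M_def Xvec_def Yvec_def hmult_def hinv_def by simp_all
  then show "Xd (\<lambda>p. f (hmult (hinv q) p)) p = Xd f (hmult (hinv q) p)"
    "Yd (\<lambda>p. f (hmult (hinv q) p)) p = Yd f (hmult (hinv q) p)"
    unfolding Xd_Yd_eq_ddir
    using ddir_affine_comp(1)[where A="hmult (hinv q)", OF M A smooth_on_differentiable[OF f UNIV_I]] by simp_all
qed

text \<open>A Riemann sum: sampling at the points of a fine net \<open>J\<close> loses at most \<open>\<eta>\<close> per unit mass.\<close>
lemma weighted_net_bound:
  fixes k :: "'p \<Rightarrow> hpt \<Rightarrow> real"
  assumes "finite J" "J \<subseteq> K"
    and close: "\<And>p q q'. p \<in> S \<Longrightarrow> q \<in> J \<Longrightarrow> q' \<in> K \<Longrightarrow> dist q q' < d \<Longrightarrow> k p q \<le> k p q' + \<eta>"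
    and nonneg: "\<And>p q. k p q \<ge> 0" and \<eta>: "\<eta> \<ge> 0"
    and meas: "\<And>p. k p \<in> borel_measurable borel"
  shows "E \<in> sets borel \<Longrightarrow> E \<subseteq> K \<Longrightarrow> E \<subseteq> (\<Union>q\<in>J. ball q d) \<Longrightarrow> emeasure lborel E < \<infinity> \<Longrightarrow>
    \<exists>w. (\<forall>q. w q \<ge> 0) \<and> (\<Sum>q\<in>J. w q) = measure lborel E \<and>
      (\<forall>p\<in>S. ennreal (\<Sum>q\<in>J. w q * k p q) \<le> (\<integral>\<^sup>+q. ennreal (k p q + \<eta>) * indicator E q \<partial>lborel))"
  using assms(1,2) close
proof (induction arbitrary: E)
  case empty
  then have "E = {}" by simp
  then show ?case by (intro exI[of _ "\<lambda>_. 0"]) simp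
next
  case (insert i J)
  \<comment> \<open>\<open>E\<close> is split into the part near \<open>i\<close>, whose measure
    becomes the weight of \<open>i\<close>, and the rest, which is covered by the balls around
    \<open>J\<close>.\<close>
  define E1 where "E1 = E \<inter> ball i d"
  define E2 where "E2 = E - ball i d"
  have m: "E1 \<in> sets borel" "E2 \<in> sets borel" using insert.prems unfolding E1_def E2_def by auto
  have fin: "emeasure lborel E1 < \<infinity>" "emeasure lborel E2 < \<infinity>"
    using insert.prems(1,4) emeasure_mono[of E1 E lborel] emeasure_mono[of E2 E lborel]
    unfolding E1_def E2_def by (auto intro: le_less_trans)
  have "\<exists>w. (\<forall>q. w q \<ge> 0) \<and> (\<Sum>q\<in>J. w q) = measure lborel E2 \<and>
      (\<forall>p\<in>S. ennreal (\<Sum>q\<in>J. w q * k p q) \<le> (\<integral>\<^sup>+q. ennreal (k p q + \<eta>) * indicator E2 q \<partial>lborel))"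
    by (rule insert.IH) (use insert.prems m fin in \<open>auto simp: E2_def\<close>)
  then obtain w where w: "\<And>q. w q \<ge> 0" "(\<Sum>q\<in>J. w q) = measure lborel E2"
     "\<And>p. p \<in> S \<Longrightarrow> ennreal (\<Sum>q\<in>J. w q * k p q) \<le> (\<integral>\<^sup>+q. ennreal (k p q + \<eta>) * indicator E2 q \<partial>lborel)"
    by blast
  define w' where "w' = w(i := measure lborel E1)"
  have sum: "(\<Sum>q\<in>insert i J. w' q * g q) = measure lborel E1 * g i + (\<Sum>q\<in>J. w q * g q)" for g
    using insert.hyps unfolding w'_def by (simp add: sum.insert) (auto intro!: sum.cong)
  have part: "indicator E q = (indicator E1 q + indicator E2 q :: ennreal)" for q
    unfolding E1_def E2_def by (auto simp: indicator_def)
  have "(\<Sum>q\<in>insert i J. w' q) = measure lborel E1 + measure lborel E2"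
    using sum[of "\<lambda>_. 1"] w(2) by simp
  also have "\<dots> = measure lborel (E1 \<union> E2)"
    using m fin by (intro measure_Union[symmetric]) (auto simp: E1_def E2_def)
  also have "E1 \<union> E2 = E" unfolding E1_def E2_def by blast
  finally have 1: "(\<Sum>q\<in>insert i J. w' q) = measure lborel E" .
  have 2: "ennreal (\<Sum>q\<in>insert i J. w' q * k p q) \<le> (\<integral>\<^sup>+q. ennreal (k p q + \<eta>) * indicator E q \<partial>lborel)"
    if p: "p \<in> S" for p
  proof -
    have "ennreal (measure lborel E1 * k p i) = (\<integral>\<^sup>+q. ennreal (k p i) * indicator E1 q \<partial>lborel)"
      using m fin nonneg
      by (subst nn_integral_cmult_indicator)
        (auto simp: ennreal_mult' emeasure_eq_ennreal_measure less_top mult.commute)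
    also have "\<dots> \<le> (\<integral>\<^sup>+q. ennreal (k p q + \<eta>) * indicator E1 q \<partial>lborel)"
    proof (rule nn_integral_mono)
      fix q
      have "k p i \<le> k p q + \<eta>" if "q \<in> E1"
        using insert.prems(6)[of p i q] that p insert.prems(2) unfolding E1_def by auto
      then show "ennreal (k p i) * indicator E1 q \<le> ennreal (k p q + \<eta>) * indicator E1 q"
        by (cases "q \<in> E1") (auto intro: ennreal_leI)
    qed
    finally have "ennreal (measure lborel E1 * k p i) + ennreal (\<Sum>q\<in>J. w q * k p q) \<le>
      (\<integral>\<^sup>+q. ennreal (k p q + \<eta>) * indicator E1 q \<partial>lborel) + (\<integral>\<^sup>+q. ennreal (k p q + \<eta>) * indicator E2 q \<partial>lborel)"
      using w(3)[OF p] by (rule add_mono)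
    also have "\<dots> = (\<integral>\<^sup>+q. ennreal (k p q + \<eta>) * indicator E q \<partial>lborel)"
      unfolding part distrib_left using m meas[of p] by (intro nn_integral_add[symmetric]) auto
    finally show ?thesis unfolding sum using w(1) nonneg
      by (subst ennreal_plus) (auto intro!: sum_nonneg)
  qed
  show ?case using 1 2 w(1) by (intro exI[of _ w']) (auto simp: w'_def)
qed

lemma exists_compact_half:
  fixes \<Omega> :: "hpt set"
  assumes "open \<Omega>" "bounded \<Omega>" "measure lborel \<Omega> > 0"
  obtains K where "compact K" "K \<subseteq> \<Omega>" "measure lborel K \<ge> measure lborel \<Omega> / 2"
proof -
  have fin: "emeasure lborel \<Omega> < \<infinity>" using emeasure_bounded_finite[OF assms(2)] .
  obtain T where T: "closed T" "T \<subseteq> \<Omega>" "emeasure lebesgue (\<Omega> - T) < ennreal (measure lborel \<Omega> / 2)"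
    by (rule sets_lebesgue_inner_closed[of \<Omega> "measure lborel \<Omega> / 2"]) (use assms in auto)
  have "emeasure lborel (\<Omega> - T) < ennreal (measure lborel \<Omega> / 2)"
    using T assms(1) by (simp add: emeasure_completion)
  moreover from this have "emeasure lborel (\<Omega> - T) \<noteq> top" by auto
  ultimately have "measure lborel (\<Omega> - T) < measure lborel \<Omega> / 2"
    using assms(3) by (simp add: emeasure_eq_ennreal_measure ennreal_less_iff)
  moreover have "measure lborel (\<Omega> - T) = measure lborel \<Omega> - measure lborel T"
    using T assms(1) fin by (intro measure_Diff) auto
  ultimately have "measure lborel T \<ge> measure lborel \<Omega> / 2" by linarith
  moreover have "compact T" using T assms(2) bounded_subset compact_eq_bounded_closed by blast
  ultimately show ?thesis using that T by blast
qed

text \<open>Membership in the translated box bounds the Euclidean distance of \<open>p\<close> and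
  \<open>q\<close> by a multiple of \<open>s\<close> that depends only on the bound \<open>R\<close>
  of \<open>K\<close>, because the group twist is at most \<open>4 * R * s\<close>; it stays below
  the distance from \<open>K\<close> to the complement of \<open>\<Omega>\<close>.\<close>

lemma exists_uniform_hbox:
  fixes K \<Omega> :: "hpt set"
  assumes K: "compact K" "K \<subseteq> \<Omega>" and \<Omega>: "open \<Omega>"
  obtains s where "s > 0" "\<And>q p. q \<in> K \<Longrightarrow> hmult (hinv q) p \<in> hbox s \<Longrightarrow> p \<in> \<Omega>"
proof -
  obtain d where d: "d > 0" "\<And>x y. x \<in> K \<Longrightarrow> y \<in> - \<Omega> \<Longrightarrow> d \<le> dist x y"
    using separate_compact_closed[OF K(1) closed_Compl[OF \<Omega>]] K(2) by (metis disjoint_eq_subset_Compl double_complement)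
  obtain R where R: "R > 0" "\<And>q. q \<in> K \<Longrightarrow> norm q \<le> R"
    using compact_imp_bounded[OF K(1)] unfolding bounded_pos by auto
  \<comment> \<open>The minimum with 1 bounds the square of \<open>s\<close> by \<open>s\<close>;
    the summand 4, where 3 arises below, makes the final inequality strict.\<close>
  define s where "s = min 1 (d / (4 + 4 * R))"
  have s: "s > 0" "s \<le> 1" unfolding s_def using d R by auto
  have s': "s * (4 + 4 * R) \<le> d"
    using R(1) pos_le_divide_eq[of "4 + 4 * R" s d] by (simp add: s_def)
  have "p \<in> \<Omega>" if q: "q \<in> K" and w: "hmult (hinv q) p \<in> hbox s" for q p
  proof (rule ccontr)
    assume "p \<notin> \<Omega>"
    then have far: "d \<le> norm (q - p)" using d(2)[OF q, of p] by (simp add: dist_norm)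
    define a b c where "a = hx p - hx q" and "b = hy p - hy q" and "c = ht p - ht q"
    have ab: "\<bar>a\<bar> \<le> s" "\<bar>b\<bar> \<le> s" "\<bar>c - 2 * hy q * a + 2 * hx q * b\<bar> \<le> s\<^sup>2"
      using w unfolding hbox_def hmult_def hinv_def a_def b_def c_def by (simp_all add: algebra_simps)
    have "\<bar>hx q\<bar> \<le> norm q" "\<bar>hy q\<bar> \<le> norm q"
      by (rule power2_le_imp_le; simp add: norm_hpt)+
    then have q': "\<bar>hx q\<bar> \<le> R" "\<bar>hy q\<bar> \<le> R" using R(2)[OF q] by linarith+
    have "\<bar>hy q * a\<bar> \<le> R * s" "\<bar>hx q * b\<bar> \<le> R * s"
      unfolding abs_mult using q' ab R by (intro mult_mono; simp)+
    moreover have "s\<^sup>2 \<le> s" using s by (simp add: power2_eq_square mult_left_le)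
    ultimately have c: "\<bar>c\<bar> \<le> s + 4 * (R * s)" using ab(3) by linarith
    have "norm (q - p) \<le> \<bar>a\<bar> + \<bar>b\<bar> + \<bar>c\<bar>"
    proof -
      have "norm (q - p) \<le> norm (fst (q - p)) + norm (snd (q - p))"
        using norm_Pair_le[of "fst (q - p)" "snd (q - p)"] by (simp only: prod.collapse)
      also have "norm (fst (q - p)) = norm (hx q - hx p)" by (simp add: hx_def)
      also have "norm (snd (q - p)) \<le> norm (fst (snd (q - p))) + norm (snd (snd (q - p)))"
        using norm_Pair_le[of "fst (snd (q - p))" "snd (snd (q - p))"] by (simp only: prod.collapse)
      also have "norm (fst (snd (q - p))) = norm (hy q - hy p)" by (simp add: hy_def)
      also have "norm (snd (snd (q - p))) = norm (ht q - ht p)" by (simp add: ht_def)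
      finally show ?thesis unfolding a_def b_def c_def by (simp add: abs_minus_commute)
    qed
    also have "\<dots> \<le> s + s + (s + 4 * (R * s))" using ab c by linarith
    also have "\<dots> < s * (4 + 4 * R)" using s by (simp add: algebra_simps)
    finally show False using far s' by linarith
  qed
  then show ?thesis using that s by blast
qed

lemma norm_sum_pair_le:
  fixes a b :: "'i \<Rightarrow> real"
  assumes "\<And>i. i \<in> J \<Longrightarrow> w i \<ge> 0"
  shows "sqrt ((\<Sum>i\<in>J. w i * a i)\<^sup>2 + (\<Sum>i\<in>J. w i * b i)\<^sup>2) \<le> (\<Sum>i\<in>J. w i * sqrt ((a i)\<^sup>2 + (b i)\<^sup>2))"
proof -
  have "sqrt ((\<Sum>i\<in>J. w i * a i)\<^sup>2 + (\<Sum>i\<in>J. w i * b i)\<^sup>2) = norm (\<Sum>i\<in>J. w i *\<^sub>R (a i, b i))"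
    by (simp add: norm_Pair fst_sum snd_sum norm_prod_def)
  also have "\<dots> \<le> (\<Sum>i\<in>J. norm (w i *\<^sub>R (a i, b i)))" by (rule norm_sum)
  also have "\<dots> = (\<Sum>i\<in>J. w i * sqrt ((a i)\<^sup>2 + (b i)\<^sup>2))"
    using assms by (intro sum.cong) (simp_all add: norm_Pair del: scaleR_Pair)
  finally show ?thesis .
qed

text \<open>The net lies in a compact \<open>K\<close> because for \<open>q\<close> near the
  frontier the box translated by \<open>q\<close> would leave \<open>\<Omega>\<close>, and mass
  outside is not counted. The constant 1027 is 1026 for the kernel plus 1 for the discretisation
  error.\<close>

lemma exists_calibrating_field:
  assumes \<Omega>: "open \<Omega>" "bounded \<Omega>" and m: "m = measure lborel \<Omega>" "m > 0"
  obtains \<phi>1 \<phi>2 :: "hpt \<Rightarrow> real" where "test_fun \<phi>1" "test_fun \<phi>2"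
    "\<And>p. sqrt ((\<phi>1 p)\<^sup>2 + (\<phi>2 p)\<^sup>2) \<le> 1027 * m powr (1/4)"
    "integral\<^sup>L lborel (\<lambda>p. indicator \<Omega> p * (Xd \<phi>1 p + Yd \<phi>2 p)) \<ge> m / 2"
proof -
  obtain K where K: "compact K" "K \<subseteq> \<Omega>" "measure lborel K \<ge> m / 2"
    using exists_compact_half[OF \<Omega>] m by blast
  obtain s where s: "s > 0" "\<And>q p. q \<in> K \<Longrightarrow> hmult (hinv q) p \<in> hbox s \<Longrightarrow> p \<in> \<Omega>"
    using exists_uniform_hbox[OF K(1,2) \<Omega>(1)] by blast
  define e where "e = s\<^sup>2"
  have e: "e > 0" using s by (simp add: e_def)
  obtain R where R: "R > 0" "\<And>p. p \<in> \<Omega> \<Longrightarrow> norm p < R"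
    using \<Omega>(2) unfolding bounded_pos_less by auto
  obtain \<eta> :: "hpt \<Rightarrow> real" where \<eta>: "test_fun \<eta>" "\<And>p. 0 \<le> \<eta> p" "\<And>p. \<eta> p \<le> 1"
    "\<And>p. dist 0 p \<le> R \<Longrightarrow> \<eta> p = 1" "\<And>p. dist 0 p \<ge> 2 * R \<Longrightarrow> \<eta> p = 0"
    by (rule exists_bump[of R "0::hpt", OF R(1)]) blast
  \<comment> \<open>The cutoff vanishes outside \<open>S\<close>, so the kernel has to be estimated
    only for \<open>p\<close> in this compact set.\<close>
  define S where "S = cball (0::hpt) (2 * R)"
  define k where "k = (\<lambda>p q. kern_size e (hmult (hinv q) p))"
  \<comment> \<open>\<open>\<delta>\<close> is chosen so that the error per unit mass, summed over
    mass at most \<open>m\<close>, amounts to at most \<open>m powr (1/4)\<close>.\<close>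
  define \<delta> where "\<delta> = m powr (1/4) / m"
  have \<delta>: "\<delta> > 0" "\<delta> * m = m powr (1/4)" using m by (simp_all add: \<delta>_def)
  have cont: "continuous_on (S \<times> K) (\<lambda>z. k (fst z) (snd z))"
    unfolding k_def hmult_def hinv_def
    by (intro continuous_on_compose2[OF continuous_kern_size[OF e, of UNIV]] continuous_intros
        continuous_on_compose2[OF continuous_coords(1)[of UNIV]] continuous_on_compose2[OF continuous_coords(2)[of UNIV]]
        continuous_on_compose2[OF continuous_coords(3)[of UNIV]]) auto
  have "uniformly_continuous_on (S \<times> K) (\<lambda>z. k (fst z) (snd z))"
    by (rule compact_uniformly_continuous[OF cont]) (auto intro!: compact_Times K simp: S_def)
  then obtain d where d: "d > 0" "\<And>z z'. z \<in> S \<times> K \<Longrightarrow> z' \<in> S \<times> K \<Longrightarrow> dist z' z < d \<Longrightarrow>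
      dist (k (fst z') (snd z')) (k (fst z) (snd z)) < \<delta>"
    using \<delta>(1) unfolding uniformly_continuous_on_def by metis
  have close: "k p q \<le> k p q' + \<delta>" if "p \<in> S" "q \<in> K" "q' \<in> K" "dist q q' < d" for p q q'
  proof -
    have "dist (p, q) (p, q') < d" using that by (simp add: dist_Pair_Pair)
    then have "dist (k p q) (k p q') < \<delta>" using d(2)[of "(p, q')" "(p, q)"] that by simp
    then show ?thesis by (simp add: dist_real_def)
  qed
  have "K \<subseteq> (\<Union>q\<in>K. ball q d)" using d(1) by (intro subsetI UN_I) auto
  then obtain J where J: "J \<subseteq> K" "finite J" "K \<subseteq> (\<Union>q\<in>J. ball q d)"
    using compactE_image[OF K(1), of K "\<lambda>q. ball q d"] by (metis open_ball)
  have Kb: "K \<in> sets borel" using K(1) by (simp add: borel_compact)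
  have Kfin: "emeasure lborel K < \<infinity>" using emeasure_compact_finite[OF K(1)] .
  have fin\<Omega>: "emeasure lborel \<Omega> < \<infinity>" using emeasure_bounded_finite[OF \<Omega>(2)] .
  have k0: "k p q \<ge> 0" for p q unfolding k_def by (rule kern_size_nonneg)
  have km: "k p \<in> borel_measurable borel" for p
    unfolding k_def hmult_def hinv_def by measurable
  have "\<exists>w. (\<forall>q. w q \<ge> 0) \<and> (\<Sum>q\<in>J. w q) = measure lborel K \<and>
      (\<forall>p\<in>S. ennreal (\<Sum>q\<in>J. w q * k p q) \<le> (\<integral>\<^sup>+q. ennreal (k p q + \<delta>) * indicator K q \<partial>lborel))"
    by (rule weighted_net_bound[OF J(2,1), where S=S and d=d])
      (use close J k0 \<delta> km Kb Kfin in \<open>auto simp: subset_iff\<close>)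
  then obtain w where w: "\<And>q. w q \<ge> 0" "(\<Sum>q\<in>J. w q) = measure lborel K"
    "\<And>p. p \<in> S \<Longrightarrow> ennreal (\<Sum>q\<in>J. w q * k p q) \<le> (\<integral>\<^sup>+q. ennreal (k p q + \<delta>) * indicator K q \<partial>lborel)"
    by blast
  have Km: "emeasure lborel K \<le> ennreal m"
    using emeasure_mono[OF K(2), of lborel] \<Omega>(1) fin\<Omega> unfolding m(1)
    by (simp add: emeasure_eq_ennreal_measure less_top)
  have sum_le: "(\<Sum>q\<in>J. w q * k p q) \<le> 1027 * m powr (1/4)" if p: "p \<in> S" for p
  proof -
    note w(3)[OF p]
    also have "(\<integral>\<^sup>+q. ennreal (k p q + \<delta>) * indicator K q \<partial>lborel) =
      (\<integral>\<^sup>+q. ennreal (k p q) * indicator K q \<partial>lborel) + (\<integral>\<^sup>+q. ennreal \<delta> * indicator K q \<partial>lborel)"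
      using k0 \<delta>(1) km[of p] Kb by (subst nn_integral_add[symmetric]) (auto simp: distrib_right)
    also have "\<dots> \<le> ennreal (1026 * m powr (1/4)) + ennreal \<delta> * ennreal m"
    proof (rule add_mono)
      show "(\<integral>\<^sup>+q. ennreal (k p q) * indicator K q \<partial>lborel) \<le> ennreal (1026 * m powr (1/4))"
        unfolding k_def by (rule nn_integral_kern_size_le[OF Kb m(2) Km]) (use e in simp)
      show "(\<integral>\<^sup>+q. ennreal \<delta> * indicator K q \<partial>lborel) \<le> ennreal \<delta> * ennreal m"
        using Kb Km by (simp add: nn_integral_cmult mult_left_mono)
    qed
    also have "\<dots> = ennreal (1027 * m powr (1/4))"
      using \<delta> m by (simp add: ennreal_mult'[symmetric] ennreal_plus[symmetric] del: ennreal_plus)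
    finally show ?thesis by (subst (asm) ennreal_le_iff) simp_all
  qed
  define F1 where "F1 = (\<lambda>p. \<Sum>q\<in>J. w q * kernX e (hmult (hinv q) p))"
  define F2 where "F2 = (\<lambda>p. \<Sum>q\<in>J. w q * kernY e (hmult (hinv q) p))"
  note sk = smooth_kern[OF e]
  note tr = Xd_left_translation[OF sk(1)] Xd_left_translation[OF sk(2)]
  have sm: "smooth (\<lambda>p. w q * kernX e (hmult (hinv q) p))" "smooth (\<lambda>p. w q * kernY e (hmult (hinv q) p))" for q
    by (intro smooth_on_arith(2) open_UNIV smooth_on_const tr)+
  have F: "smooth F1" "smooth F2" unfolding F1_def F2_def by (intro smooth_on_sum open_UNIV sm)+
  have Xsum: "ddir v (\<lambda>p. \<Sum>q\<in>I. g q p) p = (\<Sum>q\<in>I. ddir v (g q) p)"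
    if "finite I" "\<And>q. smooth (g q)" for g :: "hpt \<Rightarrow> hpt \<Rightarrow> real" and I v p
    using that(1)
  proof induction
    case (insert i I)
    have "ddir v (\<lambda>p. g i p + (\<Sum>q\<in>I. g q p)) p = ddir v (g i) p + ddir v (\<lambda>p. \<Sum>q\<in>I. g q p) p"
      by (intro ddir_arith smooth_on_differentiable[OF _ UNIV_I] that(2) smooth_on_sum open_UNIV)
    then show ?case using insert by simp
  qed simp
  have divF: "Xd F1 p + Yd F2 p = (\<Sum>q\<in>J. w q * (4 * e / (hN e (hmult (hinv q) p) * sqrt (hN e (hmult (hinv q) p)))))" for p
  proof -
    have "Xd F1 p = (\<Sum>q\<in>J. Xd (\<lambda>p. w q * kernX e (hmult (hinv q) p)) p)"
      "Yd F2 p = (\<Sum>q\<in>J. Yd (\<lambda>p. w q * kernY e (hmult (hinv q) p)) p)"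
      unfolding Xd_Yd_eq_ddir F1_def F2_def by (intro Xsum J sm)+
    moreover have "Xd (\<lambda>p. w q * kernX e (hmult (hinv q) p)) p = w q * Xd (kernX e) (hmult (hinv q) p)"
      "Yd (\<lambda>p. w q * kernY e (hmult (hinv q) p)) p = w q * Yd (kernY e) (hmult (hinv q) p)" for q
      using Xd_cmult(1)[OF smooth_on_differentiable[OF tr(1) UNIV_I]] tr(2)
        Xd_cmult(2)[OF smooth_on_differentiable[OF tr(4) UNIV_I]] tr(6) by simp_all
    ultimately show ?thesis
      by (simp add: sum.distrib[symmetric] distrib_left[symmetric] divergence_kern[OF e])
  qed
  define \<phi>1 where "\<phi>1 = (\<lambda>p. F1 p * \<eta> p)"
  define \<phi>2 where "\<phi>2 = (\<lambda>p. F2 p * \<eta> p)"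
  have t: "test_fun \<phi>1" "test_fun \<phi>2" unfolding \<phi>1_def \<phi>2_def by (intro test_fun_mult F \<eta>)+
  have size: "sqrt ((\<phi>1 p)\<^sup>2 + (\<phi>2 p)\<^sup>2) \<le> 1027 * m powr (1/4)" for p
  proof (cases "p \<in> S")
    case True
    have "sqrt ((\<phi>1 p)\<^sup>2 + (\<phi>2 p)\<^sup>2) = \<eta> p * sqrt ((F1 p)\<^sup>2 + (F2 p)\<^sup>2)"
      unfolding \<phi>1_def \<phi>2_def using \<eta>(2)[of p]
      by (simp add: power_mult_distrib distrib_right[symmetric] real_sqrt_mult mult.commute)
    also have "\<dots> \<le> sqrt ((F1 p)\<^sup>2 + (F2 p)\<^sup>2)" using \<eta>(2,3)[of p] by (simp add: mult_left_le_one_le)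
    also have "\<dots> \<le> (\<Sum>q\<in>J. w q * k p q)"
      unfolding F1_def F2_def k_def norm_kern[OF e, symmetric] by (intro norm_sum_pair_le w)
    finally show ?thesis using sum_le[OF True] by linarith
  next
    case False
    then show ?thesis using \<eta>(5)[of p] by (simp add: \<phi>1_def \<phi>2_def S_def)
  qed
  have div\<phi>: "Xd \<phi>1 p + Yd \<phi>2 p = Xd F1 p + Yd F2 p" if "p \<in> \<Omega>" for p
  proof -
    have "Xd \<phi>1 p = Xd F1 p" "Yd \<phi>2 p = Yd F2 p"
      by (rule Xd_cong_open[OF \<Omega>(1) that]; use R(2) \<eta>(4) in \<open>simp add: \<phi>1_def \<phi>2_def less_imp_le\<close>)+
    then show ?thesis by simp
  qed
  \<comment> \<open>\<open>B q\<close> is the normalised indicator of the box translated by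
    \<open>q\<close>. It lies below the divergence of the translated kernel, has integral 1, and for
    \<open>q\<close> in \<open>J\<close> vanishes off \<open>\<Omega>\<close>.\<close>
  define B where "B q p = 1 / (8 * s ^ 4) * indicator (hbox s) (hmult (hinv q) p)" for q p
  have Bm: "B q \<in> borel_measurable borel" for q
    unfolding B_def[abs_def] hmult_def hinv_def by measurable
  have Bnn: "(\<integral>\<^sup>+p. ennreal (B q p) \<partial>lborel) = 1" for q
  proof -
    have "(\<integral>\<^sup>+p. ennreal (B q p) \<partial>lborel) = (\<integral>\<^sup>+p. ennreal (1 / (8 * s ^ 4)) * indicator (hbox s) (hmult (hinv q) p) \<partial>lborel)"
      unfolding B_def using s by (intro nn_integral_cong) (simp add: indicator_def)
    also have "\<dots> = (\<integral>\<^sup>+p. ennreal (1 / (8 * s ^ 4)) * indicator (hbox s) p \<partial>lborel)"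
      by (rule nn_integral_hmult_hinv(1)[of "\<lambda>p. ennreal (1 / (8 * s ^ 4)) * indicator (hbox s) p"]) measurable
    also have "\<dots> = ennreal (1 / (8 * s ^ 4)) * ennreal (8 * s ^ 4)"
      using nn_integral_hbox[OF s(1)] by (subst nn_integral_cmult) simp_all
    also have "\<dots> = 1" using s by (simp add: ennreal_mult'[symmetric])
    finally show ?thesis .
  qed
  have B0: "B q p \<ge> 0" for q p unfolding B_def by simp
  have Bint: "integrable lborel (B q)" "integral\<^sup>L lborel (B q) = 1" for q
  proof -
    show "integrable lborel (B q)"
      using Bm Bnn B0 by (intro integrableI_nonneg) auto
    show "integral\<^sup>L lborel (B q) = 1" using Bm Bnn B0 by (subst integral_eq_nn_integral) auto
  qed
  have "m / 2 \<le> (\<Sum>q\<in>J. w q)" using K(3) w(2) by simp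
  also have "\<dots> = integral\<^sup>L lborel (\<lambda>p. \<Sum>q\<in>J. w q * B q p)" by (simp add: Bint)
  also have "\<dots> \<le> integral\<^sup>L lborel (\<lambda>p. indicator \<Omega> p * (Xd \<phi>1 p + Yd \<phi>2 p))"
  proof (rule integral_mono)
    show "integrable lborel (\<lambda>p. \<Sum>q\<in>J. w q * B q p)" by (simp add: Bint)
    have "integrable lborel (\<lambda>p. Xd \<phi>1 p + Yd \<phi>2 p)"
      by (intro Bochner_Integration.integrable_add test_fun_integrable test_fun_Xd_Yd t)
    then show "integrable lborel (\<lambda>p. indicator \<Omega> p * (Xd \<phi>1 p + Yd \<phi>2 p))"
      using integrable_mult_indicator[of \<Omega> lborel "\<lambda>p. Xd \<phi>1 p + Yd \<phi>2 p"] \<Omega>(1) by simp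
    fix p
    show "(\<Sum>q\<in>J. w q * B q p) \<le> indicator \<Omega> p * (Xd \<phi>1 p + Yd \<phi>2 p)"
    proof (cases "p \<in> \<Omega>")
      case True
      have "B q p \<le> 4 * e / (hN e (hmult (hinv q) p) * sqrt (hN e (hmult (hinv q) p)))" for q
      proof (cases "hmult (hinv q) p \<in> hbox s")
        case True
        then show ?thesis unfolding B_def e_def using divergence_lower_bound[OF s(1) True] by simp
      next
        case False
        then show ?thesis unfolding B_def using hN_pos'[OF e, of "hmult (hinv q) p"] e by simp
      qed
      then have "(\<Sum>q\<in>J. w q * B q p) \<le> Xd F1 p + Yd F2 p"
        unfolding divF by (intro sum_mono mult_left_mono w)
      then show ?thesis using div\<phi>[OF True] True by simp
    next
      case False
      have "B q p = 0" if "q \<in> J" for q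
        using s(2)[of q p] that J(1) False unfolding B_def by (auto simp: indicator_def)
      then show ?thesis using False by simp
    qed
  qed
  finally show ?thesis using that[OF t size] by blast
qed

section \<open>Volume and area for a constant conformal factor\<close>

lemma integral_dv: "integral\<^sup>L dv (f :: hpt \<Rightarrow> real) = 4 * integral\<^sup>L lborel f" if "f \<in> borel_measurable borel"
proof -
  have "dv = density lborel (\<lambda>_. ennreal 4)" unfolding dv_def by simp
  then have "integral\<^sup>L dv f = integral\<^sup>L (density lborel (\<lambda>_. ennreal 4)) f" by simp
  also have "\<dots> = integral\<^sup>L lborel (\<lambda>p. 4 *\<^sub>R f p)"
    by (rule integral_density) (use that in auto)
  finally show ?thesis by simp
qed

text \<open>The calibrating field, scaled to pointwise length at most \<open>exp (3 * c)\<close>,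
  competes in the supremum; the density 4 of \<open>dv\<close> turns \<open>m / 2\<close> into
  \<open>2 * m\<close>.\<close>

lemma area_const_ge:
  assumes \<Omega>: "smooth_bounded_domain \<Omega>" and u: "\<And>p. u p = c" and m: "m = measure lborel \<Omega>" "m > 0"
  shows "area_u u \<Omega> \<ge> 2 / 1027 * exp (3 * c) * m powr (3/4)"
proof -
  have op: "open \<Omega>" "bounded \<Omega>" using \<Omega> unfolding smooth_bounded_domain_def by auto
  define a where "a = exp (3 * c)"
  have a: "a > 0" unfolding a_def by simp
  define A where "A = {integral\<^sup>L dv (\<lambda>p. indicator \<Omega> p * (Xd \<phi>1 p + Yd \<phi>2 p)) | \<phi>1 \<phi>2.
       test_fun (\<phi>1 :: hpt \<Rightarrow> real) \<and> test_fun (\<phi>2 :: hpt \<Rightarrow> real) \<and>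
       (\<forall>p. (\<phi>1 p)^2 + (\<phi>2 p)^2 \<le> (exp (3 * u p))^2)}"
  have meas: "(\<lambda>p. indicator \<Omega> p * h p) \<in> borel_measurable borel" if "test_fun h" for h :: "hpt \<Rightarrow> real"
    using test_fun_measurable[OF that] op by simp
  have int: "integrable lborel (\<lambda>p. indicator \<Omega> p * h p)" if "test_fun h" for h :: "hpt \<Rightarrow> real"
    using integrable_mult_indicator[of \<Omega> lborel h] op test_fun_integrable[OF that] by simp
  have val: "integral\<^sup>L dv (\<lambda>p. indicator \<Omega> p * (Xd f p + Yd g p)) =
      4 * integral\<^sup>L lborel (\<lambda>p. indicator \<Omega> p * (Xd f p + Yd g p))"
    if "test_fun f" "test_fun g" for f g :: "hpt \<Rightarrow> real"
    by (intro integral_dv meas test_fun_arith test_fun_Xd_Yd that)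
  obtain B1 where B1: "\<And>f. test_fun f \<Longrightarrow> (\<forall>p. \<bar>f p\<bar> \<le> (1::real)) \<Longrightarrow>
     \<bar>integral\<^sup>L lborel (\<lambda>p. indicator \<Omega> p * Xd f p)\<bar> \<le> B1"
    using finite_perimeter[OF _ \<Omega>, of Xvec] unfolding left_invariant_field_def Xd_Yd_eq_ddir by auto
  obtain B2 where B2: "\<And>f. test_fun f \<Longrightarrow> (\<forall>p. \<bar>f p\<bar> \<le> (1::real)) \<Longrightarrow>
     \<bar>integral\<^sup>L lborel (\<lambda>p. indicator \<Omega> p * Yd f p)\<bar> \<le> B2"
    using finite_perimeter[OF _ \<Omega>, of Yvec] unfolding left_invariant_field_def Xd_Yd_eq_ddir by auto
  have scale: "test_fun (\<lambda>p. t * f p)" "integral\<^sup>L lborel (\<lambda>p. indicator \<Omega> p * Xd (\<lambda>p. t * f p) p) = t * integral\<^sup>L lborel (\<lambda>p. indicator \<Omega> p * Xd f p)"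
    "integral\<^sup>L lborel (\<lambda>p. indicator \<Omega> p * Yd (\<lambda>p. t * f p) p) = t * integral\<^sup>L lborel (\<lambda>p. indicator \<Omega> p * Yd f p)"
    if f: "test_fun f" for f :: "hpt \<Rightarrow> real" and t :: real
  proof -
    show "test_fun (\<lambda>p. t * f p)" by (intro test_fun_mult smooth_on_const f)
    show "integral\<^sup>L lborel (\<lambda>p. indicator \<Omega> p * Xd (\<lambda>p. t * f p) p) = t * integral\<^sup>L lborel (\<lambda>p. indicator \<Omega> p * Xd f p)"
      "integral\<^sup>L lborel (\<lambda>p. indicator \<Omega> p * Yd (\<lambda>p. t * f p) p) = t * integral\<^sup>L lborel (\<lambda>p. indicator \<Omega> p * Yd f p)"
      by (simp_all add: Xd_cmult[OF test_fun_differentiable[OF f]] mult.left_commute)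
  qed
  have split: "integral\<^sup>L lborel (\<lambda>p. indicator \<Omega> p * (Xd f p + Yd g p)) =
     integral\<^sup>L lborel (\<lambda>p. indicator \<Omega> p * Xd f p) + integral\<^sup>L lborel (\<lambda>p. indicator \<Omega> p * Yd g p)"
    if "test_fun f" "test_fun g" for f g :: "hpt \<Rightarrow> real"
    unfolding distrib_left
    by (rule Bochner_Integration.integral_add[OF int[OF test_fun_Xd_Yd(1)[OF that(1)]] int[OF test_fun_Xd_Yd(2)[OF that(2)]]])
  \<comment> \<open>Required by \<open>cSup_upper\<close>: finite perimeter is proved for functions
    bounded by 1 and is rescaled by \<open>a\<close>, component by component.\<close>
  have bdd: "bdd_above A"
  proof (rule bdd_aboveI)
    fix x assume "x \<in> A"
    then obtain f g :: "hpt \<Rightarrow> real" where fg: "test_fun f" "test_fun g" "\<And>p. (f p)\<^sup>2 + (g p)\<^sup>2 \<le> a\<^sup>2"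
      and x: "x = integral\<^sup>L dv (\<lambda>p. indicator \<Omega> p * (Xd f p + Yd g p))"
      unfolding A_def u a_def by auto
    have "\<bar>f p\<bar> \<le> a" "\<bar>g p\<bar> \<le> a" for p
      using fg(3)[of p] a zero_le_power2[of "f p"] zero_le_power2[of "g p"]
      by (intro power2_le_iff_abs_le[THEN iffD1], simp, linarith)+
    then have le: "\<forall>p. \<bar>1 / a * f p\<bar> \<le> 1" "\<forall>p. \<bar>1 / a * g p\<bar> \<le> 1"
      using a by (simp_all add: abs_mult)
    note sf = scale[OF fg(1), of "1 / a"] and sg = scale[OF fg(2), of "1 / a"]
    have "\<bar>1 / a * integral\<^sup>L lborel (\<lambda>p. indicator \<Omega> p * Xd f p)\<bar> \<le> B1"
      using B1[OF sf(1) le(1)] unfolding sf(2) .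
    moreover have "\<bar>1 / a * integral\<^sup>L lborel (\<lambda>p. indicator \<Omega> p * Yd g p)\<bar> \<le> B2"
      using B2[OF sg(1) le(2)] unfolding sg(3) .
    ultimately have "integral\<^sup>L lborel (\<lambda>p. indicator \<Omega> p * Xd f p) \<le> B1 * a"
      "integral\<^sup>L lborel (\<lambda>p. indicator \<Omega> p * Yd g p) \<le> B2 * a"
      using a by (simp_all add: abs_mult divide_le_eq)
    then show "x \<le> 4 * (B1 * a + B2 * a)" unfolding x val[OF fg(1,2)] split[OF fg(1,2)] by simp
  qed
  obtain \<phi>1 \<phi>2 :: "hpt \<Rightarrow> real" where \<phi>: "test_fun \<phi>1" "test_fun \<phi>2"
    "\<And>p. sqrt ((\<phi>1 p)\<^sup>2 + (\<phi>2 p)\<^sup>2) \<le> 1027 * m powr (1/4)"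
    "integral\<^sup>L lborel (\<lambda>p. indicator \<Omega> p * (Xd \<phi>1 p + Yd \<phi>2 p)) \<ge> m / 2"
    using exists_calibrating_field[OF op m] by blast
  define M where "M = 1027 * m powr (1/4)"
  have M: "M > 0" using m unfolding M_def by simp
  define t where "t = a / M"
  have t: "t > 0" using a M by (simp add: t_def)
  note s1 = scale[OF \<phi>(1), of t] and s2 = scale[OF \<phi>(2), of t]
  have "integral\<^sup>L dv (\<lambda>p. indicator \<Omega> p * (Xd (\<lambda>p. t * \<phi>1 p) p + Yd (\<lambda>p. t * \<phi>2 p) p)) \<in> A"
  proof -
    have "(t * \<phi>1 p)\<^sup>2 + (t * \<phi>2 p)\<^sup>2 \<le> a\<^sup>2" for p
    proof -
      have "(\<phi>1 p)\<^sup>2 + (\<phi>2 p)\<^sup>2 \<le> M\<^sup>2" using \<phi>(3)[of p] unfolding M_def[symmetric] by (rule sqrt_le_D)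
      then have "t\<^sup>2 * ((\<phi>1 p)\<^sup>2 + (\<phi>2 p)\<^sup>2) \<le> t\<^sup>2 * M\<^sup>2" by (intro mult_left_mono) auto
      also have "t\<^sup>2 * M\<^sup>2 = a\<^sup>2" using M unfolding t_def by (simp add: power_divide)
      finally show ?thesis by (simp add: power_mult_distrib distrib_left)
    qed
    then show ?thesis unfolding A_def u a_def[symmetric] using s1(1) s2(1) by blast
  qed
  then have "integral\<^sup>L dv (\<lambda>p. indicator \<Omega> p * (Xd (\<lambda>p. t * \<phi>1 p) p + Yd (\<lambda>p. t * \<phi>2 p) p)) \<le> area_u u \<Omega>"
    unfolding area_u_def A_def[symmetric] using bdd by (rule cSup_upper)
  moreover have "integral\<^sup>L dv (\<lambda>p. indicator \<Omega> p * (Xd (\<lambda>p. t * \<phi>1 p) p + Yd (\<lambda>p. t * \<phi>2 p) p)) =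
     4 * t * integral\<^sup>L lborel (\<lambda>p. indicator \<Omega> p * (Xd \<phi>1 p + Yd \<phi>2 p))"
    unfolding val[OF s1(1) s2(1)] split[OF s1(1) s2(1)] split[OF \<phi>(1,2)] s1(2) s2(3) by (simp add: algebra_simps)
  moreover have "4 * t * (m / 2) \<le> 4 * t * integral\<^sup>L lborel (\<lambda>p. indicator \<Omega> p * (Xd \<phi>1 p + Yd \<phi>2 p))"
    using \<phi>(4) t by (intro mult_left_mono) auto
  moreover have "4 * t * (m / 2) = 2 / 1027 * exp (3 * c) * m powr (3/4)"
  proof -
    have "m = m powr (1/4) * m powr (3/4)" using m by (simp flip: powr_add)
    then show ?thesis unfolding t_def M_def a_def using m by (simp add: field_simps)
  qed
  ultimately show ?thesis by linarith
qed

text \<open>The conformal factor cancels: \<open>exp (3 * c)\<close> to the power 4/3 is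
  \<open>exp (4 * c)\<close>, and likewise \<open>m powr (3/4)\<close> returns \<open>m\<close>. The
  constant is the density 4 times the power that cancels 2/1027.\<close>

lemma isoperimetric_const:
  assumes \<Omega>: "smooth_bounded_domain \<Omega>" and u: "\<And>p. u p = c"
  shows "vol_u u \<Omega> \<le> 4 * (1027 / 2) powr (4/3) * area_u u \<Omega> powr (4/3)"
proof -
  have op: "open \<Omega>" "bounded \<Omega>" "\<Omega> \<noteq> {}" using \<Omega> unfolding smooth_bounded_domain_def by auto
  define m where "m = measure lborel \<Omega>"
  have fin: "emeasure lborel \<Omega> < \<infinity>" using emeasure_bounded_finite[OF op(2)] .
  obtain p e where pe: "e > 0" "ball p e \<subseteq> \<Omega>" using op open_contains_ball by (metis ex_in_conv)
  have "measure lborel (ball p e) \<le> m" unfolding m_def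
    using pe op fin by (intro measure_mono_fmeasurable) (auto simp: fmeasurable_def)
  then have m: "m > 0" using content_ball_pos[OF pe(1), of p] by linarith
  have "vol_u u \<Omega> = 4 * (m * exp (4 * c))"
    unfolding vol_u_def u using op by (subst integral_dv) (simp_all add: m_def)
  also have "\<dots> = 4 * (1027 / 2) powr (4/3) * (2 / 1027 * exp (3 * c) * m powr (3/4)) powr (4/3)"
  proof -
    have 1: "(2 / 1027 * exp (3 * c) * m powr (3/4)) powr (4/3) = (2 / 1027) powr (4/3) * (exp (4 * c) * m)"
      using m by (simp only: powr_mult powr_powr exp_powr_real) simp
    have 2: "(1027 / 2) powr (4/3) * (2 / 1027) powr (4/3) = (1::real)"
      by (subst powr_mult[symmetric]) simp_all
    have "4 * (1027 / 2) powr (4/3) * (2 / 1027 * exp (3 * c) * m powr (3/4)) powr (4/3) =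
        4 * ((1027 / 2) powr (4/3) * (2 / 1027) powr (4/3)) * (exp (4 * c) * m)"
      unfolding 1 by (simp only: mult.assoc)
    then show ?thesis unfolding 2 by (simp only: mult.commute mult_1_right)
  qed
  also have "\<dots> \<le> 4 * (1027 / 2) powr (4/3) * area_u u \<Omega> powr (4/3)"
    using area_const_ge[OF \<Omega> u m_def m] m by (intro mult_left_mono powr_mono2) auto
  finally show ?thesis .
qed

theorem theorem1p1:
  shows "\<exists>C :: real \<Rightarrow> real. \<forall>u :: hpt \<Rightarrow> real.
    (smooth u \<and> pluriharmonic u \<and> complete_cr u \<and>
     (\<forall>p. Qprime u p \<ge> 0) \<and>
     (\<exists>K. compact K \<and> (\<forall>p. p \<notin> K \<longrightarrow> - sublap u p \<ge> grad_b_sq u p)) \<and>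
     integrable dv (\<lambda>p. Qprime u p * exp (4 * u p)) \<and>
     integral\<^sup>L dv (\<lambda>p. Qprime u p * exp (4 * u p)) < c1')
    \<longrightarrow> (\<forall>\<Omega>. smooth_bounded_domain \<Omega> \<longrightarrow>
          vol_u u \<Omega> \<le> C (integral\<^sup>L dv (\<lambda>p. Qprime u p * exp (4 * u p))) * area_u u \<Omega> powr (4/3))"
\<comment> \<open>By rigidity \<open>u\<close> is constant, and for constants the inequality holds
  with one absolute constant, so \<open>C\<close> is taken to be a constant function.\<close>
proof (intro exI[of _ "\<lambda>_. 4 * (1027 / 2) powr (4/3)"] allI impI, elim conjE exE)
  fix u :: "hpt \<Rightarrow> real" and \<Omega> K
  assume "smooth u" "pluriharmonic u" "\<forall>p. Qprime u p \<ge> 0" "compact K"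
    "\<forall>p. p \<notin> K \<longrightarrow> - sublap u p \<ge> grad_b_sq u p"
    "integrable dv (\<lambda>p. Qprime u p * exp (4 * u p))" and \<Omega>: "smooth_bounded_domain \<Omega>"
  then have "u p = u 0" for p using pluriharmonic_liouville[of u K p 0] by blast
  then show "vol_u u \<Omega> \<le> 4 * (1027 / 2) powr (4/3) * area_u u \<Omega> powr (4/3)"
    by (rule isoperimetric_const[OF \<Omega>])
qed

end
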